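(* There is an absolute constant $C$ such that for any integers $r>s>1$, the number of primes $p$ with $N_p(r,s)>4$ is at most $C\,rs/\log(rs)$.
   Context: For a prime $p$ and positive integers $r,s$, $N_p(r,s)$ denotes the number of solutions $(x,y)\in\mathbb{F}_p^*\times\mathbb{F}_p^*$ of the system $x^r=y^r+1$, $x^s=y^s+1$, $x=y+1$; equivalently, it counts common zeros $y$ in $\mathbb{F}_p$ of the polynomials $F_r(Y)=(Y+1)^r-Y^r-1$ and $F_s(Y)=(Y+1)^s-Y^s-1$ subject to $y\neq 0$, $y+1\neq 0$. *)

theory Defs
  imports Complex_Main "HOL-Number_Theory.Number_Theory"
begin

text \<open>The field with \<open>p\<close> elements is rendered as the library's \<^const>\<open>residue_ring\<close> (carrier
  \<open>{0..p - 1}\<close>, arithmetic modulo \<open>p\<close>); this is meant for prime \<open>p\<close> only.\<close>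

definition sol_set :: "nat \<Rightarrow> nat \<Rightarrow> nat \<Rightarrow> (int \<times> int) set" where
  "sol_set p r s = (let F = residue_ring (int p) in
     {(x, y). x \<in> carrier F - {\<zero>\<^bsub>F\<^esub>} \<and> y \<in> carrier F - {\<zero>\<^bsub>F\<^esub>} \<and>
        x [^]\<^bsub>F\<^esub> r = y [^]\<^bsub>F\<^esub> r \<oplus>\<^bsub>F\<^esub> \<one>\<^bsub>F\<^esub> \<and>
        x [^]\<^bsub>F\<^esub> s = y [^]\<^bsub>F\<^esub> s \<oplus>\<^bsub>F\<^esub> \<one>\<^bsub>F\<^esub> \<and>
        x = y \<oplus>\<^bsub>F\<^esub> \<one>\<^bsub>F\<^esub>})"

definition N :: "nat \<Rightarrow> nat \<Rightarrow> nat \<Rightarrow> nat" where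
  "N p r s = card (sol_set p r s)"

end

theory Submission
  imports Defs "Berlekamp_Zassenhaus.Factor_Bound" "HOL-Complex_Analysis.Cauchy_Integral_Theorem"
begin

text \<open>By a theorem of Beukers, for \<open>1 < s < r\<close> the polynomials \<open>(y + 1)\<^sup>r - y\<^sup>r - 1\<close> and
  \<open>(y + 1)\<^sup>s - y\<^sup>s - 1\<close> have no common complex zeros other than \<open>0\<close>, \<open>-1\<close> and the primitive cube roots
  of unity. Hence the product of the values of the first polynomial at the remaining zeros of the
  second, cleared of denominators, is a nonzero integer \<open>Q\<close> of size \<open>e\<^bsup>O(rs)\<^esup>\<close>. If \<open>N p r s > 4\<close>, then modulo \<open>p\<close>
  there is a common zero outside the four trivial ones, so \<open>p\<close> divides \<open>Q\<close>; and \<open>Q\<close> has only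
  \<open>O(rs / log(rs))\<close> prime divisors.

  For Beukers' theorem let \<open>y\<close> be a nontrivial common zero. The \<open>p\<close>-adic places are realised as valuation
  rings of the complex numbers, so that no number fields are needed. If \<open>y\<close> or \<open>y + 1\<close> is not a unit at such a
  place, then binomial expansions give \<open>3 (r - s) \<le> s\<close>; but the norm of \<open>(y + 1)\<^bsup>r-s\<^esup> - y\<^bsup>r-s\<^esup>\<close> is divisible
  by so much that \<open>r - s\<close> cannot be this small, in view of Zagier's lower bound \<open>M\<^sup>1\<^sup>0 \<ge> (27/4)\<^sup>d\<close> for
  the height \<open>M\<close> of \<open>(y + 1 : y : 1)\<close>, with \<open>d\<close> the degree of \<open>y\<close>. If \<open>y\<close> and \<open>y + 1\<close> are units, some
  conjugate satisfies \<open>|y (y + 1)|\<^sup>2 \<le> |y\<^sup>2 + y + 1|\<^sup>3\<close>, and comparing logarithms for it gives \<open>65 s \<le> r\<close>. Then the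
  hypergeometric (Pade) linear forms vanishing at \<open>(y + 1)\<^sup>s - y\<^sup>s - 1 = 0\<close> produce a nonzero algebraic
  integer of norm less than 1.\<close>

hide_const (open) UnivPoly.coeff UnivPoly.monom Module.smult

section \<open>Existence of valuation rings\<close>

text \<open>The unit property is wanted because the size of the Pade forms carries the factor |y (y
  + 1)|^((2 n + 1) s), which disappears from the product over the conjugates only if y and y + 1
  have norm 1. What remains is a contest between binomial coefficients of size (27/4)^n and Zagier's
  lower bound. Its constant 27/4 is the same, so only exponents are compared: a contradiction needs
  (n - 2) s + 1 > 10 (n + 1). This fails for every n if s <= 10, whence the separate treatment of
  those exponents, and holds for s >= 11 as soon as n >= 32. Since 2 n + 1 is at most r / s, this
  asks for r / s >= 65, which the archimedean comparison supplies from a single well-placed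
  conjugate. The places of the complex numbers have non-discrete value groups, so valuations are
  never numbers here: sizes are compared through divisibility, units and membership in the maximal
  ideal.\<close>

definition is_subring :: "'a::field set \<Rightarrow> bool" where
  "is_subring S \<longleftrightarrow> 1 \<in> S \<and> (\<forall>x\<in>S. \<forall>y\<in>S. x - y \<in> S \<and> x * y \<in> S)"

text \<open>The whole field qualifies as well; a place over p is singled out by
  \<open>of_nat p \<in> max_ideal V\<close>.\<close>

definition valuation_ring :: "'a::field set \<Rightarrow> bool" where
  "valuation_ring V \<longleftrightarrow> is_subring V \<and> (\<forall>x. x \<in> V \<or> inverse x \<in> V)"

lemma is_subringD:
  assumes "is_subring S"
  shows "1 \<in> S" "0 \<in> S" "x \<in> S \<Longrightarrow> y \<in> S \<Longrightarrow> x + y \<in> S" "x \<in> S \<Longrightarrow> y \<in> S \<Longrightarrow> x - y \<in> S"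
    "x \<in> S \<Longrightarrow> y \<in> S \<Longrightarrow> x * y \<in> S" "x \<in> S \<Longrightarrow> - x \<in> S" "x \<in> S \<Longrightarrow> x ^ n \<in> S"
proof -
  show 1: "1 \<in> S" using assms by (auto simp: is_subring_def)
  have d: "x - y \<in> S" if "x \<in> S" "y \<in> S" for x y using assms that by (auto simp: is_subring_def)
  have m: "x * y \<in> S" if "x \<in> S" "y \<in> S" for x y using assms that by (auto simp: is_subring_def)
  show 0: "0 \<in> S" using d[OF 1 1] by simp
  have n: "- x \<in> S" if "x \<in> S" for x using d[OF 0 that] by simp
  show "x \<in> S \<Longrightarrow> y \<in> S \<Longrightarrow> x + y \<in> S" using d[of x "- y"] n[of y] by simp
  show "x \<in> S \<Longrightarrow> y \<in> S \<Longrightarrow> x - y \<in> S" by (rule d)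
  show "x \<in> S \<Longrightarrow> y \<in> S \<Longrightarrow> x * y \<in> S" by (rule m)
  show "x \<in> S \<Longrightarrow> - x \<in> S" by (rule n)
  show "x \<in> S \<Longrightarrow> x ^ n \<in> S" by (induction n) (auto simp: 1 m)
qed

lemma is_subring_sum:
  assumes "is_subring S" "\<And>i. i \<in> A \<Longrightarrow> f i \<in> S"
  shows "sum f A \<in> S"
  using assms(2) by (induction A rule: infinite_finite_induct) (auto intro: is_subringD[OF assms(1)])

lemma is_subring_of_nat: "is_subring S \<Longrightarrow> of_nat n \<in> S"
  by (induction n) (auto intro: is_subringD)

lemma is_subring_of_int: "is_subring S \<Longrightarrow> of_int k \<in> S"
  by (cases k) (auto intro: is_subringD is_subring_of_nat simp del: of_nat_Suc)

lemma is_subring_Union_chain: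
  assumes "C \<noteq> {}" "\<And>S. S \<in> C \<Longrightarrow> is_subring S" "\<And>S T. S \<in> C \<Longrightarrow> T \<in> C \<Longrightarrow> S \<subseteq> T \<or> T \<subseteq> S"
  shows "is_subring (\<Union>C)"
  unfolding is_subring_def
proof (intro conjI ballI)
  show "1 \<in> \<Union>C" using assms(1,2) is_subringD(1) by blast
  fix x y assume "x \<in> \<Union>C" "y \<in> \<Union>C"
  then obtain S where S: "S \<in> C" "x \<in> S" "y \<in> S" using assms(3) by blast
  show "x - y \<in> \<Union>C" "x * y \<in> \<Union>C"
    using S is_subringD(4,5)[OF assms(2)[OF S(1)], of x y] by (auto intro!: UnionI[OF S(1)])
qed

text \<open>The coefficient set is arbitrary because it is also taken to be the ideal c S, which
  carries the relations f(z) = 1 in Chevalley's argument.\<close>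

definition polys_over :: "'a::field set \<Rightarrow> 'a poly set" where
  "polys_over S = {f. \<forall>i. coeff f i \<in> S}"

definition adjoin :: "'a::field set \<Rightarrow> 'a \<Rightarrow> 'a set" where
  "adjoin S z = (\<lambda>f. poly f z) ` polys_over S"

lemma polys_over_mult:
  "is_subring S \<Longrightarrow> f \<in> polys_over S \<Longrightarrow> g \<in> polys_over S \<Longrightarrow> f * g \<in> polys_over S"
  by (auto simp: polys_over_def coeff_mult intro!: is_subring_sum is_subringD(5))

lemma is_subring_adjoin:
  assumes "is_subring S"
  shows "is_subring (adjoin S z)"
  unfolding is_subring_def
proof (intro conjI ballI)
  have "1 \<in> polys_over S" by (auto simp: polys_over_def is_subringD[OF assms])
  then show "1 \<in> adjoin S z" by (force simp: adjoin_def)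
  fix x y assume "x \<in> adjoin S z" "y \<in> adjoin S z"
  then obtain f g where fg: "f \<in> polys_over S" "g \<in> polys_over S" "x = poly f z" "y = poly g z"
    by (auto simp: adjoin_def)
  have "f - g \<in> polys_over S"
    using fg is_subringD[OF assms] by (auto simp: polys_over_def)
  then show "x - y \<in> adjoin S z" using fg by (force simp: adjoin_def)
  show "x * y \<in> adjoin S z" using fg polys_over_mult[OF assms fg(1,2)] by (force simp: adjoin_def)
qed

lemma subset_adjoin: "is_subring S \<Longrightarrow> S \<subseteq> adjoin S z"
proof
  fix x assume S: "is_subring S" and x: "x \<in> S"
  have "[:x:] \<in> polys_over S" using x is_subringD(2)[OF S] by (auto simp: polys_over_def coeff_pCons split: nat.split)
  then show "x \<in> adjoin S z" by (force simp: adjoin_def)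
qed

lemma mem_adjoin: "is_subring S \<Longrightarrow> z \<in> adjoin S z"
proof -
  assume S: "is_subring S"
  have "[:0, 1:] \<in> polys_over S" using is_subringD[OF S] by (auto simp: polys_over_def coeff_pCons split: nat.split)
  then show ?thesis by (force simp: adjoin_def)
qed

text \<open>Chevalley's elimination step: with \<open>g(1/z) = 1\<close> and \<open>g\<close> of degree at most that of \<open>f\<close>,
  the leading term of \<open>f\<close> can be rewritten in lower powers of \<open>z\<close>.\<close>

lemma reduce_degree:
  assumes S: "is_subring S" and z: "z \<noteq> 0"
    and f: "f \<in> polys_over (times c ` S)" "poly f z = 1"
    and g: "g \<in> polys_over (times c ` S)" "poly g (inverse z) = 1"
    and c: "c \<in> S" and deg: "degree g \<le> degree f" "degree f > 0"
    and u: "inverse (1 - coeff g 0) \<in> S" "1 - coeff g 0 \<noteq> 0"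
  shows "\<exists>f' \<in> polys_over (times c ` S). poly f' z = 1 \<and> degree f' < degree f"
proof -
  define n where "n = degree f"
  define m where "m = degree g"
  define v where "v = inverse (1 - coeff g 0)"
  define I where "I = times c ` S"
  have I_add: "x + y \<in> I" if "x \<in> I" "y \<in> I" for x y
    using that by (auto simp: I_def distrib_left[symmetric] intro: is_subringD[OF S])
  have I0: "0 \<in> I" using is_subringD(2)[OF S] by (force simp: I_def)
  have I_sum: "sum h A \<in> I" if "\<And>i. i \<in> A \<Longrightarrow> h i \<in> I" for h :: "nat \<Rightarrow> 'a" and A
    using that by (induction A rule: infinite_finite_induct) (auto intro: I_add I0)
  have I_mult: "x * y \<in> I" if "x \<in> S" "y \<in> I" for x y
  proof -
    from that obtain w where "w \<in> S" "y = c * w" by (auto simp: I_def)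
    then show ?thesis using is_subringD(5)[OF S that(1), of w] by (auto simp: I_def mult.left_commute)
  qed
  have IS: "x \<in> S" if "x \<in> I" for x using that c by (auto simp: I_def intro: is_subringD[OF S])
  have fI: "coeff f i \<in> I" and gI: "coeff g i \<in> I" for i using f g by (auto simp: polys_over_def I_def)
  define f' where "f' = (f - monom (coeff f n) n) + (\<Sum>j\<in>{1..m}. monom (coeff f n * (v * coeff g j)) (n - j))"
  have zn: "z ^ n = (\<Sum>j\<in>{1..m}. v * coeff g j * z ^ (n - j))"
  proof -
    have "1 = (\<Sum>j\<le>m. coeff g j * inverse z ^ j)" using g(2) by (simp add: poly_altdef m_def)
    also have "\<dots> = coeff g 0 + (\<Sum>j\<in>{1..m}. coeff g j * inverse z ^ j)"
      by (subst atMost_atLeast0, subst sum.atLeast_Suc_atMost) auto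
    finally have "1 - coeff g 0 = (\<Sum>j\<in>{1..m}. coeff g j * inverse z ^ j)" by (simp add: algebra_simps)
    then have "1 = v * (\<Sum>j\<in>{1..m}. coeff g j * inverse z ^ j)"
      using u(2) by (simp add: v_def field_simps)
    then have "z ^ n = z ^ n * (v * (\<Sum>j\<in>{1..m}. coeff g j * inverse z ^ j))" by simp
    also have "\<dots> = (\<Sum>j\<in>{1..m}. z ^ n * (v * (coeff g j * inverse z ^ j)))"
      by (simp add: sum_distrib_left)
    also have "\<dots> = (\<Sum>j\<in>{1..m}. v * coeff g j * z ^ (n - j))"
    proof (rule sum.cong)
      fix j assume "j \<in> {1..m}"
      then have "j \<le> n" using deg by (auto simp: n_def m_def)
      then have "z ^ n = z ^ (n - j) * z ^ j" by (simp flip: power_add)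
      then show "z ^ n * (v * (coeff g j * inverse z ^ j)) = v * coeff g j * z ^ (n - j)"
        using z by (simp add: power_inverse field_simps)
    qed simp
    finally show ?thesis .
  qed
  have "poly f' z = poly f z - coeff f n * z ^ n + coeff f n * (\<Sum>j\<in>{1..m}. v * coeff g j * z ^ (n - j))"
    by (simp add: f'_def poly_sum poly_monom sum_distrib_left mult.assoc)
  then have "poly f' z = 1" using zn f by simp
  moreover have "coeff f' i \<in> I" for i
  proof -
    have "(if n = i then coeff f n else 0) \<in> I" using fI I0 by auto
    have "coeff f i - (if n = i then coeff f n else 0) \<in> I" using fI I0 by auto
    moreover have "(\<Sum>j\<in>{1..m}. if n - j = i then coeff f n * (v * coeff g j) else 0) \<in> I"
      by (rule I_sum) (use u(1) in \<open>auto intro!: I0 I_mult fI gI IS simp: v_def\<close>)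
    ultimately show ?thesis unfolding f'_def
      by (auto simp: coeff_sum intro: I_add)
  qed
  moreover have "degree f' < n"
  proof -
    have "coeff f' i = 0" if "i \<ge> n" for i
    proof -
      have "(\<Sum>j\<in>{1..m}. if n - j = i then coeff f n * (v * coeff g j) else 0) = 0"
        by (rule sum.neutral) (use that deg in \<open>auto simp: n_def m_def\<close>)
      moreover have "coeff f i - (if n = i then coeff f n else 0) = 0" using that by (auto simp: n_def coeff_eq_0)
      ultimately show ?thesis by (simp add: f'_def coeff_sum)
    qed
    then have "degree f' \<le> n - 1" by (intro degree_le) auto
    then show ?thesis using deg by (simp add: n_def)
  qed
  ultimately show ?thesis by (auto simp: polys_over_def I_def n_def)
qed

text \<open>Chevalley's extension theorem. A subring maximal among those omitting 1/c exists by
  Zorn. If it contained neither z nor 1/z, maximality would put 1/c into both extensions, giving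
  relations f(z) = 1 and g(1/z) = 1 with coefficients in c V; a pair of least total degree can
  always be shortened.\<close>

theorem valuation_ring_exists:
  assumes S0: "is_subring S0" and c: "c \<in> S0" "c \<noteq> 0" "inverse c \<notin> S0"
  shows "\<exists>V. valuation_ring V \<and> S0 \<subseteq> V \<and> inverse c \<notin> V"
proof -
  define A where "A = {S. is_subring S \<and> S0 \<subseteq> S \<and> inverse c \<notin> S}"
  have "\<exists>V\<in>A. \<forall>X\<in>A. V \<subseteq> X \<longrightarrow> X = V"
  proof (rule subset_Zorn_nonempty)
    show "A \<noteq> {}" using S0 c by (auto simp: A_def)
    fix C assume C: "C \<noteq> {}" "subset.chain A C"
    have ch: "S \<subseteq> T \<or> T \<subseteq> S" if "S \<in> C" "T \<in> C" for S T
      using C(2) that by (auto simp: subset_chain_def)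
    have CA: "C \<subseteq> A" using C(2) by (auto simp: subset_chain_def)
    have "is_subring (\<Union>C)" using C(1) CA ch by (intro is_subring_Union_chain) (auto simp: A_def)
    then show "\<Union>C \<in> A" using CA C(1) by (auto simp: A_def)
  qed
  then obtain V where V: "V \<in> A" and max: "\<And>X. X \<in> A \<Longrightarrow> V \<subseteq> X \<Longrightarrow> X = V" by blast
  have SV: "is_subring V" and S0V: "S0 \<subseteq> V" and cV: "inverse c \<notin> V" using V by (auto simp: A_def)
  note V_ring = is_subringD[OF SV]
  have c_V: "c \<in> V" using c S0V by auto
  have adj: "inverse c \<in> adjoin V z" if "z \<notin> V" for z
  proof (rule ccontr)
    assume "inverse c \<notin> adjoin V z"
    then have "adjoin V z \<in> A" using is_subring_adjoin[OF SV] subset_adjoin[OF SV] S0V by (auto simp: A_def)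
    then show False using max subset_adjoin[OF SV] mem_adjoin[OF SV] that by blast
  qed
  have one: "\<exists>f\<in>polys_over (times c ` V). poly f z = 1" if z: "z \<notin> V" for z
  proof -
    obtain f where f: "f \<in> polys_over V" "poly f z = inverse c" using adj[OF z] by (auto simp: adjoin_def)
    have "smult c f \<in> polys_over (times c ` V)" using f by (auto simp: polys_over_def)
    moreover have "poly (smult c f) z = 1" using f c by simp
    ultimately show ?thesis by blast
  qed
  have nz: "1 - c * x \<noteq> 0" if "x \<in> V" for x
  proof
    assume "1 - c * x = 0"
    then have "x = inverse c" using c by (simp add: field_simps)
    then show False using cV that by simp
  qed
  \<comment> \<open>If 1/w were not in V, then 1/c would be a polynomial in 1/w, so w^n / c lies in
    V. As w^n has the form 1 - c y, this puts 1/c = w^n / c + y into V.\<close>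
  have unit: "inverse (1 - c * x) \<in> V" if x: "x \<in> V" for x
  proof (rule ccontr)
    define w where "w = 1 - c * x"
    have wV: "w \<in> V" using x c_V V_ring by (auto simp: w_def)
    assume "inverse (1 - c * x) \<notin> V"
    then obtain f where f: "f \<in> polys_over V" "poly f (inverse w) = inverse c"
      using adj[of "inverse w"] by (auto simp: adjoin_def w_def)
    define n where "n = degree f"
    have "w ^ n * poly f (inverse w) = (\<Sum>i\<le>n. coeff f i * w ^ (n - i))"
      unfolding poly_altdef sum_distrib_left n_def[symmetric]
    proof (rule sum.cong)
      fix i assume "i \<in> {..n}"
      then have "w ^ n = w ^ (n - i) * w ^ i" by (simp flip: power_add)
      then show "w ^ n * (coeff f i * inverse w ^ i) = coeff f i * w ^ (n - i)"
        using nz[OF x] by (simp add: power_inverse field_simps w_def[symmetric])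
    qed simp
    also have "\<dots> \<in> V" using f wV by (auto simp: polys_over_def intro!: is_subring_sum[OF SV] V_ring)
    finally have 1: "w ^ n * inverse c \<in> V" using f by simp
    have "\<exists>y\<in>V. w ^ k = 1 - c * y" for k
    proof (induction k)
      case 0 then show ?case using V_ring by (auto intro!: bexI[of _ 0])
    next
      case (Suc k)
      then obtain y where y: "y \<in> V" "w ^ k = 1 - c * y" by blast
      have "w ^ Suc k = 1 - c * (x + y - c * x * y)"
        by (simp only: power_Suc y) (simp add: w_def algebra_simps)
      moreover have "x + y - c * x * y \<in> V" using x y c_V by (auto intro!: V_ring)
      ultimately show ?case by blast
    qed
    then obtain y where y: "y \<in> V" "w ^ n = 1 - c * y" by blast
    have "inverse c = w ^ n * inverse c + y" using y c by (simp add: field_simps)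
    then show False using 1 y V_ring(3) cV by metis
  qed
  have "z \<in> V \<or> inverse z \<in> V" for z
  proof (rule ccontr)
    assume nV: "\<not> (z \<in> V \<or> inverse z \<in> V)"
    then have z: "z \<noteq> 0" using V_ring by auto
    \<comment> \<open>The total degree is minimised, so that whichever of f and g has the larger
      degree may be the one that is reduced.\<close>
    define Q where "Q = (\<lambda>k. \<exists>f g. f \<in> polys_over (times c ` V) \<and> g \<in> polys_over (times c ` V) \<and>
        poly f z = 1 \<and> poly g (inverse z) = 1 \<and> degree f + degree g = k)"
    have ex: "\<exists>k. Q k" using one[of z] one[of "inverse z"] nV by (auto simp: Q_def)
    define k where "k = (LEAST k. Q k)"
    have Qk: "Q k" unfolding k_def using ex by (rule LeastI_ex)
    have mink: "\<not> Q j" if "j < k" for j using that not_less_Least by (auto simp: k_def)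
    obtain f g where fg: "f \<in> polys_over (times c ` V)" "g \<in> polys_over (times c ` V)"
        "poly f z = 1" "poly g (inverse z) = 1" "degree f + degree g = k"
      using Qk by (auto simp: Q_def)
    have u: "inverse (1 - coeff h 0) \<in> V \<and> 1 - coeff h 0 \<noteq> 0" if "h \<in> polys_over (times c ` V)" for h
    proof -
      have "coeff h 0 \<in> times c ` V" using that by (auto simp: polys_over_def)
      then obtain x where "x \<in> V" "coeff h 0 = c * x" by blast
      then show ?thesis using unit nz by auto
    qed
    have dpos: "degree h > 0" if "h \<in> polys_over (times c ` V)" "poly h w = 1" for h w
    proof (rule ccontr)
      assume "\<not> degree h > 0"
      then obtain a where "h = [:a:]" by (auto elim: degree_eq_zeroE)
      then show False using that u[OF that(1)] by auto
    qed
    show False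
    proof (cases "degree g \<le> degree f")
      case True
      obtain f' where "f' \<in> polys_over (times c ` V)" "poly f' z = 1" "degree f' < degree f"
        using reduce_degree[OF SV z fg(1,3,2,4) c_V True dpos[OF fg(1,3)]] u[OF fg(2)] by blast
      then show False using mink[of "degree f' + degree g"] fg by (auto simp: Q_def)
    next
      case False
      have iz: "inverse z \<noteq> 0" using z by simp
      have fi: "poly f (inverse (inverse z)) = 1" using fg by simp
      obtain g' where "g' \<in> polys_over (times c ` V)" "poly g' (inverse z) = 1" "degree g' < degree g"
        using reduce_degree[OF SV iz fg(2,4,1) fi c_V _ dpos[OF fg(2,4)]] u[OF fg(1)] False by auto
      then show False using mink[of "degree f + degree g'"] fg by (auto simp: Q_def)
    qed
  qed
  then show ?thesis using SV S0V cV by (auto simp: valuation_ring_def)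
qed

section \<open>Gauss's lemma over a valuation ring\<close>

text \<open>Zero is listed separately since \<open>inverse 0 = 0\<close> lies in V.\<close>

definition max_ideal :: "'a::field set \<Rightarrow> 'a set" where
  "max_ideal V = {x \<in> V. x = 0 \<or> inverse x \<notin> V}"

lemma valuation_ring_subring: "valuation_ring V \<Longrightarrow> is_subring V"
  by (simp add: valuation_ring_def)

lemmas valuation_ringD = is_subringD[OF valuation_ring_subring]

lemma max_ideal_subset: "x \<in> max_ideal V \<Longrightarrow> x \<in> V"
  by (simp add: max_ideal_def)

lemma zero_in_max_ideal: "valuation_ring V \<Longrightarrow> 0 \<in> max_ideal V"
  by (simp add: max_ideal_def valuation_ringD)

lemma one_notin_max_ideal: "valuation_ring V \<Longrightarrow> 1 \<notin> max_ideal V"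
  by (simp add: max_ideal_def valuation_ringD)

lemma inverse_unit: "x \<in> V \<Longrightarrow> x \<notin> max_ideal V \<Longrightarrow> inverse x \<in> V"
  by (auto simp: max_ideal_def)

lemma inverse_in_max_ideal: "valuation_ring V \<Longrightarrow> x \<notin> V \<Longrightarrow> inverse x \<in> max_ideal V"
  by (auto simp: max_ideal_def valuation_ring_def)

lemma max_ideal_mult:
  assumes V: "valuation_ring V" and x: "x \<in> max_ideal V" and y: "y \<in> V"
  shows "x * y \<in> max_ideal V"
proof -
  have "inverse x \<in> V" if "inverse (x * y) \<in> V" "x * y \<noteq> 0"
  proof -
    have "inverse x = y * inverse (x * y)" using that by (simp add: field_simps)
    also have "\<dots> \<in> V" by (rule valuation_ringD(5)[OF V y that(1)])
    finally show ?thesis .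
  qed
  then show ?thesis using x y valuation_ringD(5)[OF V] by (auto simp: max_ideal_def)
qed

lemma max_ideal_mult': "valuation_ring V \<Longrightarrow> x \<in> V \<Longrightarrow> y \<in> max_ideal V \<Longrightarrow> x * y \<in> max_ideal V"
  using max_ideal_mult[of V y x] by (simp add: mult.commute)

text \<open>The valuation property enters here: one of x / y and y / x lies in V, so the sum is a
  multiple of one of its terms.\<close>

lemma max_ideal_add:
  assumes V: "valuation_ring V" and x: "x \<in> max_ideal V" and y: "y \<in> max_ideal V"
  shows "x + y \<in> max_ideal V"
proof (cases "x = 0 \<or> y = 0")
  case True then show ?thesis using x y by auto
next
  case False
  have *: "x + y \<in> max_ideal V" if "x / y \<in> V" "y \<in> max_ideal V" "y \<noteq> 0" for x y
  proof -
    have "x + y = y * (x / y + 1)" using that by (simp add: field_simps)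
    then show ?thesis using max_ideal_mult[OF V that(2), of "x / y + 1"] that valuation_ringD[OF V] by simp
  qed
  have "x / y \<in> V \<or> y / x \<in> V" using V unfolding valuation_ring_def by (metis inverse_divide)
  then show ?thesis using *[of x y] *[of y x] x y False by (auto simp: add.commute)
qed

lemma max_ideal_uminus: "valuation_ring V \<Longrightarrow> x \<in> max_ideal V \<Longrightarrow> - x \<in> max_ideal V"
  using max_ideal_mult[of V x "-1"] valuation_ringD[of V] by simp

lemma max_ideal_diff: "valuation_ring V \<Longrightarrow> x \<in> max_ideal V \<Longrightarrow> y \<in> max_ideal V \<Longrightarrow> x - y \<in> max_ideal V"
  using max_ideal_add[of V x "- y"] max_ideal_uminus[of V y] by simp

lemma max_ideal_prime:
  assumes V: "valuation_ring V" and "x \<in> V" "y \<in> V" "x * y \<in> max_ideal V"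
  shows "x \<in> max_ideal V \<or> y \<in> max_ideal V"
proof (rule ccontr)
  assume n: "\<not> ?thesis"
  then have "inverse x \<in> V" using inverse_unit assms by auto
  then have "inverse x * (x * y) \<in> max_ideal V" using max_ideal_mult'[OF V] assms by blast
  moreover have "x \<noteq> 0" using n zero_in_max_ideal[OF V] by auto
  ultimately show False using n by (simp add: mult.assoc[symmetric])
qed

lemma max_ideal_power:
  "valuation_ring V \<Longrightarrow> x \<in> max_ideal V \<Longrightarrow> n > 0 \<Longrightarrow> x ^ n \<in> max_ideal V"
  by (cases n) (auto intro: max_ideal_mult valuation_ringD max_ideal_subset)

lemma unit_power:
  "valuation_ring V \<Longrightarrow> x \<in> V \<Longrightarrow> x \<notin> max_ideal V \<Longrightarrow> x ^ n \<notin> max_ideal V"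
proof (induction n)
  case (Suc n)
  then show ?case using max_ideal_prime[of V x "x ^ n"] valuation_ringD(7)[of V x n] by auto
qed (simp add: one_notin_max_ideal)

lemma max_ideal_sum:
  assumes "valuation_ring V" "\<And>i. i \<in> A \<Longrightarrow> f i \<in> max_ideal V"
  shows "sum f A \<in> max_ideal V"
  using assms(2) by (induction A rule: infinite_finite_induct)
    (auto intro: max_ideal_add[OF assms(1)] zero_in_max_ideal[OF assms(1)])

lemma unit_add_max_ideal:
  assumes "valuation_ring V" "x \<notin> max_ideal V" "y \<in> max_ideal V"
  shows "x + y \<notin> max_ideal V"
  using max_ideal_diff[OF assms(1), of "x + y" y] assms by auto

section \<open>Places of the complex numbers over a rational prime\<close>

lemma prime_valuation_ring_exists:
  assumes "prime p"
  shows "\<exists>V::complex set. valuation_ring V \<and> of_nat p \<in> max_ideal V"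
proof -
  have S: "is_subring (\<int> :: complex set)" by (auto simp: is_subring_def)
  have inv: "inverse (of_nat p) \<notin> (\<int> :: complex set)"
  proof
    assume "inverse (of_nat p) \<in> (\<int> :: complex set)"
    then obtain k where "inverse (of_nat p :: complex) = of_int k" by (auto elim: Ints_cases)
    then have "(of_int (k * int p) :: complex) = of_int 1"
      using prime_gt_0_nat[OF assms] by (simp add: field_simps)
    then have "k * int p = 1" by (simp only: of_int_eq_iff)
    then show False using prime_gt_1_nat[OF assms] by (simp add: zmult_eq_1_iff)
  qed
  have "of_nat p \<noteq> (0::complex)" using prime_gt_0_nat[OF assms] by simp
  from valuation_ring_exists[OF S Ints_of_nat this inv]
  obtain V :: "complex set" where V: "valuation_ring V \<and> \<int> \<subseteq> V \<and> inverse (of_nat p) \<notin> V" ..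
  moreover have "of_nat p \<in> V" using V Ints_of_nat by (meson subsetD)
  ultimately show ?thesis by (intro exI[of _ V]) (simp add: max_ideal_def)
qed

lemma of_int_in_max_ideal_iff:
  fixes V :: "complex set"
  assumes V: "valuation_ring V" and p: "of_nat p \<in> max_ideal V" "prime p"
  shows "of_int a \<in> max_ideal V \<longleftrightarrow> int p dvd a"
proof
  assume "int p dvd a"
  then obtain k where "a = int p * k" by auto
  then show "of_int a \<in> max_ideal V"
    using max_ideal_mult[OF V p(1), of "of_int k"] is_subring_of_int[OF valuation_ring_subring[OF V]] by simp
next
  assume a: "of_int a \<in> max_ideal V"
  show "int p dvd a"
  proof (rule ccontr)
    assume "\<not> int p dvd a"
    then have "algebraic_semidom_class.coprime (int p) a"
      using p(2) Factorial_Ring.prime_imp_coprime[of "int p" a] by simp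
    then obtain x y where "x * int p + y * a = 1" using bezout_int[of "int p" a] by auto
    then have "(of_int (x * int p + y * a) :: complex) = of_int 1" by (rule arg_cong)
    then have "(of_int x * of_nat p + of_int y * of_int a :: complex) = 1"
      by (simp only: of_int_add of_int_mult of_int_of_nat_eq of_int_1)
    moreover have "of_int x * of_nat p + of_int y * of_int a \<in> max_ideal V"
      using a p by (intro max_ideal_add[OF V] max_ideal_mult'[OF V is_subring_of_int[OF valuation_ring_subring[OF V]]])
    ultimately show False using one_notin_max_ideal[OF V] by simp
  qed
qed

text \<open>At a place over a prime factor of the reduced denominator, the numerator would be a
  non-unit too. The criterion turns integrality of norms into a check at one place at a
  time.\<close>

lemma rational_integer_criterion:
  fixes q :: complex
  assumes "q \<in> \<rat>"
    and "\<And>p V. prime p \<Longrightarrow> valuation_ring V \<Longrightarrow> of_nat p \<in> max_ideal V \<Longrightarrow> q \<in> V"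
  shows "q \<in> \<int>"
proof -
  obtain x :: rat where x: "q = of_rat x" using assms(1) by (auto elim: Rats_cases)
  obtain a b where ab: "quotient_of x = (a, b)" by force
  have b: "b > 0" "algebraic_semidom_class.coprime a b" "x = of_int a / of_int b"
    using quotient_of_denom_pos[OF ab] quotient_of_coprime[OF ab] quotient_of_div[OF ab] by auto
  have qb: "q * of_int b = of_int a" using b by (simp add: x of_rat_divide)
  have "b = 1"
  proof (rule ccontr)
    assume "b \<noteq> 1"
    then have "nat b \<noteq> 1" using b by auto
    then obtain p where p: "prime p" "p dvd nat b" using prime_factor_nat by blast
    then have pb: "int p dvd b" using b by (simp add: int_dvd_int_iff[symmetric] del: int_dvd_int_iff)
    obtain V :: "complex set" where V: "valuation_ring V" "of_nat p \<in> max_ideal V"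
      using prime_valuation_ring_exists[OF p(1)] by blast
    have "q * of_int b \<in> max_ideal V"
      using max_ideal_mult'[OF V(1) assms(2)[OF p(1) V]] pb of_int_in_max_ideal_iff[OF V p(1)] by blast
    then have "int p dvd a" using qb of_int_in_max_ideal_iff[OF V p(1)] by simp
    then have "int p dvd 1" using pb by (rule Rings.coprime_common_divisor[OF b(2)])
    then show False using prime_gt_1_nat[OF p(1)] by simp
  qed
  then show ?thesis using qb by auto
qed

section \<open>Primitive polynomials and the product over large roots\<close>

definition primitive_over :: "'a::field set \<Rightarrow> 'a poly \<Rightarrow> bool" where
  "primitive_over V f \<longleftrightarrow> (\<forall>i. coeff f i \<in> V) \<and> (\<exists>i. coeff f i \<notin> max_ideal V)"

text \<open>If i and j are the least indices of unit coefficients of f and g, all other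
  contributions to the coefficient i + j contain a non-unit.\<close>

lemma primitive_over_mult:
  assumes V: "valuation_ring V" and f: "primitive_over V f" and g: "primitive_over V g"
  shows "primitive_over V (f * g)"
proof -
  have fV: "coeff f i \<in> V" and gV: "coeff g i \<in> V" for i using f g by (auto simp: primitive_over_def)
  define i where "i = (LEAST i. coeff f i \<notin> max_ideal V)"
  define j where "j = (LEAST j. coeff g j \<notin> max_ideal V)"
  have i: "coeff f i \<notin> max_ideal V" unfolding i_def by (rule LeastI_ex) (use f in \<open>auto simp: primitive_over_def\<close>)
  have j: "coeff g j \<notin> max_ideal V" unfolding j_def by (rule LeastI_ex) (use g in \<open>auto simp: primitive_over_def\<close>)
  have li: "coeff f k \<in> max_ideal V" if "k < i" for k using that not_less_Least by (auto simp: i_def)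
  have lj: "coeff g k \<in> max_ideal V" if "k < j" for k using that not_less_Least by (auto simp: j_def)
  have "coeff (f * g) (i + j) = coeff f i * coeff g j + (\<Sum>k\<in>{..i+j}-{i}. coeff f k * coeff g (i + j - k))"
    by (simp add: coeff_mult sum.remove[of "{..i+j}" i])
  moreover have "(\<Sum>k\<in>{..i+j}-{i}. coeff f k * coeff g (i + j - k)) \<in> max_ideal V"
  proof (rule max_ideal_sum[OF V])
    fix k assume "k \<in> {..i+j}-{i}"
    then consider "k < i" | "i + j - k < j" by force
    then show "coeff f k * coeff g (i + j - k) \<in> max_ideal V"
      by cases (auto intro: max_ideal_mult[OF V] max_ideal_mult'[OF V] li lj fV gV)
  qed
  moreover have "coeff f i * coeff g j \<notin> max_ideal V" using max_ideal_prime[OF V fV gV] i j by blast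
  ultimately have "coeff (f * g) (i + j) \<notin> max_ideal V" using unit_add_max_ideal[OF V] by metis
  moreover have "coeff (f * g) k \<in> V" for k
    by (auto simp: coeff_mult intro!: is_subring_sum[OF valuation_ring_subring[OF V]] valuation_ringD(5)[OF V] fV gV)
  ultimately show ?thesis by (auto simp: primitive_over_def)
qed

text \<open>Stands for max(1, |y|) at the place V, as in a Mahler measure, but as an element instead
  of a size.\<close>

definition large_part :: "'a::field set \<Rightarrow> 'a \<Rightarrow> 'a" where
  "large_part V y = (if y \<in> V then 1 else y)"

lemma large_part_nonzero: "valuation_ring V \<Longrightarrow> large_part V y \<noteq> 0"
  by (auto simp: large_part_def valuation_ringD)

text \<open>Gauss's lemma, in the form of a product formula at one place.\<close>

lemma gauss_large_roots:
  assumes V: "valuation_ring V" and g: "g = smult c (\<Prod>y\<leftarrow>ys. [:- y, 1:])"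
    and prim: "primitive_over V g"
  shows "c * (\<Prod>y\<leftarrow>ys. large_part V y) \<in> V" "c * (\<Prod>y\<leftarrow>ys. large_part V y) \<notin> max_ideal V"
proof -
  \<comment> \<open>Dividing each linear factor by its large part makes it primitive, so c times all
    large parts is the content of g and hence a unit.\<close>
  define fac where "fac = (\<lambda>y. smult (inverse (large_part V y)) [:- y, 1:])"
  define u where "u = c * (\<Prod>y\<leftarrow>ys. large_part V y)"
  have pf: "primitive_over V (fac y)" for y
  proof (cases "y \<in> V")
    case True
    then have "coeff (fac y) i \<in> V" for i
      using valuation_ringD[OF V] by (auto simp: fac_def large_part_def coeff_pCons split: nat.split)
    moreover have "coeff (fac y) 1 \<notin> max_ideal V"
      using True one_notin_max_ideal[OF V] by (simp add: fac_def large_part_def)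
    ultimately show ?thesis unfolding primitive_over_def by blast
  next
    case False
    then have y0: "y \<noteq> 0" using valuation_ringD[OF V] by auto
    have iy: "inverse y \<in> V" using False V by (auto simp: valuation_ring_def)
    have "coeff (fac y) i \<in> V" for i
      using valuation_ringD[OF V] False y0 iy by (auto simp: fac_def large_part_def coeff_pCons split: nat.split)
    moreover have "coeff (fac y) 0 \<notin> max_ideal V"
      using False y0 one_notin_max_ideal[OF V] max_ideal_uminus[OF V, of "-1"] by (auto simp: fac_def large_part_def)
    ultimately show ?thesis unfolding primitive_over_def by blast
  qed
  have "primitive_over V (\<Prod>y\<leftarrow>ys. fac y)"
  proof (induction ys)
    case Nil
    have "coeff 1 0 \<notin> max_ideal V" using one_notin_max_ideal[OF V] by simp
    then show ?case using valuation_ringD[OF V] by (force simp: primitive_over_def coeff_1)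
  next
    case (Cons y ys) then show ?case using primitive_over_mult[OF V pf] by simp
  qed
  moreover have "g = smult u (\<Prod>y\<leftarrow>ys. fac y)"
  proof -
    have "(\<Prod>y\<leftarrow>ys. [:- y, 1:]) = smult (\<Prod>y\<leftarrow>ys. large_part V y) (\<Prod>y\<leftarrow>ys. fac y)"
    proof (induction ys)
      case (Cons y ys)
      have "[:- y, 1:] = smult (large_part V y) (fac y)"
        using large_part_nonzero[OF V] by (simp add: fac_def)
      then show ?case using Cons
        by (simp only: list.map prod_list.Cons mult_smult_left mult_smult_right smult_smult ac_simps)
    qed simp
    then show ?thesis by (simp add: g u_def)
  qed
  ultimately obtain i where i: "coeff (\<Prod>y\<leftarrow>ys. fac y) i \<in> V" "coeff (\<Prod>y\<leftarrow>ys. fac y) i \<notin> max_ideal V"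
      "\<forall>k. coeff g k = u * coeff (\<Prod>y\<leftarrow>ys. fac y) k" and fV: "\<forall>k. coeff (\<Prod>y\<leftarrow>ys. fac y) k \<in> V"
    unfolding primitive_over_def by auto
  obtain j where j: "coeff g j \<notin> max_ideal V" using prim by (auto simp: primitive_over_def)
  have "coeff (\<Prod>y\<leftarrow>ys. fac y) i \<noteq> 0" using i zero_in_max_ideal[OF V] by auto
  then have "u = coeff g i * inverse (coeff (\<Prod>y\<leftarrow>ys. fac y) i)" using i(3) by simp
  moreover have "coeff g i \<in> V" using prim by (auto simp: primitive_over_def)
  ultimately have "u \<in> V" using inverse_unit i valuation_ringD(5)[OF V] by metis
  moreover have "u \<notin> max_ideal V"
    using j i(3) fV max_ideal_mult[OF V] by metis
  ultimately show "c * (\<Prod>y\<leftarrow>ys. large_part V y) \<in> V" "c * (\<Prod>y\<leftarrow>ys. large_part V y) \<notin> max_ideal V"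
    by (auto simp: u_def)
qed

lemma is_subring_prod_list:
  "is_subring S \<Longrightarrow> (\<And>y. y \<in> set ys \<Longrightarrow> f y \<in> S) \<Longrightarrow> (\<Prod>y\<leftarrow>ys. f y) \<in> S"
  by (induction ys) (auto intro: is_subringD)

lemma prod_list_mult: "(\<Prod>y\<leftarrow>ys. f y * g y) = (\<Prod>y\<leftarrow>ys. f y) * (\<Prod>y\<leftarrow>ys. g y :: 'a::comm_monoid_mult)"
  by (induction ys) (auto simp: ac_simps)

lemma prod_list_pow:
  "(\<Prod>y\<leftarrow>ys. f y ^ n) = ((\<Prod>y\<leftarrow>ys. (f y :: 'a::comm_semiring_1)) ^ n)"
proof (induction ys)
  case Nil show ?case by simp
next
  case (Cons a ys)
  show ?case unfolding list.map prod_list.Cons Cons.IH power_mult_distrib by (rule refl)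
qed

text \<open>A polynomial of degree n has a pole of order at most n at the conjugates outside V. As c
  times the product of their large parts is a unit, c^n clears these poles.\<close>

lemma norm_local_integral:
  assumes V: "valuation_ring V" and g: "g = smult c (\<Prod>y\<leftarrow>ys. [:- y, 1:])"
    and prim: "primitive_over V g"
    and W: "\<And>y. y \<in> set ys \<Longrightarrow> W y \<in> V" and eq: "\<And>y. y \<in> set ys \<Longrightarrow> U y = large_part V y ^ n * W y"
  shows "c ^ n * (\<Prod>y\<leftarrow>ys. U y) \<in> V"
proof -
  have "(\<Prod>y\<leftarrow>ys. U y) = (\<Prod>y\<leftarrow>ys. large_part V y ^ n * W y)"
    using eq by (intro arg_cong[of _ _ prod_list] map_cong) auto
  then have "c ^ n * (\<Prod>y\<leftarrow>ys. U y) = (c * (\<Prod>y\<leftarrow>ys. large_part V y)) ^ n * (\<Prod>y\<leftarrow>ys. W y)"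
    by (simp add: prod_list_mult prod_list_pow power_mult_distrib)
  also have "\<dots> \<in> V" using gauss_large_roots[OF V g prim] W
    by (intro valuation_ringD(5)[OF V] valuation_ringD(7)[OF V gauss_large_roots(1)[OF V g prim]]
      is_subring_prod_list[OF valuation_ring_subring[OF V]])
  finally show ?thesis .
qed

text \<open>The counterpart for zeros: if U is small of order n at the conjugates outside V, its
  norm is divisible by c^n.\<close>

lemma norm_local_integral_divided:
  assumes V: "valuation_ring V" and g: "g = smult c (\<Prod>y\<leftarrow>ys. [:- y, 1:])"
    and prim: "primitive_over V g"
    and W: "\<And>y. y \<in> set ys \<Longrightarrow> U y * large_part V y ^ n \<in> V"
  shows "(\<Prod>y\<leftarrow>ys. U y) / c ^ n \<in> V"
proof -
  define u where "u = c * (\<Prod>y\<leftarrow>ys. large_part V y)"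
  have u: "u \<in> V" "u \<notin> max_ideal V" using gauss_large_roots[OF V g prim] by (auto simp: u_def)
  then have u0: "u \<noteq> 0" using zero_in_max_ideal[OF V] by auto
  have "(\<Prod>y\<leftarrow>ys. U y * large_part V y ^ n) = (\<Prod>y\<leftarrow>ys. U y) * (\<Prod>y\<leftarrow>ys. large_part V y) ^ n"
    by (simp add: prod_list_mult prod_list_pow)
  then have "(\<Prod>y\<leftarrow>ys. U y) / c ^ n = inverse u ^ n * (\<Prod>y\<leftarrow>ys. U y * large_part V y ^ n)"
    using u0 by (simp add: u_def power_mult_distrib field_simps)
  also have "\<dots> \<in> V"
    by (intro valuation_ringD(5)[OF V] valuation_ringD(7)[OF V inverse_unit[OF u]]
      is_subring_prod_list[OF valuation_ring_subring[OF V] W])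
  finally show ?thesis .
qed

section \<open>Norms of algebraic numbers\<close>

lemma poly_smult_prod_roots:
  "poly (smult c (\<Prod>y\<leftarrow>ys. [:- y, 1::'a::comm_ring_1:])) v = c * (\<Prod>y\<leftarrow>ys. v - y)"
proof -
  have "poly (\<Prod>y\<leftarrow>ys. [:- y, 1:]) v = (\<Prod>y\<leftarrow>ys. v - y)"
    by (induction ys) (auto simp: algebra_simps)
  then show ?thesis by simp
qed

lemma linear_factors_monic:
  "lead_coeff (\<Prod>y\<leftarrow>ys. [:- y, 1::'a::idom:]) = 1 \<and> degree (\<Prod>y\<leftarrow>ys. [:- y, 1::'a:]) = length ys"
proof (induction ys)
  case (Cons y ys)
  then have "(\<Prod>y\<leftarrow>ys. [:- y, 1:]) \<noteq> 0" by (auto simp: prod_list_zero_iff)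
  then have "degree ([:- y, 1:] * (\<Prod>y\<leftarrow>ys. [:- y, 1:])) = Suc (length ys)"
    using Cons by (subst degree_mult_eq) auto
  moreover have "lead_coeff ([:- y, 1:] * (\<Prod>y\<leftarrow>ys. [:- y, 1:])) = 1"
    unfolding lead_coeff_mult Cons[THEN conjunct1] by simp
  ultimately show ?case by simp
qed simp

lemma prod_list_swap:
  "(\<Prod>y\<leftarrow>ys. \<Prod>v\<leftarrow>vs. f y v) = (\<Prod>v\<leftarrow>vs. \<Prod>y\<leftarrow>ys. f y v :: 'a::comm_monoid_mult)"
proof (induction ys)
  case (Cons a ys)
  then show ?case by (simp add: prod_list_mult)
qed (induction vs, auto)

lemma prod_list_const: "(\<Prod>y\<leftarrow>ys. c) = (c :: 'a::comm_monoid_mult) ^ length ys"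
  by (induction ys) auto

text \<open>Rationality of a resultant without Galois theory: reduce h modulo g, exchange the roles
  of the two polynomials, and use induction on the degree, as in the Euclidean algorithm.\<close>

lemma prod_roots_rational:
  fixes g h :: "rat poly"
  assumes "map_poly of_rat g = smult c (\<Prod>y\<leftarrow>ys. [:- y, 1::complex:])" "g \<noteq> 0"
  shows "(\<Prod>y\<leftarrow>ys. poly (map_poly of_rat h) y) \<in> \<rat>"
  using assms
proof (induction "degree g" arbitrary: g h c ys rule: less_induct)
  case less
  let ?m = "map_poly (of_rat :: rat \<Rightarrow> complex)"
  interpret m: map_poly_comm_ring_hom "of_rat :: rat \<Rightarrow> complex" ..
  have c: "c = of_rat (lead_coeff g)" "length ys = degree g"
  proof -
    note m = linear_factors_monic[of ys, THEN conjunct1] linear_factors_monic[of ys, THEN conjunct2]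
    have "lead_coeff (?m g) = c" by (simp only: less.prems(1) lead_coeff_smult m(1) mult_1_right)
    then show "c = of_rat (lead_coeff g)" by simp
    then have "c \<noteq> 0" using less.prems(2) by simp
    then show "length ys = degree g" using m arg_cong[OF less.prems(1), of degree] by simp
  qed
  have c0: "c \<noteq> 0" using c less.prems(2) by simp
  define r where "r = h mod g"
  have hr: "poly (?m h) y = poly (?m r) y" if "y \<in> set ys" for y
  proof -
    have "poly (?m g) y = 0" using that unfolding less.prems(1) poly_smult_prod_roots
      by (auto simp: prod_list_zero_iff)
    moreover have "h = g * (h div g) + r" by (simp add: r_def)
    then have "?m h = ?m g * ?m (h div g) + ?m r"
      by (metis m.hom_add m.hom_mult)
    ultimately show ?thesis by simp
  qed
  then have eq: "(\<Prod>y\<leftarrow>ys. poly (?m h) y) = (\<Prod>y\<leftarrow>ys. poly (?m r) y)"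
    by (intro arg_cong[of _ _ prod_list] map_cong) auto
  show ?case
  proof (cases "degree g = 0")
    case True
    then show ?thesis using c by simp
  next
    case deg: False
    show ?thesis
    proof (cases "r = 0")
      case True
      then show ?thesis using deg c unfolding eq by (cases ys) auto
    next
      case False
      then have lt: "degree r < degree g" using deg degree_mod_less'[of g h] less.prems(2) by (auto simp: r_def)
      obtain vs where vs: "smult (coeff (?m r) (degree (?m r))) (\<Prod>v\<leftarrow>vs. [:- v, 1:]) = ?m r"
        using fundamental_theorem_algebra_factorized by blast
      define d where "d = coeff (?m r) (degree (?m r))"
      have d: "d \<in> \<rat>" by (simp add: d_def)
      have IH: "(\<Prod>v\<leftarrow>vs. poly (?m g) v) \<in> \<rat>" by (rule less.hyps[OF lt vs[symmetric] False])
      have "(\<Prod>y\<leftarrow>ys. poly (?m r) y) = (\<Prod>y\<leftarrow>ys. d * (\<Prod>v\<leftarrow>vs. y - v))"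
        using arg_cong[OF vs, of "\<lambda>p. poly p y" for y]
        by (simp only: poly_smult_prod_roots d_def)
      also have "\<dots> = d ^ length ys * (\<Prod>v\<leftarrow>vs. \<Prod>y\<leftarrow>ys. y - v)"
        by (simp only: prod_list_mult prod_list_const prod_list_swap[where ys = ys and vs = vs])
      \<comment> \<open>Reciprocity of resultants: for fixed v the product over the roots y of g is
        g(v) / c up to sign.\<close>
      also have "(\<Prod>v\<leftarrow>vs. \<Prod>y\<leftarrow>ys. y - v) = (\<Prod>v\<leftarrow>vs. (-1) ^ length ys * inverse c * poly (?m g) v)"
      proof (intro arg_cong[of _ _ prod_list] map_cong refl)
        fix v
        have "(\<Prod>y\<leftarrow>ys. y - v) = (\<Prod>y\<leftarrow>ys. (-1) * (v - y))" by simp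
        also have "\<dots> = (-1) ^ length ys * (\<Prod>y\<leftarrow>ys. v - y)"
          by (simp only: prod_list_mult prod_list_const)
        finally show "(\<Prod>y\<leftarrow>ys. y - v) = (-1) ^ length ys * inverse c * poly (?m g) v"
          using c0 arg_cong[OF less.prems(1), of "\<lambda>p. poly p v"]
          by (simp only: poly_smult_prod_roots) simp
      qed
      also have "\<dots> = ((-1) ^ length ys * inverse c) ^ length vs * (\<Prod>v\<leftarrow>vs. poly (?m g) v)"
        by (simp only: prod_list_mult prod_list_const power_mult_distrib)
      also have "d ^ length ys * \<dots> \<in> \<rat>"
        using d IH c by (intro Rats_mult Rats_power) auto
      finally show ?thesis unfolding eq .
    qed
  qed
qed

lemma complex_of_int_of_rat_poly: "map_poly (of_rat :: rat \<Rightarrow> complex) (of_int_poly f) = of_int_poly f"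
  by (rule poly_eqI) simp

text \<open>G is the primitive integer multiple of the minimal polynomial. The last clause is the
  form in which irreducibility is used later: an integer polynomial vanishing at one conjugate
  vanishes at all.\<close>

lemma conjugates_exist:
  fixes y :: complex and F :: "int poly"
  assumes "F \<noteq> 0" "poly (of_int_poly F) y = 0"
  shows "\<exists>(G :: int poly) ys. Polynomial.content G = 1 \<and> y \<in> set ys \<and>
    of_int_poly G = smult (of_int (lead_coeff G)) (\<Prod>z\<leftarrow>ys. [:- z, 1:]) \<and>
    (\<forall>U z z'. z \<in> set ys \<longrightarrow> z' \<in> set ys \<longrightarrow> poly (of_int_poly U) z = 0 \<longrightarrow> poly (of_int_poly U) z' = 0)"
proof -
  let ?m = "map_poly (of_rat :: rat \<Rightarrow> complex)"
  interpret m: map_poly_comm_ring_hom "of_rat :: rat \<Rightarrow> complex" ..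
  \<comment> \<open>Degrees of the rational polynomials that vanish at y; the least one belongs to
    the minimal polynomial.\<close>
  define Q where "Q = (\<lambda>n. \<exists>g. g \<noteq> 0 \<and> poly (?m g) y = 0 \<and> degree g = n)"
  have "Q (degree (of_int_poly F :: rat poly))"
    unfolding Q_def using assms by (intro exI[of _ "of_int_poly F"]) (simp add: complex_of_int_of_rat_poly)
  then have "Q (LEAST n. Q n)" by (rule LeastI)
  then obtain g where g: "g \<noteq> 0" "poly (?m g) y = 0" "degree g = (LEAST n. Q n)" by (auto simp: Q_def)
  have min: "degree g \<le> degree h" if "h \<noteq> 0" "poly (?m h) y = 0" for h
    unfolding g(3) by (rule Least_le) (use that in \<open>auto simp: Q_def\<close>)
  obtain d G where "rat_to_normalized_int_poly g = (d, G)" by force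
  note dG = rat_to_normalized_int_poly[OF this]
  have cG: "Polynomial.content G = 1" using dG(3) g(1) by simp
  have gG: "?m g = smult (of_rat d) (of_int_poly G)"
    using arg_cong[OF dG(1), of ?m] by (simp add: complex_of_int_of_rat_poly hom_distribs)
  obtain ys where "smult (coeff (of_int_poly G) (degree (of_int_poly G :: complex poly))) (\<Prod>z\<leftarrow>ys. [:- z, 1:])
      = (of_int_poly G :: complex poly)"
    using fundamental_theorem_algebra_factorized by blast
  then have ys: "of_int_poly G = smult (of_int (lead_coeff G)) (\<Prod>z\<leftarrow>ys. [:- z, 1 :: complex:])" by simp
  have G0: "G \<noteq> 0" using cG by auto
  have root: "poly (of_int_poly G) z = 0 \<longleftrightarrow> z \<in> set ys" for z :: complex
    unfolding ys poly_smult_prod_roots using G0 by (auto simp: prod_list_zero_iff)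
  have rootg: "poly (?m g) z = 0 \<longleftrightarrow> z \<in> set ys" for z
    using root dG(2) by (simp add: gG)
  have "poly (of_int_poly U) z' = 0" if z: "z \<in> set ys" "z' \<in> set ys" "poly (of_int_poly U) z = 0" for U :: "int poly" and z z'
  proof -
    define u where "u = (of_int_poly U :: rat poly)"
    \<comment> \<open>By Bezout e vanishes at z and so is not constant. Its cofactor k in g has too
      small a degree to vanish at y; hence e does, and minimality of g makes k constant. Thus e has
      all roots of g.\<close>
    define e where "e = gcd g u"
    obtain a b where ab: "bezout_coefficients g u = (a, b)" by force
    have bz: "a * g + b * u = e" using bezout_coefficients[OF ab] by (simp add: e_def)
    have eu: "poly (?m u) w = poly (of_int_poly U) w" for w by (simp add: u_def complex_of_int_of_rat_poly)
    have "poly (?m (a * g + b * u)) z = 0"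
      using z rootg eu by (simp add: hom_distribs)
    then have ez: "poly (?m e) z = 0" using bz by simp
    have e0: "e \<noteq> 0" using g(1) by (simp add: e_def)
    have "degree e \<noteq> 0"
    proof
      assume "degree e = 0"
      then obtain c where "e = [:c:]" by (auto elim: degree_eq_zeroE)
      then show False using ez e0 by simp
    qed
    obtain k where k: "g = e * k" unfolding e_def by (meson gcd_dvd1 dvdE)
    have k0: "k \<noteq> 0" using k g(1) by auto
    have deg: "degree g = degree e + degree k" using k e0 k0 by (simp add: degree_mult_eq)
    have "poly (?m e) y * poly (?m k) y = 0" using g(2) by (simp add: k hom_distribs)
    then have "poly (?m e) y = 0" using min[OF k0] deg \<open>degree e \<noteq> 0\<close> by auto
    then have "degree k = 0" using min[OF e0] deg by simp
    then obtain c where c: "k = [:c:]" by (auto elim: degree_eq_zeroE)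
    have "poly (?m e) z' = 0" using rootg[of z'] z k0 by (simp add: k c hom_distribs)
    moreover obtain l where "u = e * l" unfolding e_def by (meson gcd_dvd2 dvdE)
    ultimately have "poly (?m u) z' = 0" by (simp add: hom_distribs)
    then show ?thesis using eu by simp
  qed
  moreover have "y \<in> set ys" using rootg g(2) by simp
  ultimately show ?thesis using cG ys by blast
qed

lemma content_one_primitive_over:
  assumes "Polynomial.content G = 1" "prime p" "valuation_ring V" "of_nat p \<in> max_ideal V"
  shows "primitive_over V (of_int_poly G :: complex poly)"
proof -
  have "\<exists>i. \<not> int p dvd coeff G i"
  proof (rule ccontr)
    assume "\<not> ?thesis"
    then have "int p dvd Polynomial.content G" by (simp add: const_poly_dvd_iff flip: const_poly_dvd_iff_dvd_content)
    then show False using assms(1) prime_gt_1_nat[OF assms(2)] by simp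
  qed
  then show ?thesis
    using of_int_in_max_ideal_iff[OF assms(3,4,2)] is_subring_of_int[OF valuation_ring_subring[OF assms(3)]]
    by (simp add: primitive_over_def)
qed

lemma norm_rational:
  assumes "of_int_poly G = smult (of_int (lead_coeff G)) (\<Prod>z\<leftarrow>ys. [:- z, 1 :: complex:])" "G \<noteq> 0"
  shows "(\<Prod>y\<leftarrow>ys. poly (of_int_poly U) y) \<in> \<rat>"
  using prod_roots_rational[of "of_int_poly G" _ ys "of_int_poly U"] assms
  by (simp add: complex_of_int_of_rat_poly)

lemma poly_large_part:
  fixes U :: "int poly" and V :: "complex set"
  assumes V: "valuation_ring V" and "degree U \<le> n"
  shows "\<exists>w\<in>V. poly (of_int_poly U) y = large_part V y ^ n * w"
proof (cases "y \<in> V")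
  case True
  have "poly (of_int_poly U) y \<in> V" unfolding poly_altdef using True
    by (auto intro!: is_subring_sum valuation_ring_subring V valuation_ringD[OF V] is_subring_of_int)
  then show ?thesis using True by (simp add: large_part_def)
next
  case False
  then have y: "y \<noteq> 0" "inverse y \<in> V" using V valuation_ringD(2)[OF V] by (auto simp: valuation_ring_def)
  define w where "w = (\<Sum>i\<le>degree U. of_int (coeff U i) * inverse y ^ (n - i))"
  have "w \<in> V" unfolding w_def using y
    by (auto intro!: is_subring_sum valuation_ring_subring V valuation_ringD[OF V] is_subring_of_int)
  moreover have "poly (of_int_poly U) y = y ^ n * w" unfolding w_def sum_distrib_left poly_altdef
  proof (rule sum.cong)
    fix i assume "i \<in> {..degree U}"
    then have "y ^ n = y ^ i * y ^ (n - i)" using assms(2) by (simp flip: power_add)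
    then show "coeff (of_int_poly U) i * y ^ i = y ^ n * (of_int (coeff U i) * inverse y ^ (n - i))"
      using y(1) by (simp add: power_inverse field_simps)
  qed simp
  ultimately show ?thesis using False by (auto simp: large_part_def)
qed

text \<open>When n is the degree of U this is the resultant of G and U; the power of the leading
  coefficient clears the poles at every finite place.\<close>

theorem norm_integral:
  assumes G: "of_int_poly G = smult (of_int (lead_coeff G)) (\<Prod>z\<leftarrow>ys. [:- z, 1 :: complex:])" "Polynomial.content G = 1"
    and U: "degree U \<le> n"
  shows "of_int (lead_coeff G) ^ n * (\<Prod>y\<leftarrow>ys. poly (of_int_poly U) y) \<in> \<int>"
proof (rule rational_integer_criterion)
  have "G \<noteq> 0" using G(2) by auto
  then show "of_int (lead_coeff G) ^ n * (\<Prod>y\<leftarrow>ys. poly (of_int_poly U) y) \<in> \<rat>"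
    by (intro Rats_mult Rats_power norm_rational[OF G(1)] Rats_of_int)
  fix p and V :: "complex set" assume p: "prime p" "valuation_ring V" "of_nat p \<in> max_ideal V"
  obtain w where w: "\<And>y. w y \<in> V" "\<And>y. poly (of_int_poly U) y = large_part V y ^ n * w y"
    using poly_large_part[OF p(2) U] by metis
  show "of_int (lead_coeff G) ^ n * (\<Prod>y\<leftarrow>ys. poly (of_int_poly U) y) \<in> V"
    by (rule norm_local_integral[OF p(2) G(1) content_one_primitive_over[OF G(2) p] w])
qed

lemma Ints_nonzero_norm_ge_1: "z \<in> \<int> \<Longrightarrow> z \<noteq> 0 \<Longrightarrow> 1 \<le> cmod z"
proof -
  assume z: "z \<in> \<int>" "z \<noteq> 0"
  obtain k where k: "z = of_int k" using z(1) by (rule Ints_cases)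
  then have "k \<noteq> 0" using z(2) by simp
  then have "1 \<le> \<bar>real_of_int k\<bar>" by linarith
  then show ?thesis using k by simp
qed

lemma norm_prod_list: "cmod (\<Prod>y\<leftarrow>ys. f y) = (\<Prod>y\<leftarrow>ys. cmod (f y))"
  by (induction ys) (auto simp: norm_mult)

section \<open>Common zeros that are not units\<close>

lemma one_plus_max_ideal_power:
  assumes V: "valuation_ring V" and "x - 1 \<in> max_ideal V"
  shows "x ^ n - 1 \<in> max_ideal V"
proof (induction n)
  case (Suc n)
  have x: "x \<in> V" using valuation_ringD(3)[OF V max_ideal_subset[OF assms(2)] valuation_ringD(1)[OF V]] by simp
  have "x ^ Suc n - 1 = x * (x ^ n - 1) + (x - 1)" by (simp add: algebra_simps)
  then show ?case using Suc assms(2) by (metis max_ideal_add[OF V] max_ideal_mult'[OF V x])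
qed (simp add: zero_in_max_ideal[OF V])

text \<open>The cofactor is the sum of x^i for i < n, which is congruent to n modulo the maximal
  ideal.\<close>

lemma power_minus_one_unit:
  assumes V: "valuation_ring V" and x: "x - 1 \<in> max_ideal V" and n: "of_nat n \<notin> max_ideal V"
  shows "\<exists>w\<in>V. w \<notin> max_ideal V \<and> x ^ n - 1 = (x - 1) * w"
proof -
  have xV: "x \<in> V" using valuation_ringD(3)[OF V max_ideal_subset[OF x] valuation_ringD(1)[OF V]] by simp
  define w where "w = (\<Sum>i<n. x ^ i)"
  have "w = of_nat n + (\<Sum>i<n. x ^ i - 1)" by (simp add: w_def sum_subtractf)
  moreover have "(\<Sum>i<n. x ^ i - 1) \<in> max_ideal V"
    by (intro max_ideal_sum[OF V] one_plus_max_ideal_power[OF V x])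
  ultimately have "w \<notin> max_ideal V" using unit_add_max_ideal[OF V n] by simp
  moreover have "w \<in> V" unfolding w_def
    by (intro is_subring_sum valuation_ring_subring V valuation_ringD(7)[OF V xV])
  moreover have "x ^ n - 1 = (x - 1) * w" by (simp add: w_def power_diff_1_eq)
  ultimately show ?thesis by blast
qed

lemma power_minus_one_dvd:
  assumes V: "valuation_ring V" and x: "x \<in> V"
  shows "\<exists>w\<in>V. x ^ n - 1 = (x - 1) * w"
  using is_subring_sum[OF valuation_ring_subring[OF V], of "{..<n}" "\<lambda>i. x ^ i"] valuation_ringD(7)[OF V x]
  by (intro bexI[of _ "\<Sum>i<n. x ^ i"]) (auto simp: power_diff_1_eq)

lemma unit_mult:
  "valuation_ring V \<Longrightarrow> x \<in> V \<Longrightarrow> y \<in> V \<Longrightarrow> x \<notin> max_ideal V \<Longrightarrow> y \<notin> max_ideal V \<Longrightarrow> x * y \<notin> max_ideal V"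
  using max_ideal_prime by blast

lemma unit_nonzero: "valuation_ring V \<Longrightarrow> x \<notin> max_ideal V \<Longrightarrow> x \<noteq> 0"
  using zero_in_max_ideal by blast

lemma inverse_unit_notin:
  "valuation_ring V \<Longrightarrow> x \<in> V \<Longrightarrow> x \<notin> max_ideal V \<Longrightarrow> inverse x \<notin> max_ideal V"
  by (auto simp: max_ideal_def)

text \<open>If z - 1 is p times a non-unit, the sum of z^i for i < p is p times a unit, so every
  p-th power multiplies z - 1 by p up to a unit. The extra non-unit factor makes this true for p = 2
  as well.\<close>

lemma frobenius_power_unit:
  assumes V: "valuation_ring V" and x: "x - 1 = of_nat p * m" "m \<in> max_ideal V"
  shows "\<exists>w\<in>V. w \<notin> max_ideal V \<and> x ^ (p ^ l) - 1 = of_nat p ^ l * (x - 1) * w"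
proof (induction l)
  case 0
  show ?case using one_notin_max_ideal[OF V] valuation_ringD(1)[OF V] by (intro bexI[of _ 1]) auto
next
  case (Suc l)
  then obtain w where w: "w \<in> V" "w \<notin> max_ideal V" "x ^ (p ^ l) - 1 = of_nat p ^ l * (x - 1) * w" by blast
  define z where "z = x ^ (p ^ l)"
  have pV: "of_nat p ^ l \<in> V" by (intro valuation_ringD(7)[OF V] is_subring_of_nat valuation_ring_subring V)
  define m' where "m' = of_nat p ^ l * m * w"
  have m': "m' \<in> max_ideal V" unfolding m'_def
    by (intro max_ideal_mult[OF V] max_ideal_mult'[OF V pV] x(2) w(1))
  have zm: "z - 1 = of_nat p * m'" using w(3) x(1) by (simp add: z_def m'_def)
  then have z1: "z - 1 \<in> max_ideal V"
    using max_ideal_mult'[OF V is_subring_of_nat[OF valuation_ring_subring[OF V]] m'] by simp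
  have zV: "z \<in> V" using valuation_ringD(3)[OF V max_ideal_subset[OF z1] valuation_ringD(1)[OF V]] by simp
  obtain d where d: "\<And>i. d i \<in> V" "\<And>i. z ^ i - 1 = (z - 1) * d i"
    using power_minus_one_dvd[OF V zV] by metis
  define w' where "w' = 1 + (\<Sum>i<p. m' * d i)"
  have "(\<Sum>i<p. m' * d i) \<in> max_ideal V" by (intro max_ideal_sum[OF V] max_ideal_mult[OF V] m' d)
  then have w': "w' \<notin> max_ideal V" "w' \<in> V" unfolding w'_def
    using unit_add_max_ideal[OF V one_notin_max_ideal[OF V]]
      valuation_ringD(3)[OF V valuation_ringD(1)[OF V] max_ideal_subset] by auto
  have "(\<Sum>i<p. z ^ i) = of_nat p + (\<Sum>i<p. z ^ i - 1)" by (simp add: sum_subtractf)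
  also have "\<dots> = of_nat p * w'" by (simp add: w'_def d zm distrib_left sum_distrib_left mult.assoc)
  finally have "z ^ p - 1 = (z - 1) * (of_nat p * w')" by (simp add: power_diff_1_eq)
  moreover have "z ^ p = x ^ (p ^ Suc l)" by (simp add: z_def mult.commute flip: power_mult)
  ultimately have "x ^ (p ^ Suc l) - 1 = of_nat p ^ Suc l * (x - 1) * (w * w')"
    using w(3) by (simp add: z_def)
  then show ?case using unit_mult[OF V w(1) w'(2) w(2) w'(1)] valuation_ringD(5)[OF V w(1) w'(2)] by blast
qed

section \<open>Binomial coefficients of prime powers\<close>

lemma choose_absorb: "0 < k \<Longrightarrow> k * (q choose k) = q * ((q - 1) choose (k - 1))"
  using times_binomial_minus1_eq[of k q] by simp

lemma prime_dvd_choose_prime_power: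
  assumes "prime p" "0 < k" "k < p ^ e"
  shows "p dvd (p ^ e choose k)"
proof (rule ccontr)
  assume n: "\<not> p dvd (p ^ e choose k)"
  have "p ^ e dvd k * (p ^ e choose k)" using choose_absorb[OF assms(2), of "p ^ e"] by simp
  moreover have "algebraic_semidom_class.coprime (p ^ e) (p ^ e choose k)"
    using Factorial_Ring.prime_imp_coprime[OF assms(1) n] by (simp add: coprime_power_left_iff)
  ultimately have "p ^ e dvd k" by (simp add: coprime_dvd_mult_left_iff)
  then show False using dvd_imp_le[of "p ^ e" k] assms by simp
qed

text \<open>With the next two lemmas this makes p^(e-1) the first positive index at which the
  binomial coefficient contains exactly one factor p.\<close>

lemma prime_square_dvd_choose_prime_power:
  assumes "prime p" "0 < k" "k < p ^ (e - 1)" "e > 0"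
  shows "p ^ 2 dvd (p ^ e choose k)"
proof (rule ccontr)
  assume n: "\<not> p ^ 2 dvd (p ^ e choose k)"
  have p0: "p > 0" using assms(1) by (rule prime_gt_0_nat)
  have "p ^ (e - 1) \<le> p ^ e" using p0 by (intro power_increasing) auto
  then obtain c where c: "(p ^ e choose k) = p * c"
    using prime_dvd_choose_prime_power[OF assms(1,2), of e] assms by (meson dvdE less_le_trans)
  have "\<not> p dvd c" using n c by (auto simp: power2_eq_square)
  from Factorial_Ring.prime_imp_coprime[OF assms(1) this]
  have cop: "algebraic_semidom_class.coprime (p ^ (e - 1)) c" by (simp add: coprime_power_left_iff)
  have "p * p ^ (e - 1) dvd p * (k * c)"
    using choose_absorb[OF assms(2), of "p ^ e"] c assms(4) by (simp flip: power_Suc add: mult.left_commute)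
  then have "p ^ (e - 1) dvd k * c" using p0 by simp
  then have "p ^ (e - 1) dvd k" using cop by (simp add: coprime_dvd_mult_left_iff)
  then show False using dvd_imp_le[of "p ^ (e - 1)" k] assms by simp
qed

lemma prime_not_dvd_choose_pred_prime_power:
  assumes "prime p" "j < p ^ e"
  shows "\<not> p dvd ((p ^ e - 1) choose j)"
  using assms(2)
proof (induction j)
  case 0 then show ?case using prime_gt_1_nat[OF assms(1)] by auto
next
  case (Suc j)
  have q: "p ^ e = Suc (p ^ e - 1)" using Suc.prems by simp
  have "p dvd (p ^ e choose Suc j)" using prime_dvd_choose_prime_power[OF assms(1)] Suc.prems by blast
  then have "p dvd ((p ^ e - 1) choose j) + ((p ^ e - 1) choose Suc j)" by (metis q binomial_Suc_Suc)
  then show ?case using Suc by (metis dvd_add_left_iff Suc_lessD)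
qed

lemma choose_prime_power_pred:
  assumes "prime p" "e > 0"
  shows "(p ^ e choose p ^ (e - 1)) = p * ((p ^ e - 1) choose (p ^ (e - 1) - 1))"
proof -
  have p0: "p > 0" using assms(1) by (rule prime_gt_0_nat)
  then have "p ^ (e - 1) * (p ^ e choose p ^ (e - 1)) = p ^ (e - 1) * (p * ((p ^ e - 1) choose (p ^ (e - 1) - 1)))"
    using choose_absorb[of "p ^ (e - 1)" "p ^ e"] assms(2) by (simp flip: power_Suc add: mult.assoc[symmetric] mult.commute)
  then show ?thesis using p0 by simp
qed

lemma one_plus_prime_power_expand:
  fixes u :: "'a::field_char_0"
  assumes p: "prime p" and q: "q = p ^ e" "e > 0"
  shows "(1 + u) ^ q = 1 + u ^ q + of_nat p * u * (\<Sum>k\<in>{1..<q}. of_nat ((q choose k) div p) * u ^ (k - 1))"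
proof -
  have q0: "0 < q" using q prime_gt_0_nat[OF p] by simp
  have "(1 + u) ^ q = (\<Sum>k\<le>q. of_nat (q choose k) * u ^ k)"
    using binomial_ring[of u 1 q] by (simp add: add.commute)
  also have "{..q} = insert 0 (insert q {1..<q})" using q0 by auto
  also have "(\<Sum>k\<in>insert 0 (insert q {1..<q}). of_nat (q choose k) * u ^ k)
      = 1 + u ^ q + (\<Sum>k\<in>{1..<q}. of_nat (q choose k) * u ^ k)" using q0 by simp
  also have "(\<Sum>k\<in>{1..<q}. of_nat (q choose k) * u ^ k)
      = of_nat p * u * (\<Sum>k\<in>{1..<q}. of_nat ((q choose k) div p) * u ^ (k - 1))"
    unfolding sum_distrib_left
  proof (rule sum.cong)
    fix k assume k: "k \<in> {1..<q}"
    then have "q choose k = p * ((q choose k) div p)" using prime_dvd_choose_prime_power[OF p, of k e] q by simp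
    then have "(of_nat (q choose k) :: 'a) = of_nat p * of_nat ((q choose k) div p)" by (metis of_nat_mult)
    moreover have "u ^ k = u * u ^ (k - 1)" using k by (simp flip: power_Suc)
    ultimately show "of_nat (q choose k) * u ^ k = of_nat p * u * (of_nat ((q choose k) div p) * u ^ (k - 1))"
      by simp
  qed simp
  finally show ?thesis .
qed

lemma of_nat_in_max_ideal_iff:
  fixes V :: "complex set"
  assumes "valuation_ring V" "of_nat p \<in> max_ideal V" "prime p"
  shows "of_nat a \<in> max_ideal V \<longleftrightarrow> p dvd a"
  using of_int_in_max_ideal_iff[OF assms, of "int a"] by simp

text \<open>\<open>(1 + u)\<^sup>q\<close> is as close to 1 as the large power \<open>u\<^sup>s\<close>, so \<open>u\<^sup>q\<close> must be balanced by the
  terms of the binomial expansion that carry a factor \<open>p\<close>.\<close>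

lemma power_in_p_max_ideal:
  fixes V :: "complex set"
  assumes V: "valuation_ring V" and p: "of_nat p \<in> max_ideal V" "prime p"
    and u: "u \<in> max_ideal V" "u \<noteq> 0" and q: "q = p ^ e" "e > 0" "q \<le> s"
    and w: "w \<in> V" "w \<notin> max_ideal V" "u ^ s = ((1 + u) ^ q - 1) * w" and sq: "s = q \<Longrightarrow> w = 1"
  shows "\<exists>m\<in>max_ideal V. u ^ q = of_nat p * m"
proof -
  note subV = valuation_ring_subring[OF V]
  have uV: "u \<in> V" using u max_ideal_subset by blast
  have p0: "(of_nat p :: complex) \<noteq> 0" using prime_gt_0_nat[OF p(2)] by simp
  define c where "c = (\<lambda>k. (q choose k) div p)"
  define z where "z = (\<Sum>k\<in>{1..<q}. of_nat (c k) * u ^ (k - 1))"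
  have zV: "z \<in> V" unfolding z_def
    by (intro is_subring_sum[OF subV] valuation_ringD(5)[OF V] is_subring_of_nat[OF subV] valuation_ringD(7)[OF V uV])
  have expand: "(1 + u) ^ q = 1 + u ^ q + of_nat p * u * z"
    unfolding z_def c_def by (rule one_plus_prime_power_expand[OF p(2) q(1,2)])
  show ?thesis
  proof (cases "s = q")
    case False
    \<comment> \<open>For s > q the power u^s is a non-unit multiple of u^q, and is absorbed into
      the unit \<open>v\<close>.\<close>
    define v where "v = 1 - u ^ (s - q) * inverse w"
    have "u ^ (s - q) * inverse w \<in> max_ideal V"
      using False q by (intro max_ideal_mult[OF V] max_ideal_power[OF V u(1)] inverse_unit w) auto
    then have v: "v \<notin> max_ideal V" "v \<in> V"
      using unit_add_max_ideal[OF V one_notin_max_ideal[OF V] max_ideal_uminus[OF V]]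
        valuation_ringD(4)[OF V valuation_ringD(1)[OF V] max_ideal_subset] by (auto simp: v_def)
    have w0: "w \<noteq> 0" using unit_nonzero[OF V w(2)] .
    have us: "u ^ s = u ^ q * u ^ (s - q)" using q(3) by (simp flip: power_add)
    have "u ^ q + of_nat p * u * z = u ^ s * inverse w" using w(3) expand w0 by (simp add: field_simps)
    then have "u ^ q * v = of_nat p * (- (u * z))" by (simp add: v_def us algebra_simps)
    then have "u ^ q = of_nat p * (- (u * z) * inverse v)" using unit_nonzero[OF V v(1)] by (simp add: field_simps)
    moreover have "- (u * z) * inverse v \<in> max_ideal V"
      by (intro max_ideal_mult[OF V] max_ideal_uminus[OF V] u(1) zV inverse_unit v)
    ultimately show ?thesis by blast
  next
    case True
    \<comment> \<open>For s = q the powers u^q cancel exactly and the information sits in z = 0. The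
      index K = p^(e-1) has a unit coefficient; the terms before it are divisible by p and those
      after it carry further powers of u, so u^(K-1) is divisible by p.\<close>
    then have "of_nat p * u * z = 0" using w(3) expand sq by simp
    then have z0: "z = 0" using p0 u by simp
    define K where "K = p ^ (e - 1)"
    have p1: "p > 1" using prime_gt_1_nat[OF p(2)] .
    have K: "0 < K" "K < q" "q = p * K" unfolding K_def using q p1 by (auto simp flip: power_Suc)
    have cK: "of_nat (c K) \<notin> max_ideal V"
    proof -
      have "c K = (q - 1) choose (K - 1)"
        using choose_prime_power_pred[OF p(2) q(2)] p1 by (simp add: c_def q K_def)
      moreover have "\<not> p dvd ((q - 1) choose (K - 1))"
      proof -
        have "K - 1 < p ^ e" using K(1,2) q(1) by linarith
        then show ?thesis unfolding q(1) by (rule prime_not_dvd_choose_pred_prime_power[OF p(2)])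
      qed
      ultimately show ?thesis using of_nat_in_max_ideal_iff[OF V p] by simp
    qed
    have small: "\<exists>d. c k = p * d" if "k \<in> {1..<K}" for k
    proof -
      have "p ^ 2 dvd (q choose k)"
        using prime_square_dvd_choose_prime_power[OF p(2), of k e] that q by (simp add: K_def)
      then obtain d where "q choose k = p ^ 2 * d" by auto
      then show ?thesis using p1 by (auto simp: c_def power2_eq_square)
    qed
    then obtain d where d: "\<And>k. k \<in> {1..<K} \<Longrightarrow> c k = p * d k" by metis
    define x where "x = (\<Sum>k\<in>{1..<K}. of_nat (d k) * u ^ (k - 1))"
    define h where "h = (\<Sum>k\<in>{K+1..<q}. of_nat (c k) * u ^ (k - K))"
    have xV: "x \<in> V" unfolding x_def
      by (intro is_subring_sum[OF subV] valuation_ringD(5)[OF V] is_subring_of_nat[OF subV] valuation_ringD(7)[OF V uV])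
    have hM: "h \<in> max_ideal V" unfolding h_def
      by (intro max_ideal_sum[OF V] max_ideal_mult'[OF V] is_subring_of_nat[OF subV] max_ideal_power[OF V u(1)]) auto
    have "{1..<q} = {1..<K} \<union> insert K {K+1..<q}" using K(1,2) by auto
    then have "z = (\<Sum>k\<in>{1..<K}. of_nat (c k) * u ^ (k - 1)) + (\<Sum>k\<in>insert K {K+1..<q}. of_nat (c k) * u ^ (k - 1))"
      unfolding z_def by (simp only:) (rule sum.union_disjoint, auto)
    also have "(\<Sum>k\<in>{1..<K}. of_nat (c k) * u ^ (k - 1)) = of_nat p * x"
      unfolding x_def sum_distrib_left by (rule sum.cong) (auto simp: d)
    also have "(\<Sum>k\<in>insert K {K+1..<q}. of_nat (c k) * u ^ (k - 1)) = u ^ (K - 1) * (of_nat (c K) + h)"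
    proof -
      have "(\<Sum>k\<in>{K+1..<q}. of_nat (c k) * u ^ (k - 1)) = u ^ (K - 1) * h"
        unfolding h_def sum_distrib_left
      proof (rule sum.cong)
        fix k assume "k \<in> {K+1..<q}"
        then have "u ^ (k - 1) = u ^ (K - 1) * u ^ (k - K)" using K by (simp flip: power_add)
        then show "of_nat (c k) * u ^ (k - 1) = u ^ (K - 1) * (of_nat (c k) * u ^ (k - K))" by simp
      qed simp
      then show ?thesis by (simp add: algebra_simps)
    qed
    finally have eq: "u ^ (K - 1) * (of_nat (c K) + h) = - of_nat p * x" using z0 by (simp add: eq_neg_iff_add_eq_0 add.commute)
    define v where "v = of_nat (c K) + h"
    have v: "v \<notin> max_ideal V" "v \<in> V" unfolding v_def
      using unit_add_max_ideal[OF V cK hM] valuation_ringD(3)[OF V is_subring_of_nat[OF subV] max_ideal_subset[OF hM]] by auto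
    have "u ^ (K - 1) = of_nat p * (- x * inverse v)"
      using eq unit_nonzero[OF V v(1)] by (simp add: v_def field_simps)
    moreover have "u ^ q = u ^ (K - 1) * u ^ (q - (K - 1))" using K(1,2) by (simp flip: power_add)
    ultimately have "u ^ q = of_nat p * ((- x * inverse v) * u ^ (q - (K - 1)))" by simp
    moreover have "(- x * inverse v) * u ^ (q - (K - 1)) \<in> max_ideal V"
      using K(1,2) by (intro max_ideal_mult'[OF V] max_ideal_power[OF V u(1)] valuation_ringD(5,6)[OF V] xV inverse_unit v) auto
    ultimately show ?thesis by blast
  qed
qed

text \<open>The source of the factor 3 in the local gap: for k = q j with j < L it gives 4 k <= q
  p^L <= r, which for k = r - s is 3 (r - s) <= s.\<close>

lemma four_mult_le_power: "4 * n \<le> p ^ (n + 1)" if "p \<ge> (2::nat)"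
proof -
  have "4 * n \<le> 2 ^ (n + 1)"
  proof (induction n)
    case (Suc n)
    show ?case
    proof (cases "n \<le> 1")
      case True then show ?thesis by (auto simp: le_Suc_eq)
    next
      case False
      have "(2::nat) ^ 2 \<le> 2 ^ n" using False by (intro power_increasing) auto
      then show ?thesis using Suc by simp
    qed
  qed simp
  also have "\<dots> \<le> p ^ (n + 1)" using that by (rule power_mono) simp
  finally show ?thesis .
qed

text \<open>Let p^e and p^f be the exact powers of p in s and r. The equations force e < f, and
  lifting the exponent shows that u^(r-s) is p^L up to a unit, L = f - e. As u^q for q = p^e is p
  times a non-unit, r - s is q j with 0 < j < L, while r is at least q p^L.\<close>

lemma local_gap_of_small_root:
  fixes V :: "complex set"
  assumes V: "valuation_ring V" and p: "of_nat p \<in> max_ideal V" "prime p"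
    and u: "u \<in> max_ideal V" "u \<noteq> 0" and rs: "1 < s" "s < r"
    and eqs: "(1 + u) ^ s = 1 + u ^ s" "(1 + u) ^ r = 1 + u ^ r"
  shows "2 \<le> r - s \<and> 3 * (r - s) \<le> s"
proof -
  note subV = valuation_ring_subring[OF V]
  have p2: "p \<ge> 2" using prime_ge_2_nat[OF p(2)] .
  have uV: "u \<in> V" using u max_ideal_subset by blast
  define t where "t = 1 + u"
  have t1: "t - 1 \<in> max_ideal V" using u by (simp add: t_def)
  have tV: "t ^ n \<in> V" for n using valuation_ringD(1,3,7)[OF V] uV by (simp add: t_def)
  obtain s' where s': "s = p ^ multiplicity p s * s'" "\<not> p dvd s'"
    using multiplicity_decompose'[of s p] rs p2 by auto
  obtain r' where r': "r = p ^ multiplicity p r * r'" "\<not> p dvd r'"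
    using multiplicity_decompose'[of r p] rs p2 by auto
  define e where "e = multiplicity p s"
  define f where "f = multiplicity p r"
  have un: "of_nat s' \<notin> max_ideal V" "of_nat r' \<notin> max_ideal V"
    using s' r' of_nat_in_max_ideal_iff[OF V p] by auto
  \<comment> \<open>Otherwise T - 1 would be u^r up to a unit and yet divide the lower power
    u^s.\<close>
  have "e < f"
  proof (rule ccontr)
    assume "\<not> e < f"
    define T where "T = t ^ (p ^ f)"
    have T: "T - 1 \<in> max_ideal V" unfolding T_def by (rule one_plus_max_ideal_power[OF V t1])
    obtain w where w: "w \<in> V" "w \<notin> max_ideal V" "T ^ r' - 1 = (T - 1) * w"
      using power_minus_one_unit[OF V T un(2)] by blast
    have "T ^ r' = t ^ r" using r'(1) by (simp add: T_def f_def flip: power_mult)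
    then have ur: "u ^ r = (T - 1) * w" using w(3) eqs(2) by (simp add: t_def)
    obtain z where z: "z \<in> V" "T ^ (p ^ (e - f) * s') - 1 = (T - 1) * z"
      using power_minus_one_dvd[OF V] tV unfolding T_def by blast
    have "p ^ f * (p ^ (e - f) * s') = s" using s'(1) \<open>\<not> e < f\<close> by (simp add: e_def flip: power_add mult.assoc)
    then have "T ^ (p ^ (e - f) * s') = t ^ s" by (simp add: T_def flip: power_mult)
    then have us: "u ^ s = (T - 1) * z" using z(2) eqs(1) by (simp add: t_def)
    have "u ^ r = u ^ s * u ^ (r - s)" using rs by (simp flip: power_add)
    then have "(T - 1) * w = (T - 1) * (z * u ^ (r - s))" using ur us by simp
    moreover have "T - 1 \<noteq> 0" using us u by auto
    ultimately have "w = z * u ^ (r - s)" by simp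
    then show False using w(2) max_ideal_mult'[OF V z(1) max_ideal_power[OF V u(1)]] rs by simp
  qed
  define q where "q = p ^ e"
  define T where "T = t ^ q"
  have T: "T - 1 \<in> max_ideal V" unfolding T_def by (rule one_plus_max_ideal_power[OF V t1])
  have sq: "s = q * s'" using s' by (simp add: q_def e_def)
  \<comment> \<open>For s' = 1 the factor is taken to be exactly 1: if s = q, the cancellation of
    u^q in \<open>power_in_p_max_ideal\<close> needs an equality, not one up to a unit.\<close>
  obtain w where w: "w \<in> V" "w \<notin> max_ideal V" "T ^ s' - 1 = (T - 1) * w" "s' = 1 \<Longrightarrow> w = 1"
  proof (cases "s' = 1")
    case True then show ?thesis using that[of 1] valuation_ringD(1)[OF V] one_notin_max_ideal[OF V] by simp
  next
    case False then show ?thesis using that power_minus_one_unit[OF V T un(1)] by blast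
  qed
  have us: "u ^ s = (T - 1) * w" using w(3) eqs(1) by (simp add: t_def T_def sq flip: power_mult)
  have e0: "e > 0"
  proof (rule ccontr)
    assume "\<not> e > 0"
    then have "u ^ s = u * w" using us by (simp add: T_def q_def t_def)
    moreover have "u ^ s = u * u ^ (s - 1)" using rs by (simp flip: power_Suc)
    ultimately have "w = u ^ (s - 1)" using u by simp
    then show False using w(2) max_ideal_power[OF V u(1)] rs by simp
  qed
  have s'0: "s' > 0" using sq rs by (cases s') auto
  have q2: "q \<ge> 2" using e0 p2 self_le_power[of p e] by (simp add: q_def)
  have q_s: "q \<le> s" using sq s'0 by simp
  obtain m where m: "m \<in> max_ideal V" "u ^ q = of_nat p * m"
    using power_in_p_max_ideal[OF V p u q_def e0 q_s w(1,2)] us w(4) sq q2 s'0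
    by (auto simp: T_def t_def)
  define L where "L = f - e"
  have L: "L > 0" "f = e + L" using \<open>e < f\<close> by (auto simp: L_def)
  have w0: "w \<noteq> 0" using unit_nonzero[OF V w(2)] .
  have "T - 1 = of_nat p * (m * u ^ (s - q) * inverse w)"
  proof -
    have "u ^ s = u ^ q * u ^ (s - q)" using q_s by (simp flip: power_add)
    then show ?thesis using us w0 m by (simp add: field_simps)
  qed
  moreover have "m * u ^ (s - q) * inverse w \<in> max_ideal V"
    by (intro max_ideal_mult[OF V] m valuation_ringD(7)[OF V uV] inverse_unit w)
  ultimately obtain w2 where w2: "w2 \<in> V" "w2 \<notin> max_ideal V" "T ^ (p ^ L) - 1 = of_nat p ^ L * (T - 1) * w2"
    using frobenius_power_unit[OF V, of T p] by blast
  have T2: "T ^ (p ^ L) - 1 \<in> max_ideal V" by (rule one_plus_max_ideal_power[OF V T])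
  obtain w3 where w3: "w3 \<in> V" "w3 \<notin> max_ideal V" "(T ^ (p ^ L)) ^ r' - 1 = (T ^ (p ^ L) - 1) * w3"
    using power_minus_one_unit[OF V T2 un(2)] by blast
  have "(T ^ (p ^ L)) ^ r' = t ^ r" using r'(1) L
    by (simp add: T_def q_def f_def[symmetric] power_add flip: power_mult mult.assoc)
  then have ur: "u ^ r = of_nat p ^ L * (T - 1) * w2 * w3" using w3(3) w2(3) eqs(2) by (simp add: t_def)
  define k where "k = r - s"
  have k: "r = s + k" "k > 0" using rs by (auto simp: k_def)
  define w5 where "w5 = inverse w * w2 * w3"
  have w5: "w5 \<in> V" "w5 \<notin> max_ideal V" unfolding w5_def
    by (intro unit_mult[OF V] valuation_ringD(5)[OF V] inverse_unit inverse_unit_notin[OF V] w w2 w3)+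
  have "T - 1 = u ^ s * inverse w" using us w0 by (simp add: field_simps)
  then have "u ^ s * u ^ k = u ^ s * (of_nat p ^ L * w5)" using ur by (simp add: k power_add w5_def mult.assoc)
  then have uk: "u ^ k = of_nat p ^ L * w5" using u by simp
  have p0: "(of_nat p :: complex) ^ L \<noteq> 0" using p2 by simp
  have lt: "k < q * L"
  proof (rule ccontr)
    assume "\<not> k < q * L"
    then have "u ^ k = (u ^ q) ^ L * u ^ (k - q * L)" by (simp flip: power_mult power_add)
    also have "\<dots> = of_nat p ^ L * (m ^ L * u ^ (k - q * L))" by (simp add: m power_mult_distrib)
    finally have "w5 = m ^ L * u ^ (k - q * L)" using uk p0 by (simp only: mult_cancel_left simp_thms)
    moreover have "m ^ L * u ^ (k - q * L) \<in> max_ideal V"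
      by (intro max_ideal_mult[OF V] max_ideal_power[OF V m(1)] valuation_ringD(7)[OF V uV] L)
    ultimately show False using w5 by simp
  qed
  have rq: "r = q * (p ^ L * r')" using r'(1) L by (simp add: q_def f_def[symmetric] power_add)
  then have "q dvd k" using sq k by (metis dvd_add_right_iff dvd_triv_left)
  then obtain j where j: "k = q * j" by auto
  have jL: "j < L" using lt j by simp
  have "r' > 0" using rq rs by (cases r') auto
  then have "q * p ^ L \<le> r" using rq by simp
  moreover have "q * (4 * j) \<le> q * p ^ L"
    using four_mult_le_power[OF p2, of j] power_increasing[of "j + 1" L p] jL p2
    by (intro mult_le_mono2) linarith
  ultimately have "4 * k \<le> r" using j by linarith
  moreover have "j > 0" using j k by (cases j) auto
  then have "2 \<le> k" using j q2 by (cases j) auto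
  ultimately show ?thesis using k by simp
qed

text \<open>This arises from u = -(y + 1), where even exponents change a sign. One even exponent
  forces residue characteristic 2; then an odd exponent n would make u^n equal to u times a unit. So
  both are even, and powers of u are compared with 2.\<close>

lemma no_small_root_even:
  fixes V :: "complex set"
  assumes V: "valuation_ring V" and u: "u \<in> max_ideal V" "u \<noteq> 0" and rs: "1 < s" "s < r"
    and odd: "\<And>n. n \<in> {r, s} \<Longrightarrow> odd n \<Longrightarrow> (1 + u) ^ n = 1 + u ^ n"
    and even: "\<And>n. n \<in> {r, s} \<Longrightarrow> even n \<Longrightarrow> (1 + u) ^ n = u ^ n - 1"
    and ex: "even r \<or> even s"
  shows False
proof -
  note subV = valuation_ring_subring[OF V]
  have uV: "u \<in> V" using u max_ideal_subset by blast
  define t where "t = 1 + u"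
  have t1: "t - 1 \<in> max_ideal V" using u by (simp add: t_def)
  have tV: "t ^ n \<in> V" for n using valuation_ringD(7)[OF V valuation_ringD(3)[OF V valuation_ringD(1)[OF V] uV]] by (simp add: t_def)
  have two: "2 \<in> max_ideal V"
  proof -
    obtain n where n: "n \<in> {r, s}" "even n" using ex by auto
    have "2 = u ^ n - (t ^ n - 1)" using even[OF n] by (simp add: t_def)
    moreover have "u ^ n \<in> max_ideal V" using n rs by (intro max_ideal_power[OF V u(1)]) auto
    ultimately show ?thesis using max_ideal_diff[OF V _ one_plus_max_ideal_power[OF V t1]] by metis
  qed
  have odd_unit: "of_nat n \<notin> max_ideal V" if n: "odd n" for n
  proof
    assume n': "of_nat n \<in> max_ideal V"
    obtain k where "n = 2 * k + 1" using n by (auto elim: oddE)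
    then have "1 = of_nat n - 2 * (of_nat k :: complex)" by simp
    moreover have "2 * (of_nat k :: complex) \<in> max_ideal V" by (intro max_ideal_mult[OF V] two is_subring_of_nat[OF subV])
    ultimately show False using max_ideal_diff[OF V n'] one_notin_max_ideal[OF V] by metis
  qed
  have not_odd: False if n: "n \<in> {r, s}" "odd n" for n
  proof -
    obtain w where w: "w \<in> V" "w \<notin> max_ideal V" "t ^ n - 1 = (t - 1) * w"
      using power_minus_one_unit[OF V t1 odd_unit[OF n(2)]] by blast
    then have "u ^ n = u * w" using odd[OF n] by (simp add: t_def)
    moreover have "u ^ n = u * u ^ (n - 1)" using n rs by (auto simp flip: power_Suc)
    ultimately have "w = u ^ (n - 1)" using u by simp
    then show False using w(2) max_ideal_power[OF V u(1), of "n - 1"] n rs by auto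
  qed
  then have ev: "even r" "even s" by auto
  obtain s' where s0: "s = 2 ^ multiplicity 2 s * s'" "odd s'"
    using multiplicity_decompose'[of s 2] rs by auto
  define e where "e = multiplicity 2 s"
  note s' = s0[folded e_def]
  obtain r' where r0: "r = 2 ^ multiplicity 2 r * r'" "odd r'"
    using multiplicity_decompose'[of r 2] rs by auto
  define f where "f = multiplicity 2 r"
  note r' = r0[folded f_def]
  \<comment> \<open>An odd cofactor n' lets -T, which is congruent to 1 since 2 is a non-unit, play
    the part of x in the lifting lemma.\<close>
  have plus: "\<exists>w\<in>V. w \<notin> max_ideal V \<and> u ^ n = (t ^ (2 ^ j) + 1) * w"
    if n: "n \<in> {r, s}" "n = 2 ^ j * n'" "odd n'" for n j n'
  proof -
    define T where "T = t ^ (2 ^ j)"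
    have "- T - 1 = - (T - 1) - 2" by simp
    then have "- T - 1 \<in> max_ideal V" unfolding T_def
      using max_ideal_diff[OF V max_ideal_uminus[OF V one_plus_max_ideal_power[OF V t1]] two] by metis
    then obtain w where w: "w \<in> V" "w \<notin> max_ideal V" "(- T) ^ n' - 1 = (- T - 1) * w"
      using power_minus_one_unit[OF V _ odd_unit[OF n(3)]] by blast
    have "t ^ n = T ^ n'" using n(2) by (simp add: T_def flip: power_mult)
    moreover have "even n" using n(1) ev by auto
    ultimately have "T ^ n' = u ^ n - 1" using even[OF n(1)] by (simp add: t_def)
    then have "u ^ n = (T + 1) * w" using w(3) n(3) by (simp add: algebra_simps)
    then show ?thesis using w by (auto simp: T_def)
  qed
  \<comment> \<open>Here a contains the smaller power of 2. As b' is even, T + 1 divides t^b - 1, so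
    2 is divisible by u^s; the binomial expansion of T + 1 then makes u^(2^j) divisible by u^s as
    well.\<close>
  have main: False if ab: "{a, b} = {r, s}" "a \<noteq> b" "a = 2 ^ j * a'" "odd a'" "b = 2 ^ j * b'" "even b'"
    for a b j a' b'
  proof -
    define T where "T = t ^ (2 ^ j)"
    have abm: "a \<in> {r, s}" "b \<in> {r, s}" using ab(1) by blast+
    have eva: "even a" "even b" using abm ev by auto
    have j0: "j > 0" using eva(1) ab(3,4) by (cases j) auto
    obtain w where w: "w \<in> V" "w \<notin> max_ideal V" "u ^ a = (T + 1) * w"
      using plus[OF abm(1) ab(3,4)] by (auto simp: T_def)
    have w0: "w \<noteq> 0" using unit_nonzero[OF V w(2)] .
    obtain c where c: "b' = 2 * c" using ab(6) by auto
    have "T ^ 2 \<in> V" unfolding T_def by (intro valuation_ringD(7)[OF V] tV)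
    then obtain z where z: "z \<in> V" "(T ^ 2) ^ c - 1 = (T ^ 2 - 1) * z" using power_minus_one_dvd[OF V] by blast
    have "t ^ b = (T ^ 2) ^ c" using ab(5) c by (simp add: T_def ac_simps flip: power_mult)
    then have tb: "t ^ b - 1 = (T + 1) * ((T - 1) * z)" using z(2) by (simp add: power2_eq_square algebra_simps)
    have TV: "T \<in> V" unfolding T_def by (rule tV)
    have T1: "T + 1 = u ^ a * inverse w" using w(3) w0 by (simp add: field_simps)
    have sa: "u ^ n = u ^ s * u ^ (n - s)" if "n \<in> {r, s}" for n using that rs by (auto simp flip: power_add)
    define y where "y = u ^ (b - s) - u ^ (a - s) * inverse w * ((T - 1) * z)"
    have yV: "y \<in> V" unfolding y_def
      by (intro valuation_ringD(4)[OF V] valuation_ringD(5)[OF V] valuation_ringD(7)[OF V uV] inverse_unit w z(1) TV valuation_ringD(1)[OF V])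
    have "2 = u ^ b - (t ^ b - 1)" using even[OF abm(2) eva(2)] by (simp add: t_def)
    also have "\<dots> = u ^ b - u ^ a * inverse w * ((T - 1) * z)" unfolding tb T1 ..
    also have "\<dots> = u ^ s * y" by (simp add: sa[OF abm(1)] sa[OF abm(2)] y_def algebra_simps)
    finally have 2: "2 = u ^ s * y" .
    define x where "x = (\<Sum>k\<in>{1..<2^j}. of_nat ((2^j choose k) div 2) * u ^ (k - 1))"
    have xV: "x \<in> V" unfolding x_def
      by (intro is_subring_sum[OF subV] valuation_ringD(5)[OF V] is_subring_of_nat[OF subV] valuation_ringD(7)[OF V uV])
    have ex: "T + 1 = 2 * (1 + u * x) + u ^ (2 ^ j)"
      using one_plus_prime_power_expand[OF two_is_prime_nat refl j0, of u] by (simp add: T_def t_def x_def algebra_simps)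
    have ux: "1 + u * x \<notin> max_ideal V" "1 + u * x \<in> V"
      using unit_add_max_ideal[OF V one_notin_max_ideal[OF V] max_ideal_mult[OF V u(1) xV]]
        valuation_ringD(3)[OF V valuation_ringD(1)[OF V] max_ideal_subset[OF max_ideal_mult[OF V u(1) xV]]] by auto
    show False
    proof (cases "2 ^ j < s")
      case True
      have "u ^ (2 ^ j) = u ^ a * inverse w - u ^ s * y * (1 + u * x)" using ex T1 2 by simp
      also have "\<dots> = u ^ s * (u ^ (a - s) * inverse w - y * (1 + u * x))" using sa[OF abm(1)] by (simp add: algebra_simps)
      also have "u ^ s = u ^ (2 ^ j) * u ^ (s - 2 ^ j)" using True by (simp flip: power_add)
      finally have "u ^ (2 ^ j) * 1 = u ^ (2 ^ j) * (u ^ (s - 2 ^ j) * (u ^ (a - s) * inverse w - y * (1 + u * x)))"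
        by (simp add: mult.assoc)
      then have "1 = u ^ (s - 2 ^ j) * (u ^ (a - s) * inverse w - y * (1 + u * x))" using u(2)
        by (simp only: mult_cancel_left power_eq_0_iff simp_thms)
      moreover have "u ^ (s - 2 ^ j) * (u ^ (a - s) * inverse w - y * (1 + u * x)) \<in> max_ideal V"
        using True by (intro max_ideal_mult[OF V] max_ideal_power[OF V u(1)] valuation_ringD(4)[OF V]
          valuation_ringD(5)[OF V] valuation_ringD(7)[OF V uV] inverse_unit w yV ux) auto
      ultimately show False using one_notin_max_ideal[OF V] by simp
    next
      \<comment> \<open>Now a = s = 2^j, so T + 1 is exactly u^(2^j), and the expansion would give 2
        (1 + u x) = 0.\<close>
      case False
      have "b' \<noteq> 0" using abm(2) ab(5) rs by (cases "b' = 0") auto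
      then have "2 ^ j < b" using c ab(5) by auto
      then have as: "a = s" "b = r" using False abm ab(2) by auto
      have "a' = 1" using False as ab(3,4) rs by (cases a') auto
      then have "2 ^ j = a" using ab(3) by simp
      then have "T + 1 = u ^ (2 ^ j)" using even[OF abm(1) eva(1)] by (simp add: T_def t_def)
      then have "2 * (1 + u * x) = 0" using ex by (metis add_cancel_left_left)
      then show False using unit_nonzero[OF V ux(1)] by (simp only: mult_eq_0_iff) simp
    qed
  qed
  consider "e = f" | "e < f" | "f < e" by linarith
  then show False
  proof cases
    case 1
    obtain w1 where w1: "w1 \<in> V" "w1 \<notin> max_ideal V" "u ^ s = (t ^ (2 ^ e) + 1) * w1" using plus[of s e s'] s' by auto
    obtain w2 where w2: "w2 \<in> V" "w2 \<notin> max_ideal V" "u ^ r = (t ^ (2 ^ e) + 1) * w2" using plus[of r e r'] r' 1 by auto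
    have "u ^ r = u ^ s * u ^ (r - s)" using rs by (simp flip: power_add)
    then have "(t ^ (2 ^ e) + 1) * w2 = (t ^ (2 ^ e) + 1) * (w1 * u ^ (r - s))" using w1 w2 by simp
    moreover have "t ^ (2 ^ e) + 1 \<noteq> 0" using w1(3) u(2) by auto
    ultimately have "w2 = w1 * u ^ (r - s)" by simp
    then show False using w2(2) max_ideal_mult'[OF V w1(1) max_ideal_power[OF V u(1)]] rs by simp
  next
    case 2
    have "r = 2 ^ e * (2 ^ (f - e) * r')" using r'(1) 2 by (simp flip: power_add mult.assoc)
    then show False using main[of s r e s' "2 ^ (f - e) * r'"] s' rs 2 by auto
  next
    case 3
    have "s = 2 ^ f * (2 ^ (e - f) * s')" using s'(1) 3 by (simp flip: power_add mult.assoc)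
    then show False using main[of r s f r' "2 ^ (e - f) * s'"] r' rs 3 by auto
  qed
qed

text \<open>The maps y to 1/y and y to -(y + 1) move infinity and -1 to 0, so each kind of non-unit
  becomes a small root.\<close>

theorem local_gap:
  fixes V :: "complex set"
  assumes V: "valuation_ring V" and p: "of_nat p \<in> max_ideal V" "prime p"
    and rs: "1 < s" "s < r" and y: "y \<noteq> 0" "y \<noteq> -1"
    and eqs: "(y + 1) ^ s = y ^ s + 1" "(y + 1) ^ r = y ^ r + 1"
    and nonunit: "y \<notin> V \<or> y \<in> max_ideal V \<or> y + 1 \<in> max_ideal V"
  shows "2 \<le> r - s \<and> 3 * (r - s) \<le> s"
proof -
  consider "y \<notin> V" | "y \<in> max_ideal V" | "y + 1 \<in> max_ideal V" using nonunit by blast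
  then show ?thesis
  proof cases
    case 1
    have *: "(1 + inverse y) ^ n = 1 + inverse y ^ n" if "(y + 1) ^ n = y ^ n + 1" for n
    proof -
      have "1 + inverse y = (y + 1) / y" using y by (simp add: field_simps)
      then have "(1 + inverse y) ^ n = (y ^ n + 1) / y ^ n" using that by (simp add: power_divide)
      then show ?thesis using y by (simp add: field_simps)
    qed
    show ?thesis
      using local_gap_of_small_root[OF V p inverse_in_max_ideal[OF V 1] _ rs *[OF eqs(1)] *[OF eqs(2)]] y by simp
  next
    case 2
    show ?thesis
      using local_gap_of_small_root[OF V p 2 y(1) rs] eqs by (simp add: add.commute)
  next
    case 3
    define u where "u = - (y + 1)"
    have u: "u \<in> max_ideal V" "u \<noteq> 0" using max_ideal_uminus[OF V 3] y(2) eq_neg_iff_add_eq_0[of y 1]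
      by (auto simp only: u_def neg_equal_0_iff_equal)
    have t: "1 + u = - y" by (simp add: u_def)
    have odd: "(1 + u) ^ n = 1 + u ^ n" if "odd n" "(y + 1) ^ n = y ^ n + 1" for n
      using that unfolding t by (simp add: u_def del: minus_add_distrib)
    have even: "(1 + u) ^ n = u ^ n - 1" if "even n" "(y + 1) ^ n = y ^ n + 1" for n
      using that unfolding t by (simp add: u_def del: minus_add_distrib)
    show ?thesis
    proof (cases "even r \<or> even s")
      case True
      then have False using no_small_root_even[OF V u rs _ _ True] odd even eqs by blast
      then show ?thesis ..
    next
      case False
      then show ?thesis using local_gap_of_small_root[OF V p u rs odd[OF _ eqs(1)] odd[OF _ eqs(2)]] by blast
    qed
  qed
qed

section \<open>Heights of common zeros\<close>

definition trinomial_root :: "nat \<Rightarrow> complex \<Rightarrow> bool" where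
  "trinomial_root n y \<longleftrightarrow> (y + 1) ^ n = y ^ n + 1"

definition nontrivial :: "complex \<Rightarrow> bool" where
  "nontrivial y \<longleftrightarrow> y \<noteq> 0 \<and> y \<noteq> -1 \<and> y\<^sup>2 + y + 1 \<noteq> 0"

text \<open>The archimedean factor of the height. Keeping y + 1 as a third coordinate respects the
  symmetries permuting 0, -1 and infinity, so estimates can be normalised by the largest
  coordinate.\<close>

definition hgt :: "complex \<Rightarrow> real" where
  "hgt y = max (cmod (y + 1)) (max (cmod y) 1)"

text \<open>A primitive polynomial with its list of roots; that all roots satisfy the same integer
  equations is a separate hypothesis where the argument passes from one root to the others.\<close>

definition is_conjugates :: "int poly \<Rightarrow> complex list \<Rightarrow> bool" where
  "is_conjugates G ys \<longleftrightarrow> Polynomial.content G = 1 \<and> ys \<noteq> [] \<and>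
     of_int_poly G = smult (of_int (lead_coeff G)) (\<Prod>z\<leftarrow>ys. [:- z, 1 :: complex:])"

lemma hgt_ge_1: "hgt y \<ge> 1" by (simp add: hgt_def)

lemma hgt_cases: "hgt y = 1 \<or> hgt y = cmod y \<or> hgt y = cmod (y + 1)"
  by (simp add: hgt_def max_def)

text \<open>In p = |y|^2 and q = |y + 1|^2 this is the symmetric form p^2 + q^2 + w^2 - p q - p w -
  q w at w = 1, so the estimates for complex y become real inequalities.\<close>

lemma norm_quadratic_squared:
  "(cmod (y\<^sup>2 + y + 1))\<^sup>2 = (cmod y) ^ 4 + (cmod (y + 1)) ^ 4 + 1
     - (cmod y)\<^sup>2 * (cmod (y + 1))\<^sup>2 - (cmod y)\<^sup>2 - (cmod (y + 1))\<^sup>2"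
proof -
  have 4: "x ^ 4 = (x\<^sup>2)\<^sup>2" for x :: real by simp
  show ?thesis unfolding 4 cmod_power2 by (simp add: power2_eq_square algebra_simps)
qed

lemma unit_circle_trivial:
  assumes "cmod y = 1" "cmod (y + 1) = 1"
  shows "y\<^sup>2 + y + 1 = 0"
  using norm_quadratic_squared[of y] assms by simp

text \<open>Bounds the symmetric form through the product p q alone, which leaves a problem in one
  variable p q / w^2.\<close>

lemma triangle_form_le:
  fixes p q w :: real
  assumes "0 \<le> p" "0 \<le> q" "p \<le> w" "q \<le> w"
  shows "(p\<^sup>2 + q\<^sup>2 + w\<^sup>2 - p * q - p * w - q * w) * w\<^sup>2 \<le> (w\<^sup>2 - p * q)\<^sup>2"
proof -
  have "(w\<^sup>2 - p * q)\<^sup>2 - (p\<^sup>2 + q\<^sup>2 + w\<^sup>2 - p * q - p * w - q * w) * w\<^sup>2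
      = (w - p) * (w - q) * (w * p + w * q + p * q)"
    by (simp add: power2_eq_square algebra_simps)
  moreover have "(w - p) * (w - q) * (w * p + w * q + p * q) \<ge> 0" using assms by simp
  ultimately show ?thesis by linarith
qed

text \<open>Here Zagier's constant arises: x (1 - x)^2 has maximum 4/27 on [0, 1], attained at x =
  1/3, which shows as the squared factor in \<open>id\<close>.\<close>

lemma triangle_form_product_le:
  fixes p q w :: real
  assumes "0 \<le> p" "0 \<le> q" "p \<le> w" "q \<le> w" "0 < w"
  shows "27 * (p\<^sup>2 + q\<^sup>2 + w\<^sup>2 - p * q - p * w - q * w) * (p * q * w) \<le> 4 * w ^ 5"
proof -
  let ?T = "p\<^sup>2 + q\<^sup>2 + w\<^sup>2 - p * q - p * w - q * w"
  have "p * q \<le> w * w" using assms by (intro mult_mono) auto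
  then have "3 * (p * q) \<le> 4 * w\<^sup>2" using zero_le_square[of w] unfolding power2_eq_square by linarith
  then have pos: "0 \<le> (w\<^sup>2 - 3 * (p * q))\<^sup>2 * (4 * w\<^sup>2 - 3 * (p * q))" by simp
  have id: "4 * w ^ 6 - 27 * (w\<^sup>2 - p * q)\<^sup>2 * (p * q) = (w\<^sup>2 - 3 * (p * q))\<^sup>2 * (4 * w\<^sup>2 - 3 * (p * q))"
    by (simp add: power_numeral_reduce algebra_simps)
  have "w * (27 * ?T * (p * q * w)) = 27 * (?T * w\<^sup>2) * (p * q)" by (simp add: power2_eq_square)
  also have "\<dots> \<le> 27 * (w\<^sup>2 - p * q)\<^sup>2 * (p * q)"
    using triangle_form_le[OF assms(1-4)] assms by (intro mult_right_mono) auto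
  also have "\<dots> \<le> 4 * w ^ 6" using pos id by linarith
  also have "\<dots> = w * (4 * w ^ 5)" by (simp add: power_numeral_reduce)
  finally show ?thesis using assms(5) by simp
qed

text \<open>Zagier's inequality at one archimedean place, normalised by the largest of
  \<open>|y + 1|\<close>, \<open>|y|\<close> and \<open>1\<close>.\<close>

lemma zagier_local:
  "27 * (cmod (y\<^sup>2 + y + 1) * cmod y * cmod (y + 1))\<^sup>2 \<le> 4 * hgt y ^ 10"
proof -
  define p where "p = (cmod y)\<^sup>2"
  define q where "q = (cmod (y + 1))\<^sup>2"
  have pq: "p \<ge> 0" "q \<ge> 0" by (auto simp: p_def q_def)
  have d: "(cmod (y\<^sup>2 + y + 1))\<^sup>2 = p\<^sup>2 + q\<^sup>2 + 1 - p * q - p - q"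
    using norm_quadratic_squared[of y] by (simp add: p_def q_def)
  have "27 * (p\<^sup>2 + q\<^sup>2 + 1 - p * q - p - q) * (p * q) \<le> 4 * ((hgt y)\<^sup>2) ^ 5"
  proof -
    consider "hgt y = 1" | "hgt y = cmod y" | "hgt y = cmod (y + 1)" using hgt_cases by blast
    then show ?thesis
    proof cases
      case 1
      then have "p \<le> 1" "q \<le> 1" by (auto simp: p_def q_def hgt_def power_le_one)
      then show ?thesis using triangle_form_product_le[of p q 1] pq 1 by simp
    next
      case 2
      then have "q \<le> p" "1 \<le> p" unfolding p_def q_def by (auto simp: hgt_def intro!: power_mono one_le_power)
      moreover have "(hgt y)\<^sup>2 = p" by (simp add: 2 p_def)
      ultimately show ?thesis using triangle_form_product_le[of q 1 p] pq by (simp add: algebra_simps)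
    next
      case 3
      then have "p \<le> q" "1 \<le> q" unfolding p_def q_def by (auto simp: hgt_def intro!: power_mono one_le_power)
      moreover have "(hgt y)\<^sup>2 = q" by (simp add: 3 q_def)
      ultimately show ?thesis using triangle_form_product_le[of p 1 q] pq by (simp add: algebra_simps)
    qed
  qed
  moreover have "((hgt y)\<^sup>2) ^ 5 = hgt y ^ 10" by (simp flip: power_mult)
  ultimately show ?thesis unfolding power_mult_distrib d p_def[symmetric] q_def[symmetric] by (simp only: mult.assoc)
qed

lemma prod_list_le:
  fixes f g :: "'a \<Rightarrow> real"
  assumes "\<And>y. y \<in> set ys \<Longrightarrow> 0 \<le> f y" "\<And>y. y \<in> set ys \<Longrightarrow> f y \<le> g y"
  shows "0 \<le> (\<Prod>y\<leftarrow>ys. f y) \<and> (\<Prod>y\<leftarrow>ys. f y) \<le> (\<Prod>y\<leftarrow>ys. g y)"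
  using assms
proof (induction ys)
  case (Cons a ys)
  have *: "0 \<le> f a" "f a \<le> g a" using Cons.prems by auto
  have "0 \<le> (\<Prod>y\<leftarrow>ys. f y) \<and> (\<Prod>y\<leftarrow>ys. f y) \<le> (\<Prod>y\<leftarrow>ys. g y)" using Cons by auto
  then show ?case using * by (auto intro!: mult_mono)
qed simp

lemma prod_list_ge_1:
  fixes f :: "'a \<Rightarrow> real"
  shows "(\<And>y. y \<in> set ys \<Longrightarrow> 1 \<le> f y) \<Longrightarrow> 1 \<le> (\<Prod>y\<leftarrow>ys. f y)"
  using prod_list_le[of ys "\<lambda>_. 1" f] by (simp add: prod_list_const)

text \<open>For a primitive minimal polynomial of degree d this is the d-th power of the height: by
  Gauss's lemma the leading coefficient collects the finite places, where max(1, |y|, |y + 1|) is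
  max(1, |y|).\<close>

definition mahler :: "int poly \<Rightarrow> complex list \<Rightarrow> real" where
  "mahler G ys = \<bar>of_int (lead_coeff G)\<bar> * (\<Prod>y\<leftarrow>ys. hgt y)"

lemma conjugates_norm_ge_1:
  assumes "is_conjugates G ys" "degree U \<le> n" "\<And>y. y \<in> set ys \<Longrightarrow> poly (of_int_poly U) y \<noteq> 0"
  shows "1 \<le> \<bar>of_int (lead_coeff G)\<bar> ^ n * (\<Prod>y\<leftarrow>ys. cmod (poly (of_int_poly U) y))"
proof -
  have G: "of_int_poly G = smult (of_int (lead_coeff G)) (\<Prod>z\<leftarrow>ys. [:- z, 1 :: complex:])" "Polynomial.content G = 1"
    using assms(1) by (auto simp: is_conjugates_def)
  have "lead_coeff G \<noteq> 0" using G(2) by auto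
  moreover have "(\<Prod>y\<leftarrow>ys. poly (of_int_poly U) y) \<noteq> 0" using assms(3) by (auto simp: prod_list_zero_iff)
  ultimately have "1 \<le> cmod (of_int (lead_coeff G) ^ n * (\<Prod>y\<leftarrow>ys. poly (of_int_poly U) y))"
    by (intro Ints_nonzero_norm_ge_1[OF norm_integral[OF G assms(2)]]) simp
  then show ?thesis by (simp add: norm_mult norm_power norm_prod_list)
qed

lemma conjugates_lead_ge_1:
  assumes "is_conjugates G ys" shows "1 \<le> \<bar>real_of_int (lead_coeff G)\<bar>"
proof -
  have "G \<noteq> 0" using assms by (auto simp: is_conjugates_def)
  then have "1 \<le> \<bar>lead_coeff G\<bar>" using leading_coeff_0_iff[of G] by linarith
  then show ?thesis by linarith
qed

lemma mahler_ge_1: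
  assumes "is_conjugates G ys" shows "1 \<le> mahler G ys"
  using mult_mono[OF conjugates_lead_ge_1[OF assms] prod_list_ge_1[of ys hgt]] hgt_ge_1
  by (simp add: mahler_def)

text \<open>The norms of y, y + 1 and y^2 + y + 1, cleared of denominators, are nonzero integers;
  the local inequality multiplied over the conjugates bounds their product by the height.\<close>

theorem mahler_lower_bound:
  assumes c: "is_conjugates G ys" and nt: "\<And>y. y \<in> set ys \<Longrightarrow> nontrivial y"
  shows "(27 / 4) ^ length ys \<le> mahler G ys ^ 10"
proof -
  define l where "l = \<bar>real_of_int (lead_coeff G)\<bar>"
  define P where "P = (\<lambda>f :: complex \<Rightarrow> real. \<Prod>y\<leftarrow>ys. f y)"
  have l1: "1 \<le> l" unfolding l_def by (rule conjugates_lead_ge_1[OF c])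
  have 1: "1 \<le> l ^ 2 * P (\<lambda>y. cmod (y\<^sup>2 + y + 1))"
    using conjugates_norm_ge_1[OF c, of "[:1, 1, 1:]" 2] nt
    by (simp add: P_def l_def nontrivial_def power2_eq_square algebra_simps)
  have 2: "1 \<le> l * P (\<lambda>y. cmod y)"
    using conjugates_norm_ge_1[OF c, of "[:0, 1:]" 1] nt by (simp add: P_def l_def nontrivial_def)
  have 3: "1 \<le> l * P (\<lambda>y. cmod (y + 1))"
    using conjugates_norm_ge_1[OF c, of "[:1, 1:]" 1] nt
    by (simp add: P_def l_def nontrivial_def add.commute eq_neg_iff_add_eq_0)
  have "1 * (1 * 1) \<le> (l ^ 2 * P (\<lambda>y. cmod (y\<^sup>2 + y + 1))) * ((l * P (\<lambda>y. cmod y)) * (l * P (\<lambda>y. cmod (y + 1))))"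
    using 1 2 3 by (intro mult_mono) auto
  also have "\<dots> = l ^ 4 * P (\<lambda>y. cmod (y\<^sup>2 + y + 1) * cmod y * cmod (y + 1))"
    by (simp add: P_def prod_list_mult power4_eq_xxxx power2_eq_square)
  finally have "1 \<le> (l ^ 4 * P (\<lambda>y. cmod (y\<^sup>2 + y + 1) * cmod y * cmod (y + 1)))\<^sup>2"
    by (simp add: one_le_power)
  also have "\<dots> = l ^ 8 * P (\<lambda>y. (cmod (y\<^sup>2 + y + 1) * cmod y * cmod (y + 1))\<^sup>2)"
    by (simp add: P_def prod_list_pow power_mult_distrib[of "l ^ 4"] flip: power_mult)
  \<comment> \<open>As l is at least 1, the exponent may grow from 8 to 10 to match the tenth powers
    of \<open>hgt\<close>.\<close>
  also have "\<dots> \<le> l ^ 10 * P (\<lambda>y. (cmod (y\<^sup>2 + y + 1) * cmod y * cmod (y + 1))\<^sup>2)"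
    using l1 unfolding P_def by (intro mult_right_mono power_increasing prod_list_le[THEN conjunct1]) auto
  also have "\<dots> \<le> l ^ 10 * P (\<lambda>y. 4 / 27 * hgt y ^ 10)"
    using l1 zagier_local unfolding P_def
    by (intro mult_left_mono prod_list_le[THEN conjunct2]) (auto simp: field_simps)
  also have "\<dots> = (4 / 27) ^ length ys * mahler G ys ^ 10"
    by (simp only: P_def prod_list_mult prod_list_const prod_list_pow mahler_def l_def power_mult_distrib mult.left_commute)
  finally show ?thesis by (simp add: power_divide field_simps)
qed

section \<open>The norm of (y + 1)^(r-s) - y^(r-s)\<close>

lemma gap_difference:
  assumes s: "trinomial_root s y" and r: "trinomial_root (s + k) y"
  shows "y ^ s * ((y + 1) ^ k - y ^ k) = 1 - (y + 1) ^ k"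
    "(y + 1) ^ s * ((y + 1) ^ k - y ^ k) = 1 - y ^ k"
proof -
  have "(y ^ s + 1) * (y + 1) ^ k = y ^ s * y ^ k + 1"
    using s r by (simp add: trinomial_root_def power_add)
  then show *: "y ^ s * ((y + 1) ^ k - y ^ k) = 1 - (y + 1) ^ k" by (simp add: algebra_simps)
  have "(y + 1) ^ s = y ^ s + 1" using s by (simp add: trinomial_root_def)
  then show "(y + 1) ^ s * ((y + 1) ^ k - y ^ k) = 1 - y ^ k" using * by (simp add: algebra_simps)
qed

text \<open>Multiplied by the s-th power of the largest coordinate, the difference is again a
  difference of two k-th powers of coordinates; this is where both equations are used.\<close>

lemma gap_difference_bound:
  assumes "trinomial_root s y" "trinomial_root (s + k) y" "k \<le> s"
  shows "cmod ((y + 1) ^ k - y ^ k) * hgt y ^ (s - k) \<le> 2"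
proof -
  note gd = gap_difference[OF assms(1,2)]
  have b: "cmod (u ^ k - v ^ k) \<le> 2 * hgt y ^ k" if "cmod u \<le> hgt y" "cmod v \<le> hgt y" for u v
  proof -
    have "cmod (u ^ k - v ^ k) \<le> cmod u ^ k + cmod v ^ k"
      by (metis norm_triangle_ineq4 norm_power)
    also have "\<dots> \<le> hgt y ^ k + hgt y ^ k" using that by (intro add_mono power_mono) auto
    finally show ?thesis by simp
  qed
  have le: "cmod (y + 1) \<le> hgt y" "cmod y \<le> hgt y" "cmod 1 \<le> hgt y" by (auto simp: hgt_def)
  define A where "A = (y + 1) ^ k - y ^ k"
  have "cmod A * hgt y ^ s \<le> 2 * hgt y ^ k"
  proof -
    consider "hgt y = 1" | "hgt y = cmod y" | "hgt y = cmod (y + 1)" using hgt_cases by blast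
    then show ?thesis
    proof cases
      case 1 then show ?thesis using b[OF le(1,2)] by (simp add: A_def)
    next
      case 2
      have "cmod A * hgt y ^ s = cmod (y ^ s * A)" by (simp add: 2 norm_mult norm_power)
      also have "\<dots> = cmod (1 ^ k - (y + 1) ^ k)" using gd(1) by (simp add: A_def)
      finally show ?thesis using b[OF le(3,1)] by simp
    next
      case 3
      have "cmod A * hgt y ^ s = cmod ((y + 1) ^ s * A)" by (simp add: 3 norm_mult norm_power)
      also have "\<dots> = cmod (1 ^ k - y ^ k)" using gd(2) by (simp add: A_def)
      finally show ?thesis using b[OF le(3,2)] by simp
    qed
  qed
  moreover have "hgt y ^ s = hgt y ^ (s - k) * hgt y ^ k" using assms(3) by (simp flip: power_add)
  moreover have "hgt y ^ k > 0" using hgt_ge_1[of y] by simp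
  ultimately show ?thesis by (simp add: A_def mult.assoc[symmetric])
qed

text \<open>The difference becomes integral after multiplication by y^(s-k) where y is not integral,
  so its nonzero norm is divisible by the (s-k)-th power of the leading coefficient. The archimedean
  bound has the same exponent s - k, and the two merge in the Mahler measure.\<close>

lemma gap_norm_bound:
  assumes c: "is_conjugates G ys" and nt: "\<And>y. y \<in> set ys \<Longrightarrow> nontrivial y"
    and s: "\<And>y. y \<in> set ys \<Longrightarrow> trinomial_root s y" and r: "\<And>y. y \<in> set ys \<Longrightarrow> trinomial_root (s + k) y"
    and k: "0 < k" "k \<le> s"
  shows "mahler G ys ^ (s - k) \<le> 2 ^ length ys"
proof -
  have G: "of_int_poly G = smult (of_int (lead_coeff G)) (\<Prod>z\<leftarrow>ys. [:- z, 1 :: complex:])" "Polynomial.content G = 1"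
    using c by (auto simp: is_conjugates_def)
  have G0: "G \<noteq> 0" using G(2) by auto
  define A where "A = (\<lambda>y :: complex. (y + 1) ^ k - y ^ k)"
  define U :: "int poly" where "U = [:1, 1:] ^ k - [:0, 1:] ^ k"
  have UA: "poly (of_int_poly U) y = A y" for y :: complex
    by (simp add: U_def A_def hom_distribs poly_power add.commute)
  define q where "q = (\<Prod>y\<leftarrow>ys. A y) / of_int (lead_coeff G) ^ (s - k)"
  have "q \<in> \<int>"
  proof (rule rational_integer_criterion)
    show "q \<in> \<rat>" using norm_rational[OF G(1) G0, of U] unfolding q_def UA by (intro Rats_divide Rats_power Rats_of_int)
    fix p and V :: "complex set" assume p: "prime p" "valuation_ring V" "of_nat p \<in> max_ideal V"
    note V = p(2)
    show "q \<in> V" unfolding q_def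
    proof (rule norm_local_integral_divided[OF V G(1) content_one_primitive_over[OF G(2) p]])
      fix y assume y: "y \<in> set ys"
      show "A y * large_part V y ^ (s - k) \<in> V"
      proof (cases "y \<in> V")
        case True
        then show ?thesis by (simp add: A_def large_part_def valuation_ringD[OF V])
      next
        case False
        then have y0: "y \<noteq> 0" "inverse y \<in> V" using inverse_in_max_ideal[OF V False] max_ideal_subset valuation_ringD(2)[OF V] by auto
        have ys: "y ^ s = y ^ (s - k) * y ^ k" using k by (simp flip: power_add)
        have "(1 + inverse y) = (y + 1) / y" using y0 by (simp add: field_simps)
        then have "inverse y ^ k - (1 + inverse y) ^ k = (1 - (y + 1) ^ k) / y ^ k"
          by (simp add: power_divide power_inverse diff_divide_distrib field_simps)
        also have "\<dots> = A y * y ^ (s - k)" using gap_difference(1)[OF s[OF y] r[OF y]] y0 ys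
          by (simp add: A_def field_simps)
        finally have "A y * large_part V y ^ (s - k) = inverse y ^ k - (1 + inverse y) ^ k" using False by (simp add: large_part_def)
        also have "\<dots> \<in> V" using y0 by (intro valuation_ringD(4)[OF V] valuation_ringD(7)[OF V] valuation_ringD(3)[OF V valuation_ringD(1)[OF V]])
        finally show ?thesis .
      qed
    qed
  qed
  \<comment> \<open>A zero would give (y + 1)^k = y^k = 1, and two absolute values 1 make y a
    primitive cube root of unity.\<close>
  have An0: "A y \<noteq> 0" if "y \<in> set ys" for y
  proof
    assume "A y = 0"
    then have "(y + 1) ^ k = 1" "y ^ k = 1" using gap_difference[OF s[OF that] r[OF that]] by (auto simp: A_def)
    then have "cmod (y + 1) ^ k = 1" "cmod y ^ k = 1" by (metis norm_one norm_power)+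
    then have "cmod (y + 1) = 1" "cmod y = 1"
      using k(1) power_eq_iff_eq_base[of k "cmod (y + 1)" 1] power_eq_iff_eq_base[of k "cmod y" 1] by simp_all
    then show False using unit_circle_trivial nt[OF that] by (auto simp: nontrivial_def)
  qed
  then have "q \<noteq> 0" using G0 by (auto simp: q_def prod_list_zero_iff)
  then have "1 \<le> cmod q" by (rule Ints_nonzero_norm_ge_1[OF \<open>q \<in> \<int>\<close>])
  moreover have "0 < \<bar>real_of_int (lead_coeff G)\<bar> ^ (s - k)" using conjugates_lead_ge_1[OF c] by (intro zero_less_power) linarith
  ultimately have *: "\<bar>real_of_int (lead_coeff G)\<bar> ^ (s - k) \<le> (\<Prod>y\<leftarrow>ys. cmod (A y))"
    by (simp add: q_def norm_divide norm_power norm_prod_list pos_le_divide_eq del: zero_less_power_abs_iff)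
  have "mahler G ys ^ (s - k) = \<bar>real_of_int (lead_coeff G)\<bar> ^ (s - k) * (\<Prod>y\<leftarrow>ys. hgt y ^ (s - k))"
    by (simp add: mahler_def power_mult_distrib prod_list_pow)
  also have "\<dots> \<le> (\<Prod>y\<leftarrow>ys. cmod (A y)) * (\<Prod>y\<leftarrow>ys. hgt y ^ (s - k))"
    using * hgt_ge_1 by (intro mult_right_mono prod_list_le[THEN conjunct1]) (auto intro: order_trans[OF zero_le_one])
  also have "\<dots> = (\<Prod>y\<leftarrow>ys. cmod (A y) * hgt y ^ (s - k))" by (simp add: prod_list_mult)
  also have "\<dots> \<le> (\<Prod>y\<leftarrow>ys. 2)"
    using gap_difference_bound[OF s r k(2)] hgt_ge_1
    by (intro prod_list_le[THEN conjunct2]) (auto simp: A_def intro!: mult_nonneg_nonneg zero_le_power intro: order_trans[OF zero_le_one])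
  finally show ?thesis by (simp add: prod_list_const)
qed

lemma power_less_cancel_length:
  fixes a b :: real
  assumes "a ^ n \<le> b ^ n" "0 \<le> b" "n > 0" shows "a \<le> b"
  using assms power_mono_iff[of a b n] by (metis linorder_not_less power_strict_mono)

theorem conjugates_units:
  assumes c: "is_conjugates G ys" and nt: "\<And>y. y \<in> set ys \<Longrightarrow> nontrivial y"
    and s: "\<And>y. y \<in> set ys \<Longrightarrow> trinomial_root s y" and r: "\<And>y. y \<in> set ys \<Longrightarrow> trinomial_root r y"
    and rs: "1 < s" "s < r"
    and V: "valuation_ring V" "of_nat p \<in> max_ideal V" "prime p" and y: "y \<in> set ys"
  shows "y \<in> V \<and> y \<notin> max_ideal V \<and> y + 1 \<notin> max_ideal V"
proof (rule ccontr)
  assume "\<not> ?thesis"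
  then have *: "y \<notin> V \<or> y \<in> max_ideal V \<or> y + 1 \<in> max_ideal V" by blast
  define k where "k = r - s"
  have k: "2 \<le> k" "3 * k \<le> s"
    using local_gap[OF V rs _ _ _ _ *] nt[OF y] s[OF y] r[OF y] by (auto simp: nontrivial_def trinomial_root_def k_def)
  have rk: "r = s + k" using rs by (simp add: k_def)
  define d where "d = length ys"
  have d: "d > 0" using c by (auto simp: d_def is_conjugates_def)
  define M where "M = mahler G ys"
  have M1: "1 \<le> M" unfolding M_def by (rule mahler_ge_1[OF c])
  have up: "M ^ (s - k) \<le> 2 ^ d" unfolding M_def d_def
    by (rule gap_norm_bound[OF c nt s]) (use r k rk in auto)
  have low: "(27 / 4) ^ d \<le> M ^ 10" unfolding M_def d_def by (rule mahler_lower_bound[OF c nt])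
  \<comment> \<open>From 3 k <= s and k >= 2 follows s - k >= 4, hence M^4 <= 2^d. Against the lower
    bound for M this contradicts (27/4)^4 > 2075 > 2^10.\<close>
  have "((27 / 4) ^ 4) ^ d = (((27 / 4) ^ d) :: real) ^ 4" by (simp only: mult.commute flip: power_mult)
  also have "\<dots> \<le> (M ^ 10) ^ 4" using low by (intro power_mono) auto
  also have "\<dots> = (M ^ 4) ^ 10" by (simp flip: power_mult)
  also have "\<dots> \<le> (M ^ (s - k)) ^ 10" using k M1 by (intro power_mono power_increasing) auto
  also have "\<dots> \<le> (2 ^ d) ^ 10" using up M1 by (intro power_mono) auto
  also have "\<dots> = (2 ^ 10) ^ d" by (simp only: mult.commute flip: power_mult)
  finally have "((27 / 4) ^ 4 :: real) \<le> 2 ^ 10" by (rule power_less_cancel_length) (use d in auto)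
  then show False by (simp add: power_divide)
qed

lemma integer_unit_norm:
  assumes "z \<in> \<int>" and "\<And>p V. prime p \<Longrightarrow> valuation_ring V \<Longrightarrow> of_nat p \<in> max_ideal V \<Longrightarrow> z \<notin> max_ideal V"
  shows "cmod z = 1"
proof -
  obtain k where k: "z = of_int k" using assms(1) by (rule Ints_cases)
  have "nat \<bar>k\<bar> = 1"
  proof (rule ccontr)
    assume "nat \<bar>k\<bar> \<noteq> 1"
    then obtain p where p: "prime p" "p dvd nat \<bar>k\<bar>" using prime_factor_nat by blast
    then have pk: "int p dvd k" by (simp add: int_dvd_int_iff[symmetric] del: int_dvd_int_iff)
    obtain V :: "complex set" where V: "valuation_ring V" "of_nat p \<in> max_ideal V"
      using prime_valuation_ring_exists[OF p(1)] by blast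
    show False using assms(2)[OF p(1) V] of_int_in_max_ideal_iff[OF V p(1)] pk k by blast
  qed
  then have "\<bar>k\<bar> = 1" by linarith
  then show ?thesis by (simp add: k flip: of_int_abs)
qed

lemma unit_prod_list:
  assumes V: "valuation_ring V" and "\<And>y. y \<in> set ys \<Longrightarrow> f y \<in> V \<and> f y \<notin> max_ideal V"
  shows "(\<Prod>y\<leftarrow>ys. f y) \<notin> max_ideal V"
  using assms(2)
proof (induction ys)
  case Nil then show ?case using one_notin_max_ideal[OF V] by simp
next
  case (Cons a ys)
  have "(\<Prod>y\<leftarrow>ys. f y) \<in> V" using Cons.prems by (intro is_subring_prod_list valuation_ring_subring V) auto
  then show ?case using Cons unit_mult[OF V, of "f a" "\<Prod>y\<leftarrow>ys. f y"] by simp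
qed

text \<open>At every finite place all large parts are 1 and all y and y + 1 are units, so the three
  integers in question have no prime divisor.\<close>

theorem conjugates_unit_norms:
  assumes c: "is_conjugates G ys" and nt: "\<And>y. y \<in> set ys \<Longrightarrow> nontrivial y"
    and s: "\<And>y. y \<in> set ys \<Longrightarrow> trinomial_root s y" and r: "\<And>y. y \<in> set ys \<Longrightarrow> trinomial_root r y"
    and rs: "1 < s" "s < r"
  shows "\<bar>real_of_int (lead_coeff G)\<bar> = 1" "(\<Prod>y\<leftarrow>ys. cmod y) = 1" "(\<Prod>y\<leftarrow>ys. cmod (y + 1)) = 1"
proof -
  have G: "of_int_poly G = smult (of_int (lead_coeff G)) (\<Prod>z\<leftarrow>ys. [:- z, 1 :: complex:])" "Polynomial.content G = 1"
    using c by (auto simp: is_conjugates_def)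
  have U: "y \<in> V \<and> y \<notin> max_ideal V \<and> y + 1 \<notin> max_ideal V"
    if "prime p" "valuation_ring V" "of_nat p \<in> max_ideal V" "y \<in> set ys" for p V y
    by (rule conjugates_units[OF c nt s r rs that(2,3,1,4)])
  have "cmod (of_int (lead_coeff G)) = 1"
  proof (rule integer_unit_norm)
    fix p and V :: "complex set" assume p: "prime p" "valuation_ring V" "of_nat p \<in> max_ideal V"
    have "(\<Prod>y\<leftarrow>ys. large_part V y) = (\<Prod>y\<leftarrow>ys. 1)"
      using U[OF p] by (intro arg_cong[of _ _ prod_list] map_cong) (auto simp: large_part_def)
    then show "of_int (lead_coeff G) \<notin> max_ideal V"
      using gauss_large_roots(2)[OF p(2) G(1) content_one_primitive_over[OF G(2) p]] by (simp add: prod_list_const)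
  qed (rule Ints_of_int)
  then show l: "\<bar>real_of_int (lead_coeff G)\<bar> = 1" by simp
  have *: "(\<Prod>y\<leftarrow>ys. cmod (poly (of_int_poly W) y)) = 1"
    if "degree W \<le> 1" "\<And>p V y. prime p \<Longrightarrow> valuation_ring V \<Longrightarrow> of_nat p \<in> max_ideal V \<Longrightarrow> y \<in> set ys \<Longrightarrow>
      poly (of_int_poly W) y \<in> V \<and> poly (of_int_poly W) y \<notin> max_ideal V" for W
  proof -
    define z where "z = of_int (lead_coeff G) ^ 1 * (\<Prod>y\<leftarrow>ys. poly (of_int_poly W) y)"
    have "z \<in> \<int>" unfolding z_def by (rule norm_integral[OF G that(1)])
    then have "cmod z = 1"
    proof (rule integer_unit_norm)
      fix p and V :: "complex set" assume p: "prime p" "valuation_ring V" "of_nat p \<in> max_ideal V"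
      have lV: "(of_int (lead_coeff G) :: complex) \<in> V" by (rule is_subring_of_int[OF valuation_ring_subring[OF p(2)]])
      have "\<bar>lead_coeff G\<bar> = 1" using l by linarith
      then have "of_int (lead_coeff G) \<notin> max_ideal V"
        using of_int_in_max_ideal_iff[OF p(2,3,1)] prime_gt_1_nat[OF p(1)]
        by (metis abs_dvd_iff dvd_abs_iff int_dvd_int_iff less_irrefl nat_dvd_1_iff_1 of_nat_1)
      moreover have "(\<Prod>y\<leftarrow>ys. poly (of_int_poly W) y) \<notin> max_ideal V"
        using that(2)[OF p] by (rule unit_prod_list[OF p(2)])
      moreover have "(\<Prod>y\<leftarrow>ys. poly (of_int_poly W) y) \<in> V"
        using that(2)[OF p] by (intro is_subring_prod_list valuation_ring_subring p) auto
      ultimately show "z \<notin> max_ideal V" unfolding z_def power_one_right using unit_mult[OF p(2) lV] by blast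
    qed
    then show ?thesis using l by (simp add: z_def norm_mult norm_prod_list)
  qed
  have "(\<Prod>y\<leftarrow>ys. cmod (poly (of_int_poly [:0, 1:]) y)) = 1"
  proof (rule *)
    fix p y and V :: "complex set" assume p: "prime p" "valuation_ring V" "of_nat p \<in> max_ideal V" "y \<in> set ys"
    show "poly (of_int_poly [:0, 1:]) y \<in> V \<and> poly (of_int_poly [:0, 1:]) y \<notin> max_ideal V"
      using U[OF p] by simp
  qed simp
  then show "(\<Prod>y\<leftarrow>ys. cmod y) = 1" by simp
  have "(\<Prod>y\<leftarrow>ys. cmod (poly (of_int_poly [:1, 1:]) y)) = 1"
  proof (rule *)
    fix p y and V :: "complex set" assume p: "prime p" "valuation_ring V" "of_nat p \<in> max_ideal V" "y \<in> set ys"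
    show "poly (of_int_poly [:1, 1:]) y \<in> V \<and> poly (of_int_poly [:1, 1:]) y \<notin> max_ideal V"
      using U[OF p] valuation_ringD(3)[OF p(2) _ valuation_ringD(1)[OF p(2)], of y] by (simp add: add.commute)
  qed simp
  then show "(\<Prod>y\<leftarrow>ys. cmod (y + 1)) = 1" by (simp add: add.commute)
qed

section \<open>Comparison of logarithms\<close>

lemma linear_times_geometric_le:
  fixes s :: nat
  assumes "11 \<le> s" shows "real s * (3 / 5) ^ s \<le> 1 / 25"
  using assms
proof (induction s rule: dec_induct)
  case base show ?case by (simp add: power_divide)
next
  case (step n)
  have "real (Suc n) * (3 / 5) ^ Suc n = (real (Suc n) * (3 / 5)) * (3 / 5) ^ n" by simp
  also have "\<dots> \<le> real n * (3 / 5) ^ n" using step(1) by (intro mult_right_mono) auto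
  finally show ?case using step by linarith
qed

text \<open>The bound 1/270 lies just above (3/5)^11, the largest |z|^s for |z| <= 3/5 and s >=
  11.\<close>

lemma Ln_one_plus_approx:
  assumes "cmod x \<le> 1 / 270"
  shows "cmod (Ln (1 + x)) \<le> 1.004 * cmod x" "0.996 * cmod x \<le> cmod (Ln (1 + x))"
proof -
  have "cmod (Ln (1 + x) - x) \<le> (cmod x)\<^sup>2 / (1 - cmod x)"
    using assms by (intro Ln_approx_linear) simp
  also have "\<dots> \<le> 0.004 * cmod x"
  proof -
    have "cmod x * cmod x \<le> cmod x * (0.004 * (1 - cmod x))" using assms by (intro mult_left_mono) auto
    then show ?thesis using assms by (simp add: power2_eq_square divide_le_eq mult.commute mult.left_commute)
  qed
  finally have *: "cmod (Ln (1 + x) - x) \<le> 0.004 * cmod x" .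
  have "cmod (Ln (1 + x)) \<le> cmod (Ln (1 + x) - x) + cmod x" using norm_triangle_ineq[of "Ln (1 + x) - x" x] by simp
  then show "cmod (Ln (1 + x)) \<le> 1.004 * cmod x" using * by simp
  have "cmod x \<le> cmod (Ln (1 + x) - x) + cmod (Ln (1 + x))"
    using norm_triangle_ineq4[of "Ln (1 + x)" "Ln (1 + x) - x"] by simp
  then show "0.996 * cmod x \<le> cmod (Ln (1 + x))" using * by simp
qed

text \<open>If \<open>t\<close> is close to a root of unity of order dividing both \<open>2r\<close> and \<open>2s\<close> to the respective
  precisions, comparing logarithms gives either a contradiction or a nonzero multiple of \<open>2\<pi>i\<close>.\<close>

lemma log_gap:
  fixes t z :: complex
  assumes s: "11 \<le> s" "s < r" and z: "z \<noteq> 0" "cmod z \<le> 3 / 5" and \<kappa>: "cmod \<kappa> = 1"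
    and ts: "t ^ (2 * s) = (1 + \<kappa> * z ^ s)\<^sup>2" and tr: "t ^ (2 * r) = (1 + \<kappa> * z ^ r)\<^sup>2"
  shows "65 * s \<le> r"
proof (rule ccontr)
  assume contr: "\<not> 65 * s \<le> r"
  define x where "x = \<kappa> * z ^ s"
  define x' where "x' = \<kappa> * z ^ r"
  have nx: "cmod x = cmod z ^ s" "cmod x' = cmod z ^ r" by (simp_all add: x_def x'_def norm_mult norm_power \<kappa>)
  have x0: "cmod x > 0" using z(1) by (simp add: nx)
  have xs: "cmod x \<le> (3 / 5) ^ s" unfolding nx using z(2) by (intro power_mono) auto
  have "((3 / 5) ^ s :: real) \<le> (3 / 5) ^ 11" using s(1) by (intro power_decreasing) auto
  also have "\<dots> \<le> 1 / 270" by (simp add: power_divide)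
  finally have s270: "((3 / 5) ^ s :: real) \<le> 1 / 270" .
  have x270: "cmod x \<le> 1 / 270" using xs s270 by linarith
  have x'x: "cmod x' \<le> 3 / 5 * cmod x"
  proof -
    have "cmod z ^ r \<le> cmod z ^ Suc s" using s z(2) by (intro power_decreasing) auto
    also have "\<dots> \<le> 3 / 5 * cmod z ^ s" using z(2) by (simp only: power_Suc) (rule mult_right_mono, auto)
    finally show ?thesis by (simp add: nx)
  qed
  then have x'270: "cmod x' \<le> 1 / 270" using x270 x0 by linarith
  note L = Ln_one_plus_approx[OF x270] and L' = Ln_one_plus_approx[OF x'270]
  have "1 + x \<noteq> 0"
  proof
    assume "1 + x = 0"
    then have "x = - 1" by (simp add: eq_neg_iff_add_eq_0 add.commute)
    then show False using x270 by simp
  qed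
  moreover have "1 + x' \<noteq> 0"
  proof
    assume "1 + x' = 0"
    then have "x' = - 1" by (simp add: eq_neg_iff_add_eq_0 add.commute)
    then show False using x'270 by simp
  qed
  ultimately have e: "exp (Ln (1 + x)) = 1 + x" "exp (Ln (1 + x')) = 1 + x'" by auto
  \<comment> \<open>Both (1 + x)^(2r) and (1 + x')^(2s) equal t^(2rs), so D is a multiple of 2 pi i.
    The multiple 0 is impossible since s < r and x' is smaller than x.\<close>
  define D where "D = of_nat (2 * r) * Ln (1 + x) - of_nat (2 * s) * Ln (1 + x')"
  have "((1 + x)\<^sup>2) ^ r = ((1 + x')\<^sup>2) ^ s"
    using arg_cong[OF ts, of "\<lambda>w. w ^ r"] arg_cong[OF tr, of "\<lambda>w. w ^ s"]
    by (simp add: x_def x'_def ac_simps flip: power_mult)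
  then have "(1 + x) ^ (2 * r) = (1 + x') ^ (2 * s)" by (simp add: power_mult)
  moreover have "exp (of_nat (2 * r) * Ln (1 + x)) = (1 + x) ^ (2 * r)" unfolding exp_of_nat_mult e ..
  moreover have "exp (of_nat (2 * s) * Ln (1 + x')) = (1 + x') ^ (2 * s)" unfolding exp_of_nat_mult e ..
  moreover have "1 + x' \<noteq> 0" using e(2) by (metis exp_not_eq_zero)
  ultimately have "exp D = 1" by (simp add: D_def exp_diff)
  then obtain n :: int where n: "Re D = 0" "Im D = of_int (2 * n) * pi" by (auto simp: exp_eq_1)
  have nD: "cmod D = 2 * pi * \<bar>of_int n\<bar>" using n by (simp add: cmod_def abs_mult)
  have b1: "real r * cmod (Ln (1 + x)) \<le> real r * (1.004 * cmod x)" using L by (intro mult_left_mono) auto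
  have b2: "real s * cmod (Ln (1 + x')) \<le> real s * (1.004 * (3 / 5 * cmod x))"
    using L' x'x by (intro mult_left_mono) auto
  show False
  proof (cases "n = 0")
    case True
    then have "D = 0" using nD by simp
    then have "of_nat (2 * r) * Ln (1 + x) = of_nat (2 * s) * Ln (1 + x')"
      by (simp only: D_def right_minus_eq)
    then have "cmod (of_nat (2 * r) * Ln (1 + x)) = cmod (of_nat (2 * s) * Ln (1 + x'))" by (rule arg_cong)
    then have "real r * cmod (Ln (1 + x)) = real s * cmod (Ln (1 + x'))" by (simp add: norm_mult)
    moreover have "real r * (0.996 * cmod x) \<le> real r * cmod (Ln (1 + x))" using L by (intro mult_left_mono) auto
    ultimately have "real r * (0.996 * cmod x) \<le> real s * (1.004 * (3 / 5 * cmod x))" using b2 by linarith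
    then have "cmod x * (real r * 0.996) \<le> cmod x * (real s * 0.6024)" by (simp add: algebra_simps)
    then have "real r * 0.996 \<le> real s * 0.6024" using x0 by (simp only: mult_le_cancel_left_pos)
    then show False using s by simp
  next
    case False
    then have "1 \<le> \<bar>real_of_int n\<bar>" by linarith
    then have "2 * pi * 1 \<le> cmod D" unfolding nD by (intro mult_left_mono) auto
    also have "cmod D \<le> 2 * (real r * cmod (Ln (1 + x))) + 2 * (real s * cmod (Ln (1 + x')))"
      unfolding D_def using norm_triangle_ineq4[of "of_nat (2 * r) * Ln (1 + x)" "of_nat (2 * s) * Ln (1 + x')"]
      by (simp add: norm_mult)
    finally have *: "pi \<le> real r * (1.004 * cmod x) + real s * (1.004 * (3 / 5 * cmod x))" using b1 b2 by linarith
    have "real s * cmod x \<le> real s * (3 / 5) ^ s" using xs by (intro mult_left_mono) auto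
    then have sx: "real s * cmod x \<le> 1 / 25" using linear_times_geometric_le[OF s(1)] by linarith
    \<comment> \<open>The constant 65 is affordable: 1.004 (65/25 + 3/125) is about 2.63, below
      pi.\<close>
    have "real r * cmod x \<le> real (65 * s) * cmod x" using contr by (intro mult_right_mono) auto
    then have rx: "real r * cmod x \<le> 65 / 25" using sx by simp
    have "pi > 3" using pi_gt3 .
    then show False using * sx rx by (simp add: algebra_simps)
  qed
qed

text \<open>A bootstrap: the bound on |t z| makes |z|^s at most 1/20, the equation then puts |t| at
  19/20 or more, and division improves the bound on |z| to 3/5. The constant 566/1000 lies just
  above the square root of 8/25. The sign \<sigma> is needed when t and z are exchanged.\<close>

lemma ordered_gap:
  fixes t z :: complex
  assumes s: "11 \<le> s" "s < r" and z: "z \<noteq> 0" and tz: "(cmod t * cmod z)\<^sup>2 \<le> 8 / 25"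
    and le: "cmod z \<le> cmod t" "cmod t \<le> 1" and \<sigma>: "\<sigma> \<in> {1, -1}" "\<tau> \<in> {1, -1}"
    and eqs: "t ^ s = \<sigma> + \<tau> * z ^ s" "t ^ r = \<sigma> + \<tau> * z ^ r"
  shows "65 * s \<le> r"
proof -
  have tz': "cmod t * cmod z \<le> 566 / 1000"
  proof (rule power2_le_imp_le)
    show "(cmod t * cmod z)\<^sup>2 \<le> (566 / 1000)\<^sup>2" using tz by (simp add: power_divide)
  qed simp
  have z2: "(cmod z)\<^sup>2 \<le> 566 / 1000"
    using mult_right_mono[OF le(1), of "cmod z"] tz' by (simp add: power2_eq_square)
  have z1: "cmod z \<le> 753 / 1000"
  proof (rule power2_le_imp_le)
    show "(cmod z)\<^sup>2 \<le> (753 / 1000)\<^sup>2" using z2 by (simp add: power_divide)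
  qed simp
  have "cmod z ^ s \<le> cmod z ^ 11" using le s by (intro power_decreasing) auto
  also have "\<dots> = ((cmod z)\<^sup>2) ^ 5 * cmod z" by (simp flip: power_mult power_Suc2)
  also have "\<dots> \<le> (566 / 1000) ^ 5 * (753 / 1000)" using z1 z2 by (intro mult_mono power_mono) auto
  also have "\<dots> \<le> 1 / 20" by (simp add: power_divide)
  finally have zs: "cmod z ^ s \<le> 1 / 20" .
  have n1: "cmod \<sigma> = 1" "cmod \<tau> = 1" "\<sigma> * \<sigma> = 1" using \<sigma> by auto
  have "cmod \<sigma> - cmod (\<tau> * z ^ s) \<le> cmod (\<sigma> + \<tau> * z ^ s)" by (rule norm_diff_ineq)
  then have "19 / 20 \<le> cmod t ^ s" using zs n1 by (simp add: norm_mult norm_power flip: eqs(1))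
  also have "\<dots> \<le> cmod t ^ 1" using le s by (intro power_decreasing) auto
  finally have "19 / 20 * cmod z \<le> cmod t * cmod z" by (intro mult_right_mono) auto
  then have z35: "cmod z \<le> 3 / 5" using tz' by simp
  \<comment> \<open>Squaring removes the sign \<sigma>; this is the reason for the doubled exponents
    in \<open>log_gap\<close>.\<close>
  have sq: "t ^ (2 * n) = (1 + (\<sigma> * \<tau>) * z ^ n)\<^sup>2" if "t ^ n = \<sigma> + \<tau> * z ^ n" for n
  proof -
    have "t ^ (2 * n) = (t ^ n)\<^sup>2" by (simp add: mult.commute flip: power_mult)
    also have "\<dots> = (\<sigma> * (1 + (\<sigma> * \<tau>) * z ^ n))\<^sup>2"
      unfolding that using n1(3) by (simp add: distrib_left flip: mult.assoc)
    also have "\<dots> = (\<sigma> * \<sigma>) * (1 + (\<sigma> * \<tau>) * z ^ n)\<^sup>2" by (simp only: power2_eq_square mult_ac)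
    finally show ?thesis by (simp add: n1)
  qed
  show ?thesis
    by (rule log_gap[OF s z z35, of "\<sigma> * \<tau>" t]) (simp_all add: n1 norm_mult sq eqs)
qed

lemma unordered_gap:
  fixes t z :: complex
  assumes s: "11 \<le> s" "s < r" and nz: "z \<noteq> 0" "t \<noteq> 0" and tz: "(cmod t * cmod z)\<^sup>2 \<le> 8 / 25"
    and le: "cmod z \<le> 1" "cmod t \<le> 1" and \<tau>: "\<tau> \<in> {1, -1}"
    and eqs: "t ^ s = 1 + \<tau> * z ^ s" "t ^ r = 1 + \<tau> * z ^ r"
  shows "65 * s \<le> r"
proof (cases "cmod z \<le> cmod t")
  case True
  then show ?thesis using ordered_gap[OF s nz(1) tz _ le(2) _ \<tau> eqs] by simp
next
  case False
  have *: "z ^ n = - \<tau> + \<tau> * t ^ n" if "t ^ n = 1 + \<tau> * z ^ n" for n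
    using \<tau> that by auto
  show ?thesis
    by (rule ordered_gap[OF s nz(2) _ _ le(1) _ \<tau> *[OF eqs(1)] *[OF eqs(2)]])
      (use False tz \<tau> in \<open>auto simp: mult.commute\<close>)
qed

text \<open>For v = p q / w^2 the hypothesis and \<open>triangle_form_le\<close> give v <= (1 -
  v)^3, and v > 8/25 is excluded by (17/25)^3 < 8/25.\<close>

lemma small_product_of_large_invariant:
  fixes p q w :: real
  assumes "0 \<le> p" "0 \<le> q" "p \<le> w" "q \<le> w" "0 < w"
    and "(p * q * w)\<^sup>2 \<le> (p\<^sup>2 + q\<^sup>2 + w\<^sup>2 - p * q - p * w - q * w) ^ 3"
  shows "p * q \<le> 8 / 25 * w\<^sup>2"
proof (rule ccontr)
  assume c: "\<not> ?thesis"
  let ?T = "p\<^sup>2 + q\<^sup>2 + w\<^sup>2 - p * q - p * w - q * w"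
  define x where "x = p * q"
  have xw: "x \<le> w\<^sup>2" using assms by (auto simp: x_def power2_eq_square intro: mult_mono)
  have x8: "8 / 25 * w\<^sup>2 < x" using c by (simp add: x_def)
  have T0: "0 \<le> ?T"
  proof -
    have "?T = ((p - q)\<^sup>2 + (p - w)\<^sup>2 + (q - w)\<^sup>2) / 2" by (simp add: power2_eq_square field_simps)
    moreover have "0 \<le> ((p - q)\<^sup>2 + (p - w)\<^sup>2 + (q - w)\<^sup>2) / 2" by simp
    ultimately show ?thesis by linarith
  qed
  have "(x * w ^ 4)\<^sup>2 = (p * q * w)\<^sup>2 * (w\<^sup>2) ^ 3" by (simp add: x_def power_mult_distrib flip: power_mult power_add)
  also have "\<dots> \<le> ?T ^ 3 * (w\<^sup>2) ^ 3" using assms(6) by (intro mult_right_mono) auto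
  also have "\<dots> = (?T * w\<^sup>2) ^ 3" by (simp only: power_mult_distrib)
  also have "\<dots> \<le> ((w\<^sup>2 - x)\<^sup>2) ^ 3" unfolding x_def
    using triangle_form_le[OF assms(1-4)] T0 by (intro power_mono) auto
  also have "\<dots> = ((w\<^sup>2 - x) ^ 3)\<^sup>2" by (simp flip: power_mult)
  finally have "x * w ^ 4 \<le> (w\<^sup>2 - x) ^ 3" by (rule power2_le_imp_le) (use xw in auto)
  also have "\<dots> \<le> (17 / 25 * w\<^sup>2) ^ 3" using x8 xw by (intro power_mono) auto
  also have "(w\<^sup>2) ^ 3 = w\<^sup>2 * w ^ 4" by (simp add: power_numeral_reduce)
  then have "(17 / 25 * w\<^sup>2) ^ 3 = (17 / 25) ^ 3 * w\<^sup>2 * w ^ 4"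
    unfolding power_mult_distrib by (simp only: mult.assoc)
  finally have "x * w ^ 4 \<le> ((17 / 25) ^ 3 * w\<^sup>2) * w ^ 4" .
  then have "x \<le> (17 / 25) ^ 3 * w\<^sup>2" using assms(5) by simp
  then have "8 / 25 * w\<^sup>2 < (17 / 25) ^ 3 * w\<^sup>2" using x8 by linarith
  then have "(8 / 25 :: real) < (17 / 25) ^ 3" by (rule mult_right_less_imp_less) simp
  then show False by (simp add: power_divide)
qed

text \<open>Up to a constant, (y^2 + y + 1)^3 / (y (y + 1))^2 is the j-invariant, unchanged by the
  six maps permuting 0, -1 and infinity. So the largest coordinate can be scaled to 1, and the other
  two then have a small product.\<close>

theorem archimedean_gap:
  assumes s: "11 \<le> s" "s < r" and y: "y \<noteq> 0" "y \<noteq> -1"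
    and ts: "trinomial_root s y" and tr: "trinomial_root r y"
    and J: "(cmod y * cmod (y + 1))\<^sup>2 \<le> cmod (y\<^sup>2 + y + 1) ^ 3"
  shows "65 * s \<le> r"
proof -
  define p where "p = (cmod y)\<^sup>2"
  define q where "q = (cmod (y + 1))\<^sup>2"
  have pq: "p \<ge> 0" "q \<ge> 0" by (auto simp: p_def q_def)
  have y1: "y + 1 \<noteq> 0" using y(2) eq_neg_iff_add_eq_0 by metis
  have d: "(cmod (y\<^sup>2 + y + 1))\<^sup>2 = p\<^sup>2 + q\<^sup>2 + 1 - p * q - p - q"
    using norm_quadratic_squared[of y] by (simp add: p_def q_def)
  have "((cmod y * cmod (y + 1))\<^sup>2)\<^sup>2 \<le> (cmod (y\<^sup>2 + y + 1) ^ 3)\<^sup>2" using J by (intro power_mono) auto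
  also have "\<dots> = ((cmod (y\<^sup>2 + y + 1))\<^sup>2) ^ 3" by (simp flip: power_mult)
  finally have T: "(p * q)\<^sup>2 \<le> (p\<^sup>2 + q\<^sup>2 + 1 - p * q - p - q) ^ 3"
    unfolding d by (simp add: p_def q_def power_mult_distrib)
  consider "hgt y = 1" | "hgt y = cmod y" | "hgt y = cmod (y + 1)" using hgt_cases by blast
  then show ?thesis
  proof cases
    case 1
    then have le: "cmod y \<le> 1" "cmod (y + 1) \<le> 1" by (auto simp: hgt_def)
    then have "p * q \<le> 8 / 25 * 1\<^sup>2"
      using T pq by (intro small_product_of_large_invariant) (auto simp: p_def q_def power_le_one)
    then have "(cmod (y + 1) * cmod y)\<^sup>2 \<le> 8 / 25" by (simp add: p_def q_def power_mult_distrib mult.commute)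
    then show ?thesis
      using unordered_gap[OF s y(1) y1 _ le, of 1] ts tr by (simp add: trinomial_root_def add.commute)
  next
    case 2
    then have le: "cmod (y + 1) \<le> cmod y" "1 \<le> cmod y" by (auto simp: hgt_def)
    then have "q * 1 \<le> 8 / 25 * p\<^sup>2" using T pq
      by (intro small_product_of_large_invariant)
        (auto simp: p_def q_def algebra_simps intro!: power_mono one_le_power)
    then have "(cmod ((y + 1) / y) * cmod (inverse y))\<^sup>2 \<le> 8 / 25"
      using y(1) by (simp add: norm_divide norm_inverse p_def q_def field_simps)
    moreover have "((y + 1) / y) ^ n = 1 + 1 * inverse y ^ n" if "trinomial_root n y" for n
      unfolding power_divide that[unfolded trinomial_root_def]
      using y(1) by (simp add: add_divide_distrib inverse_eq_divide power_one_over)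
    ultimately show ?thesis
      using unordered_gap[OF s, of "inverse y" "(y + 1) / y" 1] ts tr y(1) y1 le
      by (simp add: norm_divide norm_inverse divide_le_eq inverse_eq_divide)
  next
    case 3
    then have le: "cmod y \<le> cmod (y + 1)" "1 \<le> cmod (y + 1)" by (auto simp: hgt_def)
    then have "p * 1 \<le> 8 / 25 * q\<^sup>2" using T pq
      by (intro small_product_of_large_invariant)
        (auto simp: p_def q_def algebra_simps intro!: power_mono one_le_power)
    then have "(cmod (y / (y + 1)) * cmod (inverse (y + 1)))\<^sup>2 \<le> 8 / 25"
      using y1 by (simp add: norm_divide norm_inverse p_def q_def field_simps)
    moreover have "(y / (y + 1)) ^ n = 1 + (-1) * inverse (y + 1) ^ n" if "trinomial_root n y" for n
    proof -
      have "y ^ n = (y + 1) ^ n - 1" using that by (simp add: trinomial_root_def)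
      then show ?thesis using y1 by (simp add: power_divide diff_divide_distrib inverse_eq_divide)
    qed
    ultimately show ?thesis
      using unordered_gap[OF s, of "inverse (y + 1)" "y / (y + 1)" "-1"] ts tr y(1) y1 le
      by (simp add: norm_divide norm_inverse divide_le_eq inverse_eq_divide)
  qed
qed

section \<open>Hypergeometric linear forms\<close>

lemma has_integral_Beta_nat:
  "((\<lambda>u::real. u ^ a * (1 - u) ^ b) has_integral (fact a * fact b / fact (a + b + 1))) {0..1}"
\<comment> \<open>The end points are set aside because \<open>0 powr 0\<close> is 0 whereas
  \<open>0 ^ 0\<close> is 1.\<close>
proof (rule has_integral_spike_finite[where S = "{0, 1}"])
  have "((\<lambda>t. t powr (real (Suc a) - 1) * (1 - t) powr (real (Suc b) - 1)) has_integral
      Beta (real (Suc a)) (real (Suc b))) {0..1}"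
    by (rule has_integral_Beta_real) auto
  also have "Beta (real (Suc a)) (real (Suc b)) = fact a * fact b / fact (a + b + 1)"
  proof -
    have "real (Suc a) + real (Suc b) = real (Suc (a + b + 1))" by simp
    moreover have "Gamma (real (Suc k)) = fact k" for k using Gamma_fact[of k, where ?'a = real] by (simp add: add.commute)
    ultimately show ?thesis by (simp only: Beta_def)
  qed
  finally show "((\<lambda>t. t powr (real (Suc a) - 1) * (1 - t) powr (real (Suc b) - 1)) has_integral
      fact a * fact b / fact (a + b + 1)) {0..1}" .
  show "x ^ a * (1 - x) ^ b = x powr (real (Suc a) - 1) * (1 - x) powr (real (Suc b) - 1)"
    if "x \<in> {0..1} - {0, 1}" for x :: real
    using that by (simp add: powr_realpow)
qed simp

text \<open>A terminating hypergeometric polynomial in homogeneous form. Its coefficients are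
  integers: the factorials of the beta integrals sit in a common factor.\<close>

definition beta_form :: "nat \<Rightarrow> nat \<Rightarrow> nat \<Rightarrow> 'a::comm_ring_1 \<Rightarrow> 'a \<Rightarrow> 'a" where
  "beta_form i j l P Q = (\<Sum>k\<le>l. of_nat ((i + k choose i) * (j + l - k choose j)) * P ^ (l - k) * Q ^ k)"

lemma has_integral_beta_form:
  fixes P Q :: complex
  shows "((\<lambda>u. of_real (u ^ i * (1 - u) ^ j) * (of_real (1 - u) * P + of_real u * Q) ^ l) has_integral
    fact i * fact j * fact l / fact (i + j + l + 1) * beta_form i j l P Q) {0..1}"
proof -
  have coeff: "of_nat (l choose k) * (fact (i + k) * fact (j + l - k) / fact (i + j + l + 1))
      = (fact i * fact j * fact l / fact (i + j + l + 1) * of_nat ((i + k choose i) * (j + l - k choose j)) :: complex)"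
    if "k \<le> l" for k
    using that by (simp add: binomial_fact)
  have "((\<lambda>u. \<Sum>k\<le>l. of_nat (l choose k) * P ^ (l - k) * Q ^ k * of_real (u ^ (i + k) * (1 - u) ^ (j + l - k))) has_integral
      (\<Sum>k\<le>l. of_nat (l choose k) * P ^ (l - k) * Q ^ k * of_real (fact (i + k) * fact (j + l - k) / fact (i + k + (j + l - k) + 1)))) {0..1}"
    by (intro has_integral_sum has_integral_mult_right has_integral_of_real has_integral_Beta_nat) auto
  also have "(\<lambda>u. \<Sum>k\<le>l. of_nat (l choose k) * P ^ (l - k) * Q ^ k * of_real (u ^ (i + k) * (1 - u) ^ (j + l - k)))
      = (\<lambda>u. of_real (u ^ i * (1 - u) ^ j) * (of_real (1 - u) * P + of_real u * Q) ^ l)"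
  proof
    fix u :: real
    have "(of_real (1 - u) * P + of_real u * Q) ^ l
        = (\<Sum>k\<le>l. of_nat (l choose k) * (of_real u * Q) ^ k * (of_real (1 - u) * P) ^ (l - k))"
      by (subst add.commute) (rule binomial_ring)
    then have "of_real (u ^ i * (1 - u) ^ j) * (of_real (1 - u) * P + of_real u * Q) ^ l
        = (\<Sum>k\<le>l. of_real (u ^ i * (1 - u) ^ j) * (of_nat (l choose k) * (of_real u * Q) ^ k * (of_real (1 - u) * P) ^ (l - k)))"
      by (simp only: sum_distrib_left)
    also have "\<dots> = (\<Sum>k\<le>l. of_nat (l choose k) * P ^ (l - k) * Q ^ k * of_real (u ^ (i + k) * (1 - u) ^ (j + l - k)))"
    proof (rule sum.cong)
      fix k assume "k \<in> {..l}"
      then have "(1 - u) ^ (j + l - k) = (1 - u) ^ j * (1 - u) ^ (l - k)" by (simp flip: power_add)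
      then show "of_real (u ^ i * (1 - u) ^ j) * (of_nat (l choose k) * (of_real u * Q) ^ k * (of_real (1 - u) * P) ^ (l - k))
          = of_nat (l choose k) * P ^ (l - k) * Q ^ k * of_real (u ^ (i + k) * (1 - u) ^ (j + l - k))"
        by (simp only: power_add power_mult_distrib of_real_mult of_real_power mult_ac)
    qed simp
    finally show "(\<Sum>k\<le>l. of_nat (l choose k) * P ^ (l - k) * Q ^ k * of_real (u ^ (i + k) * (1 - u) ^ (j + l - k)))
      = of_real (u ^ i * (1 - u) ^ j) * (of_real (1 - u) * P + of_real u * Q) ^ l" by simp
  qed
  also have "(\<Sum>k\<le>l. of_nat (l choose k) * P ^ (l - k) * Q ^ k * of_real (fact (i + k) * fact (j + l - k) / fact (i + k + (j + l - k) + 1)))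
      = fact i * fact j * fact l / fact (i + j + l + 1) * beta_form i j l P Q"
    unfolding beta_form_def sum_distrib_left
  proof (rule sum.cong)
    fix k assume k: "k \<in> {..l}"
    then have e: "i + k + (j + l - k) + 1 = i + j + l + 1" by simp
    then have "(of_real (fact (i + k) * fact (j + l - k) / fact (i + k + (j + l - k) + 1)) :: complex)
        = fact (i + k) * fact (j + l - k) / fact (i + j + l + 1)"
      by (simp only: e of_real_divide of_real_mult of_real_fact)
    then have "of_nat (l choose k) * P ^ (l - k) * Q ^ k * of_real (fact (i + k) * fact (j + l - k) / fact (i + k + (j + l - k) + 1))
        = (of_nat (l choose k) * (fact (i + k) * fact (j + l - k) / fact (i + j + l + 1))) * (P ^ (l - k) * Q ^ k)"
      by (simp only: mult_ac)
    also have "\<dots> = (fact i * fact j * fact l / fact (i + j + l + 1) * of_nat ((i + k choose i) * (j + l - k choose j))) * (P ^ (l - k) * Q ^ k)"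
      using k by (subst coeff) auto
    finally show "of_nat (l choose k) * P ^ (l - k) * Q ^ k * of_real (fact (i + k) * fact (j + l - k) / fact (i + k + (j + l - k) + 1))
        = fact i * fact j * fact l / fact (i + j + l + 1) * (of_nat ((i + k choose i) * (j + l - k choose j)) * P ^ (l - k) * Q ^ k)"
      by (simp only: mult_ac)
  qed simp
  finally show ?thesis .
qed

text \<open>A Vandermonde-type convolution read off from the beta integral: for P = Q = 1 the
  integrand does not depend on l, so the case l = 0 evaluates it.\<close>

lemma beta_form_one_one:
  "(\<Sum>k\<le>l. (i + k choose i) * (j + l - k choose j)) = (i + j + l + 1 choose l)"
proof -
  have e: "of_real (1 - u) * 1 + of_real u * 1 = (1 :: complex)" for u :: real by simp
  have "fact i * fact j * fact l / fact (i + j + l + 1) * beta_form i j l 1 1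
      = (fact i * fact j * fact 0 / fact (i + j + 0 + 1) * beta_form i j 0 1 1 :: complex)"
    by (rule has_integral_unique[OF has_integral_beta_form[of i j 1 1 l, unfolded e power_one]
      has_integral_beta_form[of i j 1 1 0, unfolded e power_one]])
  also have "\<dots> = fact i * fact j / fact (i + j + 1)" by (simp add: beta_form_def del: fact_Suc)
  finally have "fact i * fact j * fact l / fact (i + j + l + 1) * beta_form i j l 1 1
      = (fact i * fact j / fact (i + j + 1) :: complex)" .
  then have "beta_form i j l 1 1 = (fact (i + j + l + 1) / (fact l * fact (i + j + 1)) :: complex)"
    by (simp add: field_simps del: fact_Suc)
  also have "\<dots> = of_nat (i + j + l + 1 choose l)" by (subst binomial_fact) (auto simp del: fact_Suc)
  finally have "of_nat (\<Sum>k\<le>l. (i + k choose i) * (j + l - k choose j)) = (of_nat (i + j + l + 1 choose l) :: complex)"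
    by (simp add: beta_form_def)
  then show ?thesis by (simp only: of_nat_eq_iff)
qed

lemma edge_integral:
  fixes a b c :: complex
  shows "((\<lambda>t. (t - a) ^ i * (t - b) ^ j * (t - c) ^ l) has_contour_integral
    fact i * fact j * fact l / fact (i + j + l + 1) * ((-1) ^ j * (b - a) ^ (i + j + 1) * beta_form i j l (a - c) (b - c)))
    (linepath a b)"
  unfolding has_contour_integral_linepath
proof -
  let ?K = "(-1) ^ j * (b - a) ^ (i + j + 1)"
  have "((\<lambda>u. ?K * (of_real (u ^ i * (1 - u) ^ j) * (of_real (1 - u) * (a - c) + of_real u * (b - c)) ^ l)) has_integral
      ?K * (fact i * fact j * fact l / fact (i + j + l + 1) * beta_form i j l (a - c) (b - c))) {0..1}"
    by (intro has_integral_mult_right has_integral_beta_form)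
  moreover have "?K * (of_real (u ^ i * (1 - u) ^ j) * (of_real (1 - u) * (a - c) + of_real u * (b - c)) ^ l)
      = (linepath a b u - a) ^ i * (linepath a b u - b) ^ j * (linepath a b u - c) ^ l * (b - a)" for u
  proof -
    have 1: "linepath a b u - a = of_real u * (b - a)" by (simp add: linepath_def scaleR_conv_of_real algebra_simps)
    have 2: "linepath a b u - b = (-1) * of_real (1 - u) * (b - a)" by (simp add: linepath_def scaleR_conv_of_real algebra_simps)
    have 3: "linepath a b u - c = of_real (1 - u) * (a - c) + of_real u * (b - c)"
      by (simp add: linepath_def scaleR_conv_of_real algebra_simps)
    show ?thesis unfolding 1 2 3
      by (simp only: power_mult_distrib power_add power_one_right of_real_mult of_real_power mult_ac)
  qed
  ultimately show "((\<lambda>x. (linepath a b x - a) ^ i * (linepath a b x - b) ^ j * (linepath a b x - c) ^ l * (b - a)) has_integral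
     fact i * fact j * fact l / fact (i + j + l + 1) * ((-1) ^ j * (b - a) ^ (i + j + 1) * beta_form i j l (a - c) (b - c))) {0..1}"
    by (simp only: mult_ac)
qed

text \<open>The (2n+1)-st power of its own coordinate governs the size of each form. The definitions
  are generic in the ring because they are evaluated at complex numbers and at polynomials
  alike.\<close>

definition pade_x :: "nat \<Rightarrow> nat \<Rightarrow> 'a::comm_ring_1 \<Rightarrow> 'a \<Rightarrow> 'a \<Rightarrow> 'a" where
  "pade_x n i x y z = x ^ (2 * n + 1) * ((-1) ^ n * beta_form n n (n + i) z (- y))"

definition pade_y :: "nat \<Rightarrow> nat \<Rightarrow> 'a::comm_ring_1 \<Rightarrow> 'a \<Rightarrow> 'a \<Rightarrow> 'a" where
  "pade_y n i x y z = y ^ (2 * n + 1) * ((-1) ^ (n + i) * y ^ i * beta_form n (n + i) n x (- z))"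

definition pade_z :: "nat \<Rightarrow> nat \<Rightarrow> 'a::comm_ring_1 \<Rightarrow> 'a \<Rightarrow> 'a \<Rightarrow> 'a" where
  "pade_z n i x y z = z ^ (2 * n + 1) * ((-1) ^ n * z ^ i * beta_form (n + i) n n y (- x))"

text \<open>The three terms are, up to a common factor, the integrals of
  \<open>t\<^sup>n (t - x)\<^sup>n (t + z)\<^sup>n\<^sup>+\<^sup>i\<close> along the sides of the triangle \<open>0\<close>, \<open>x\<close>, \<open>x + y\<close>.\<close>

lemma pade_sum:
  fixes x y z :: complex
  assumes "x + y + z = 0"
  shows "pade_x n i x y z + pade_y n i x y z + pade_z n i x y z = 0"
proof -
  have c: "x + y = - z" using assms by (simp add: eq_neg_iff_add_eq_0)
  define f where "f = (\<lambda>t. (t - 0) ^ n * (t - x) ^ n * (t - (- z)) ^ (n + i))"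
  define K :: complex where "K = fact n * fact n * fact (n + i) / fact (n + n + (n + i) + 1)"
  have K0: "K \<noteq> 0" unfolding K_def by (simp only: divide_eq_0_iff mult_eq_0_iff fact_nonzero simp_thms)
  have y: "- z - x = y" using c by (simp add: algebra_simps)
  have 1: "(f has_contour_integral K * pade_x n i x y z) (linepath 0 x)"
  proof -
    have e: "x - (- z) = - y" using y by (simp add: algebra_simps)
    have "K * pade_x n i x y z = fact n * fact n * fact (n + i) / fact (n + n + (n + i) + 1) *
        ((-1) ^ n * (x - 0) ^ (n + n + 1) * beta_form n n (n + i) (0 - (- z)) (x - (- z)))"
      unfolding e by (simp only: K_def pade_x_def diff_0_right diff_0 minus_minus power_add mult_2 mult_2_right ac_simps)
    then show ?thesis unfolding f_def by (simp only: edge_integral)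
  qed
  have 2: "(f has_contour_integral K * pade_y n i x y z) (linepath x (- z))"
  proof -
    have "f = (\<lambda>t. (t - x) ^ n * (t - (- z)) ^ (n + i) * (t - 0) ^ n)" by (simp add: f_def fun_eq_iff ac_simps)
    moreover have "K * pade_y n i x y z = fact n * fact (n + i) * fact n / fact (n + (n + i) + n + 1) *
        ((-1) ^ (n + i) * (- z - x) ^ (n + (n + i) + 1) * beta_form n (n + i) n (x - 0) (- z - 0))"
      unfolding y by (simp only: K_def pade_y_def diff_0_right diff_0 minus_minus power_add mult_2 mult_2_right ac_simps)
    ultimately show ?thesis by (simp only: edge_integral)
  qed
  have 3: "(f has_contour_integral K * pade_z n i x y z) (linepath (- z) 0)"
  proof -
    have "f = (\<lambda>t. (t - (- z)) ^ (n + i) * (t - 0) ^ n * (t - x) ^ n)" by (simp add: f_def fun_eq_iff ac_simps)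
    moreover have "K * pade_z n i x y z = fact (n + i) * fact n * fact n / fact (n + i + n + n + 1) *
        ((-1) ^ n * (0 - (- z)) ^ (n + i + n + 1) * beta_form (n + i) n n (- z - x) (0 - x))"
      unfolding y by (simp only: K_def pade_z_def diff_0_right diff_0 minus_minus power_add mult_2 mult_2_right ac_simps)
    ultimately show ?thesis by (simp only: edge_integral)
  qed
  have "(f has_contour_integral 0) (linepath 0 x +++ linepath x (- z) +++ linepath (- z) 0)"
    unfolding f_def by (intro Cauchy_theorem_triangle holomorphic_intros)
  moreover have "(f has_contour_integral (K * pade_x n i x y z + (K * pade_y n i x y z + K * pade_z n i x y z)))
      (linepath 0 x +++ linepath x (- z) +++ linepath (- z) 0)"
    by (intro has_contour_integral_join 1 2 3) auto
  ultimately have "0 = K * pade_x n i x y z + (K * pade_y n i x y z + K * pade_z n i x y z)"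
    by (rule has_contour_integral_unique)
  then have "K * (pade_x n i x y z + pade_y n i x y z + pade_z n i x y z) = 0" by (simp only: distrib_left add.assoc)
  then show ?thesis using K0 by simp
qed

lemma poly_beta_form: "poly (beta_form i j l P Q) w = beta_form i j l (poly P w) (poly Q w)"
  by (simp add: beta_form_def poly_sum)

lemma poly_pade:
  "poly (pade_x n i p q t) w = pade_x n i (poly p w) (poly q w) (poly t w)"
  "poly (pade_y n i p q t) w = pade_y n i (poly p w) (poly q w) (poly t w)"
  "poly (pade_z n i p q t) w = pade_z n i (poly p w) (poly q w) (poly t w)"
  by (simp_all add: pade_x_def pade_y_def pade_z_def poly_beta_form)

lemma degree_beta_form:
  assumes "degree P \<le> 1" "degree Q \<le> 1"
  shows "degree (beta_form i j l P Q) \<le> l"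
  unfolding beta_form_def
proof (rule degree_sum_le)
  fix k assume "k \<in> {..l}"
  have "degree (of_nat ((i + k choose i) * (j + l - k choose j)) * P ^ (l - k) * Q ^ k)
      \<le> 0 + degree P * (l - k) + degree Q * k"
    by (intro order_trans[OF degree_mult_le] add_mono degree_power_le) (simp add: of_nat_poly)
  also have "\<dots> \<le> 1 * (l - k) + 1 * k" using assms by (intro add_mono mult_right_mono) auto
  finally show "degree (of_nat ((i + k choose i) * (j + l - k choose j)) * P ^ (l - k) * Q ^ k) \<le> l"
    using \<open>k \<in> {..l}\<close> by simp
qed simp

text \<open>As a polynomial in \<open>y\<close>, the determinant is divisible by \<open>y\<^sup>2\<^sup>n\<^sup>+\<^sup>1\<close> and by \<open>z\<^sup>2\<^sup>n\<^sup>+\<^sup>1\<close>, and these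
  factors exhaust its degree.\<close>

theorem pade_det_nonzero:
  fixes x y z :: complex
  assumes sum: "x + y + z = 0" and nz: "x \<noteq> 0" "y \<noteq> 0" "z \<noteq> 0"
  shows "pade_x n 0 x y z * pade_y n 1 x y z \<noteq> pade_y n 0 x y z * pade_x n 1 x y z"
proof -
  \<comment> \<open>The coordinate x is frozen and y becomes the variable, so z is the polynomial -x
    - y.\<close>
  define X where "X = [:x:]"
  define Y where "Y = [:0, 1 :: complex:]"
  define Z where "Z = [:- x, -1:]"
  have XYZ: "poly X w + poly Y w + poly Z w = 0" for w by (simp add: X_def Y_def Z_def)
  have dX: "degree X \<le> 1" "degree (- X) \<le> 1" and dY: "degree Y \<le> 1" "degree (- Y) \<le> 1" and dZ: "degree Z \<le> 1" "degree (- Z) \<le> 1"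
    by (auto simp: X_def Y_def Z_def)
  define A where "A = (\<lambda>i. pade_x n i X Y Z)"
  define B where "B = (\<lambda>i. (-1) ^ (n + i) * Y ^ i * beta_form n (n + i) n X (- Z))"
  define C where "C = (\<lambda>i. (-1) ^ n * Z ^ i * beta_form (n + i) n n Y (- X))"
  have s: "A i + Y ^ (2 * n + 1) * B i + Z ^ (2 * n + 1) * C i = 0" for i
  proof -
    have "poly (A i + Y ^ (2 * n + 1) * B i + Z ^ (2 * n + 1) * C i) = poly 0"
      using pade_sum[OF XYZ, of n i]
      by (simp add: fun_eq_iff A_def B_def C_def poly_pade poly_beta_form pade_y_def pade_z_def)
    then show ?thesis by (simp only: poly_eq_poly_eq_iff)
  qed
  define K where "K = A 0 * B 1 - B 0 * A 1"
  have m1: "degree ((-1 :: complex poly) ^ m) = 0" for m by (cases "even m") auto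
  have dA: "degree (A i) \<le> n + i" for i
  proof -
    have "degree (A i) \<le> degree (X ^ (2 * n + 1)) + (degree ((-1 :: complex poly) ^ n) + degree (beta_form n n (n + i) Z (- Y)))"
      unfolding A_def pade_x_def by (intro order_trans[OF degree_mult_le] add_mono order_refl)
    also have "degree (X ^ (2 * n + 1)) = 0" using degree_power_le[of X "2 * n + 1"] by (simp add: X_def)
    finally show ?thesis using degree_beta_form[OF dZ(1) dY(2), of n n "n + i"] m1[of n] by simp
  qed
  have dB: "degree (B i) \<le> n + i" for i
  proof -
    have "degree (B i) \<le> degree ((-1 :: complex poly) ^ (n + i)) + degree (Y ^ i) + degree (beta_form n (n + i) n X (- Z))"
      unfolding B_def by (intro order_trans[OF degree_mult_le] add_mono order_refl)
    moreover have "degree (Y ^ i) \<le> i" using degree_power_le[of Y i] dY(1) by (simp add: Y_def)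
    ultimately show ?thesis using degree_beta_form[OF dX(1) dZ(2), of n "n + i" n] m1[of "n + i"] by simp
  qed
  have dK: "degree K \<le> 2 * n + 1"
    unfolding K_def using dA[of 0] dA[of 1] dB[of 0] dB[of 1]
    by (intro degree_diff_le order_trans[OF degree_mult_le]) auto
  have D1: "A 0 * (Y ^ (2 * n + 1) * B 1) - Y ^ (2 * n + 1) * B 0 * A 1 = Y ^ (2 * n + 1) * K"
    by (simp add: K_def algebra_simps)
  \<comment> \<open>Trading the y-term for the two others exhibits the factor Z^(2n+1), which is
    coprime to Y^(2n+1) because x is nonzero.\<close>
  have YB: "Y ^ (2 * n + 1) * B i = - A i - Z ^ (2 * n + 1) * C i" for i
    using s[of i] by (simp add: algebra_simps add_eq_0_iff)
  have "Y ^ (2 * n + 1) * K = Z ^ (2 * n + 1) * (C 0 * A 1 - A 0 * C 1)"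
    unfolding D1[symmetric] YB by (simp add: algebra_simps)
  then have "Z ^ (2 * n + 1) dvd Y ^ (2 * n + 1) * K" by simp
  moreover have "algebraic_semidom_class.coprime (Z ^ (2 * n + 1)) (Y ^ (2 * n + 1))"
  proof -
    have "algebraic_semidom_class.coprime Z Y"
    proof (rule Rings.coprimeI)
      fix d assume d: "d dvd Z" "d dvd Y"
      then have "d dvd Z + Y" by (rule dvd_add)
      moreover have "Z + Y = [:- x:]" by (rule poly_eqI) (auto simp: Z_def Y_def coeff_pCons split: nat.split)
      ultimately have "d dvd [:- x:]" by simp
      moreover have "[:- x:] dvd 1" using nz(1) by (simp add: is_unit_const_poly_iff dvd_field_iff)
      ultimately show "d dvd 1" by (rule dvd_trans)
    qed
    then show ?thesis by simp
  qed
  ultimately have "Z ^ (2 * n + 1) dvd K" using coprime_dvd_mult_right_iff by blast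
  then obtain L where L: "K = Z ^ (2 * n + 1) * L" by (elim dvdE)
  \<comment> \<open>At Y = 0 the factor Y of \<open>B 1\<close> kills one product, and the other is
    an explicit nonzero number.\<close>
  have K0: "poly K 0 \<noteq> 0"
  proof -
    have b: "beta_form n n n x x = x ^ n * of_nat (\<Sum>k\<le>n. (n + k choose n) * (n + n - k choose n))"
      unfolding beta_form_def of_nat_sum sum_distrib_left
      by (rule sum.cong) (auto simp flip: power_add)
    have "(\<Sum>k\<le>n. (n + k choose n) * (n + n - k choose n)) \<noteq> 0" unfolding beta_form_one_one by simp
    then have b0: "beta_form n n n x x \<noteq> 0" using nz(1) unfolding b by (simp only: mult_eq_0_iff of_nat_eq_0_iff power_eq_0_iff) simp
    have "beta_form n n (n + 1) (- x) 0 = of_nat (n + (n + 1) choose n) * (- x) ^ (n + 1)"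
      unfolding beta_form_def by (subst sum.remove[of _ 0]) (auto intro!: sum.neutral)
    moreover have "(n + (n + 1) choose n) \<noteq> 0" by simp
    ultimately have b1: "beta_form n n (n + 1) (- x) 0 \<noteq> 0" using nz(1)
      by (simp only: mult_eq_0_iff of_nat_eq_0_iff power_eq_0_iff neg_equal_0_iff_equal) simp
    have "poly (B 1) 0 = 0" by (simp add: B_def Y_def)
    moreover have "poly (B 0) 0 = (-1) ^ n * beta_form n n n x x"
      by (simp add: B_def poly_beta_form X_def Z_def)
    moreover have "poly (A 1) 0 = x ^ (2 * n + 1) * ((-1) ^ n * beta_form n n (n + 1) (- x) 0)"
      by (simp add: A_def poly_pade poly_beta_form pade_x_def X_def Y_def Z_def)
    ultimately show ?thesis using b0 b1 nz(1) by (simp add: K_def)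
  qed
  then have "K \<noteq> 0" by auto
  then have L0: "L \<noteq> 0" "Z \<noteq> 0" using L by auto
  have "degree K = (2 * n + 1) * degree Z + degree L" unfolding L using L0 by (simp add: degree_mult_eq degree_power_eq del: power_Suc)
  moreover have "degree Z = 1" by (simp add: Z_def)
  ultimately have "degree L = 0" using dK by simp
  then obtain c where c: "L = [:c:]" by (auto elim: degree_eq_zeroE)
  have "z = (x + y + z) - (x + y)" by simp
  then have "z = - (x + y)" unfolding sum by simp
  then have ev: "poly X y = x" "poly Y y = y" "poly Z y = z" by (simp_all add: X_def Y_def Z_def)
  have pA: "poly (A i) y = pade_x n i x y z" for i by (simp only: A_def poly_pade ev)
  have pB: "y ^ (2 * n + 1) * poly (B i) y = pade_y n i x y z" for i
    by (simp add: B_def poly_beta_form pade_y_def ev)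
  have "poly L y \<noteq> 0" using L0(1) by (simp add: c)
  then have "poly (Y ^ (2 * n + 1) * K) y \<noteq> 0"
    using nz by (simp only: L poly_mult poly_power ev mult_eq_0_iff power_eq_0_iff simp_thms)
  then have "poly (A 0) y * (y ^ (2 * n + 1) * poly (B 1) y) - y ^ (2 * n + 1) * poly (B 0) y * poly (A 1) y \<noteq> 0"
    unfolding D1[symmetric] by (simp only: poly_mult poly_power poly_diff ev simp_thms)
  then show ?thesis unfolding pA pB by (simp only: right_minus_eq simp_thms)
qed

section \<open>Common complex zeros\<close>

text \<open>The indices M - 1 and M give two equal terms in the expansion of (1 + 2)^(3M-1), whose
  sum is (3M-1 choose M) 4^M.\<close>

lemma central_choose_bound:
  assumes "M \<ge> 1" shows "2 * (3 * M - 1 choose M) * 4 ^ M \<le> 27 ^ M"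
proof -
  obtain k where k: "M = Suc k" using assms by (cases M) auto
  define n where "n = 3 * M - 1"
  have n: "n = 3 * k + 2" by (simp add: n_def k)
  have "Suc k * (n choose Suc k) = (n - k) * (n choose k)" by (simp only: binomial_absorption binomial_absorb_comp)
  then have "Suc k * (n choose Suc k) = Suc k * (2 * (n choose k))" by (simp add: n)
  then have half: "n choose Suc k = 2 * (n choose k)" by (simp only: mult_cancel1) simp
  have "(\<Sum>j\<in>{k, Suc k}. (n choose j) * 2 ^ (n - j)) \<le> (\<Sum>j\<le>n. (n choose j) * 2 ^ (n - j))"
    by (rule sum_mono2) (auto simp: n)
  also have "\<dots> = 3 ^ n" using binomial_ring[of "1::nat" 2 n] by (simp add: numeral_3_eq_3)
  finally have *: "(n choose k) * 2 ^ (n - k) + (n choose Suc k) * 2 ^ (n - Suc k) \<le> 3 ^ n" by simp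
  have e: "n - k = 2 * Suc k" "n - Suc k = Suc (2 * k)" by (auto simp: n)
  have "(n choose Suc k) * 4 ^ Suc k \<le> 3 ^ n"
    using * half unfolding e by (simp add: power_mult)
  then have "3 * ((n choose Suc k) * 4 ^ Suc k) \<le> 3 ^ Suc n" by simp
  also have "\<dots> = 27 ^ Suc k" by (simp add: n power_add power_mult)
  finally have "2 * (n choose Suc k) * 4 ^ Suc k \<le> 27 ^ Suc k" by linarith
  then show ?thesis by (simp only: n_def k)
qed

lemma norm_beta_form_le:
  fixes P Q :: complex
  assumes "cmod P \<le> h" "cmod Q \<le> h"
  shows "cmod (beta_form i j l P Q) \<le> real (i + j + l + 1 choose l) * h ^ l"
proof -
  have h: "0 \<le> h" using assms(1) norm_ge_zero order_trans by blast
  have "cmod (beta_form i j l P Q) \<le> (\<Sum>k\<le>l. real ((i + k choose i) * (j + l - k choose j)) * h ^ l)"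
    unfolding beta_form_def
  proof (rule sum_norm_le)
    fix k assume "k \<in> {..l}"
    then have hl: "h ^ l = h ^ (l - k) * h ^ k" by (simp flip: power_add)
    have "cmod P ^ (l - k) * cmod Q ^ k \<le> h ^ (l - k) * h ^ k"
      using assms h by (intro mult_mono power_mono) auto
    then have "real ((i + k choose i) * (j + l - k choose j)) * (cmod P ^ (l - k) * cmod Q ^ k)
        \<le> real ((i + k choose i) * (j + l - k choose j)) * h ^ l" unfolding hl by (intro mult_left_mono) auto
    then show "cmod (of_nat ((i + k choose i) * (j + l - k choose j)) * P ^ (l - k) * Q ^ k)
        \<le> real ((i + k choose i) * (j + l - k choose j)) * h ^ l"
      by (simp only: norm_mult norm_power norm_of_nat mult.assoc)
  qed
  also have "\<dots> = real (\<Sum>k\<le>l. (i + k choose i) * (j + l - k choose j)) * h ^ l"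
    by (simp only: of_nat_sum sum_distrib_right)
  finally show ?thesis unfolding beta_form_one_one .
qed

text \<open>A 2 by 2 minor of two vanishing sums, (y + 1)^r - y^r - 1 and the sum of the three Pade
  forms at (y + 1)^s, -(y^s), -1. At a common zero the other minors agree with it up to
  sign.\<close>

definition pade_delta :: "nat \<Rightarrow> nat \<Rightarrow> nat \<Rightarrow> nat \<Rightarrow> 'a::comm_ring_1 \<Rightarrow> 'a" where
  "pade_delta r s n i y = (y + 1) ^ r * pade_y n i ((y + 1) ^ s) (- (y ^ s)) (-1)
     + y ^ r * pade_x n i ((y + 1) ^ s) (- (y ^ s)) (-1)"

lemma of_int_poly_beta_form:
  "(of_int_poly (beta_form i j l P Q) :: complex poly) = beta_form i j l (of_int_poly P) (of_int_poly Q)"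
  by (simp add: beta_form_def hom_distribs)

lemma poly_pade_delta:
  "poly (of_int_poly (pade_delta r s n i [:0, 1:])) y = (pade_delta r s n i y :: complex)"
  by (simp add: pade_delta_def pade_x_def pade_y_def hom_distribs of_int_poly_beta_form poly_beta_form poly_power)

lemma choose_le_central:
  assumes "i \<le> 1"
  shows "3 * n + i + 1 choose (n + i) \<le> 3 * n + 2 choose (n + 1)" "3 * n + i + 1 choose n \<le> 3 * n + 2 choose (n + 1)"
proof -
  consider "i = 0" | "i = 1" using assms by linarith
  then have "3 * n + i + 1 choose (n + i) \<le> 3 * n + 2 choose (n + 1) \<and> 3 * n + i + 1 choose n \<le> 3 * n + 2 choose (n + 1)"
  proof cases
    case 1 then show ?thesis by simp
  next
    case 2
    have "3 * n + 2 choose n \<le> 3 * n + 2 choose (n + 1)" by (rule binomial_mono) auto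
    then show ?thesis using 2 by simp
  qed
  then show "3 * n + i + 1 choose (n + i) \<le> 3 * n + 2 choose (n + 1)" "3 * n + i + 1 choose n \<le> 3 * n + 2 choose (n + 1)"
    by auto
qed

text \<open>The minor avoiding the largest of |y + 1|, |y| and 1 is estimated; multiplying by a
  power of that largest coordinate restores the symmetric right-hand side.\<close>

lemma pade_delta_bound:
  assumes ts: "trinomial_root s y" and tr: "trinomial_root r y" and i: "i \<le> 1" and n: "2 \<le> n"
    and r: "(2 * n + 1) * s \<le> r" "r < (2 * n + 3) * s"
  shows "cmod (pade_delta r s n i y) * hgt y ^ ((n - 2) * s + 1)
    \<le> 2 * real (3 * n + 2 choose (n + 1)) * (cmod y * cmod (y + 1)) ^ ((2 * n + 1) * s)"
proof -
  define h where "h = hgt y"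
  define m where "m = (2 * n + 1) * s"
  define B where "B = real (3 * n + 2 choose (n + 1))"
  define W where "W = B * h ^ (s * (n + i))"
  define c1 where "c1 = cmod (y + 1)"
  define c2 where "c2 = cmod y"
  have h1: "1 \<le> h" unfolding h_def by (rule hgt_ge_1)
  have c: "0 \<le> c1" "0 \<le> c2" "c1 \<le> h" "c2 \<le> h" by (auto simp: c1_def c2_def h_def hgt_def)
  have W0: "0 \<le> W" using h1 by (simp add: W_def B_def)
  define x1 where "x1 = (y + 1) ^ s"
  define x2 where "x2 = - (y ^ s)"
  have x: "x1 + x2 + (-1) = 0" using ts by (simp add: x1_def x2_def trinomial_root_def)
  have nx: "cmod x1 = c1 ^ s" "cmod x2 = c2 ^ s" by (simp_all add: x1_def x2_def c1_def c2_def norm_power)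
  have nh: "cmod x1 \<le> h ^ s" "cmod (- x1) \<le> h ^ s" "cmod x2 \<le> h ^ s" "cmod (- x2) \<le> h ^ s"
    "cmod (-1 :: complex) \<le> h ^ s" "cmod (- (-1) :: complex) \<le> h ^ s"
    unfolding norm_minus_cancel nx using c h1 by (auto intro!: power_mono one_le_power)
  define v1 where "v1 = pade_x n i x1 x2 (-1)"
  define v2 where "v2 = pade_y n i x1 x2 (-1)"
  define v3 where "v3 = pade_z n i x1 x2 (-1)"
  have v: "v1 + v2 + v3 = 0" unfolding v1_def v2_def v3_def by (rule pade_sum[OF x])
  have hs: "h ^ (s * (n + i)) = (h ^ s) ^ (n + i)" by (simp add: power_mult)
  have B1: "real (n + n + (n + i) + 1 choose (n + i)) \<le> B" "real (n + (n + i) + n + 1 choose n) \<le> B"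
      "real (n + i + n + n + 1 choose n) \<le> B"
  proof -
    have "n + n + (n + i) + 1 = 3 * n + i + 1" "n + (n + i) + n + 1 = 3 * n + i + 1" "n + i + n + n + 1 = 3 * n + i + 1" by simp_all
    then show "real (n + n + (n + i) + 1 choose (n + i)) \<le> B" "real (n + (n + i) + n + 1 choose n) \<le> B"
      "real (n + i + n + n + 1 choose n) \<le> B"
      using choose_le_central[OF i, of n] by (simp_all only: B_def of_nat_le_iff)
  qed
  have bf: "cmod (beta_form a b l P Q) \<le> B * (h ^ s) ^ l"
    if "real (a + b + l + 1 choose l) \<le> B" "cmod P \<le> h ^ s" "cmod Q \<le> h ^ s" for a b l and P Q :: complex
  proof -
    have "cmod (beta_form a b l P Q) \<le> real (a + b + l + 1 choose l) * (h ^ s) ^ l"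
      by (rule norm_beta_form_le[OF that(2,3)])
    also have "\<dots> \<le> B * (h ^ s) ^ l" using that(1) h1 by (intro mult_right_mono) auto
    finally show ?thesis .
  qed
  have v1: "cmod v1 \<le> c1 ^ m * W"
  proof -
    have "cmod v1 = c1 ^ m * cmod (beta_form n n (n + i) (-1) (- x2))"
      unfolding v1_def pade_x_def norm_mult norm_power nx norm_minus_cancel norm_one power_one mult_1_left m_def
      by (simp only: mult.commute flip: power_mult)
    also have "\<dots> \<le> c1 ^ m * (B * (h ^ s) ^ (n + i))" using c bf[OF B1(1) nh(5,4)] by (intro mult_left_mono) auto
    finally show ?thesis by (simp only: W_def hs)
  qed
  have v2: "cmod v2 \<le> c2 ^ m * W"
  proof -
    have "cmod v2 = c2 ^ m * ((c2 ^ s) ^ i * cmod (beta_form n (n + i) n x1 (- (-1))))"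
      unfolding v2_def pade_y_def norm_mult norm_power nx norm_minus_cancel norm_one power_one mult_1_left m_def
      by (simp only: mult.commute flip: power_mult)
    also have "\<dots> \<le> c2 ^ m * ((h ^ s) ^ i * (B * (h ^ s) ^ n))"
      using c h1 bf[OF B1(2) nh(1,6)] nh(3)[unfolded nx] by (intro mult_left_mono mult_mono power_mono) (auto simp: B_def)
    also have "\<dots> = c2 ^ m * W" by (simp only: W_def hs power_add mult_ac)
    finally show ?thesis .
  qed
  have v3: "cmod v3 \<le> 1 ^ m * W"
  proof -
    have "cmod v3 = 1 ^ i * cmod (beta_form (n + i) n n x2 (- x1))"
      unfolding v3_def pade_z_def by (simp add: norm_mult norm_power)
    also have "\<dots> \<le> (h ^ s) ^ i * (B * (h ^ s) ^ n)"
      using h1 bf[OF B1(3) nh(3,2)] by (intro mult_mono power_mono) (auto simp: B_def)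
    also have "\<dots> = 1 ^ m * W" by (simp only: W_def hs power_add mult_ac power_one mult_1_left)
    finally show ?thesis .
  qed
  have mr: "m \<le> r" using r by (simp add: m_def)
  have pair: "cmod (R * v' + R' * v) \<le> 2 * (a ^ m * b ^ m) * h ^ (r - m) * W"
    if "cmod R = a ^ r" "cmod R' = b ^ r" "cmod v \<le> a ^ m * W" "cmod v' \<le> b ^ m * W" "0 \<le> a" "0 \<le> b" "a \<le> h" "b \<le> h"
    for R R' v v' a b
  proof -
    have R: "u ^ r \<le> u ^ m * h ^ (r - m)" if "0 \<le> u" "u \<le> h" for u
    proof -
      have "u ^ r = u ^ m * u ^ (r - m)" using mr by (simp flip: power_add)
      then show ?thesis using that by (simp add: mult_left_mono power_mono)
    qed
    have "cmod (R * v' + R' * v) \<le> cmod R * cmod v' + cmod R' * cmod v"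
      by (metis norm_mult norm_triangle_ineq)
    also have "\<dots> \<le> (a ^ m * h ^ (r - m)) * (b ^ m * W) + (b ^ m * h ^ (r - m)) * (a ^ m * W)"
      using that R[of a] R[of b] h1 by (intro add_mono mult_mono) auto
    finally show ?thesis by (simp add: algebra_simps)
  qed
  define D where "D = pade_delta r s n i y"
  define R1 where "R1 = (y + 1) ^ r"
  define R2 where "R2 = y ^ r"
  have R: "R1 = R2 + 1" using tr by (simp add: R1_def R2_def trinomial_root_def)
  have nR: "cmod R1 = c1 ^ r" "cmod R2 = c2 ^ r" by (simp_all add: R1_def R2_def c1_def c2_def norm_power)
  have D1: "D = R1 * v2 + R2 * v1" by (simp add: D_def pade_delta_def R1_def R2_def v1_def v2_def x1_def x2_def)
  have v30: "v3 = - v1 - v2" using v by (simp add: algebra_simps eq_neg_iff_add_eq_0)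
  have D2: "D = (- R2) * v3 + 1 * v2" unfolding D1 v30 R by (simp add: algebra_simps)
  have D3: "D = (- R1) * v3 + (-1) * v1" unfolding D1 v30 R by (simp add: algebra_simps)
  have main: "cmod D * h ^ m \<le> 2 * (c1 ^ m * c2 ^ m) * h ^ (r - m) * W"
  proof -
    consider "h = 1" | "h = c2" | "h = c1" using hgt_cases unfolding h_def c1_def c2_def by blast
    then show ?thesis
    proof cases
      case 1
      then show ?thesis using pair[OF nR v1 v2] c unfolding D1 by simp
    next
      case 2
      have "cmod D \<le> 2 * (c1 ^ m * 1 ^ m) * h ^ (r - m) * W"
        unfolding D3 by (rule pair) (use nR v1 v3 c h1 in auto)
      then have "cmod D * h ^ m \<le> 2 * (c1 ^ m * 1 ^ m) * h ^ (r - m) * W * h ^ m" using h1 by (intro mult_right_mono) auto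
      then show ?thesis using 2 by (simp add: mult_ac)
    next
      case 3
      have "cmod D \<le> 2 * (c2 ^ m * 1 ^ m) * h ^ (r - m) * W"
        unfolding D2 by (rule pair) (use nR v2 v3 c h1 in auto)
      then have "cmod D * h ^ m \<le> 2 * (c2 ^ m * 1 ^ m) * h ^ (r - m) * W * h ^ m" using h1 by (intro mult_right_mono) auto
      then show ?thesis using 3 by (simp add: mult_ac)
    qed
  qed
  define F where "F = r - m + s * (n + i)"
  define E where "E = (n - 2) * s + 1"
  \<comment> \<open>From r < (2n+3) s follows r - m < 2 s; after the loss of at most s (n + 1) in
    \<open>W\<close>, the exponent (n - 2) s + 1 is left over from m.\<close>
  have EF: "E + F \<le> m"
  proof -
    obtain k where k: "n = k + 2" using n by (metis add.commute le_Suc_ex)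
    have "s * (n + i) \<le> s * (n + 1)" using i by (intro mult_le_mono2) auto
    then have "E + F \<le> k * s + 1 + (r - m) + s * (k + 3)" by (simp add: E_def F_def k algebra_simps)
    moreover have "r - m < 2 * s" using r by (simp add: m_def algebra_simps)
    moreover have "m = k * s + s * (k + 3) + 2 * s" by (simp add: m_def k algebra_simps)
    ultimately show ?thesis by linarith
  qed
  have "(cmod D * h ^ E) * h ^ F = cmod D * h ^ (E + F)" by (simp add: power_add)
  also have "\<dots> \<le> cmod D * h ^ m" using EF h1 by (intro mult_left_mono power_increasing) auto
  also have "\<dots> \<le> (2 * B * (c1 * c2) ^ m) * h ^ F"
    using main by (simp add: W_def F_def power_add power_mult_distrib mult_ac)
  finally have "cmod D * h ^ E \<le> 2 * B * (c1 * c2) ^ m" using h1 by (simp del: power_mult_distrib)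
  then show ?thesis by (simp add: D_def h_def E_def B_def c1_def c2_def m_def mult.commute)
qed

lemma prod_list_less:
  fixes f g :: "'a \<Rightarrow> real"
  assumes "ys \<noteq> []" "\<And>y. y \<in> set ys \<Longrightarrow> 0 \<le> f y" "\<And>y. y \<in> set ys \<Longrightarrow> f y < g y"
  shows "(\<Prod>y\<leftarrow>ys. f y) < (\<Prod>y\<leftarrow>ys. g y)"
  using assms
proof (induction ys rule: list_nonempty_induct)
  case (cons x xs)
  have "0 \<le> (\<Prod>y\<leftarrow>xs. f y)" using cons.prems prod_list_le[of xs f f] by auto
  then show ?case using cons by (auto intro!: mult_strict_mono')
qed simp

theorem no_unit_conjugates:
  assumes c: "is_conjugates G ys" and nt: "\<And>y. y \<in> set ys \<Longrightarrow> nontrivial y"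
    and s: "\<And>y. y \<in> set ys \<Longrightarrow> trinomial_root s y" and r: "\<And>y. y \<in> set ys \<Longrightarrow> trinomial_root r y"
    and conj: "\<And>U z z'. z \<in> set ys \<Longrightarrow> z' \<in> set ys \<Longrightarrow> poly (of_int_poly U) z = 0 \<Longrightarrow> poly (of_int_poly U) z' = 0"
    and rs: "11 \<le> s" "s < r"
  shows False
proof -
  define d where "d = length ys"
  have ys: "ys \<noteq> []" using c by (simp add: is_conjugates_def)
  then have d: "d > 0" by (simp add: d_def)
  have s1: "1 < s" using rs by simp
  have units: "\<bar>real_of_int (lead_coeff G)\<bar> = 1" "(\<Prod>y\<leftarrow>ys. cmod y) = 1" "(\<Prod>y\<leftarrow>ys. cmod (y + 1)) = 1"
    by (rule conjugates_unit_norms[OF c nt s r s1 rs(2)]; assumption)+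
  \<comment> \<open>The norm of y (y + 1) is 1 in absolute value and that of y^2 + y + 1 is at least
    1, so the inequality cannot fail at every conjugate.\<close>
  have "\<exists>y\<in>set ys. (cmod y * cmod (y + 1))\<^sup>2 \<le> cmod (y\<^sup>2 + y + 1) ^ 3"
  proof (rule ccontr)
    assume "\<not> ?thesis"
    then have "(\<Prod>y\<leftarrow>ys. cmod (y\<^sup>2 + y + 1) ^ 3) < (\<Prod>y\<leftarrow>ys. (cmod y * cmod (y + 1))\<^sup>2)"
      by (intro prod_list_less ys) auto
    also have "\<dots> = 1" by (simp only: prod_list_pow prod_list_mult units(2,3) mult_1_left power_one)
    finally have "(\<Prod>y\<leftarrow>ys. cmod (y\<^sup>2 + y + 1)) ^ 3 < 1" by (simp only: prod_list_pow)
    moreover have "1 \<le> (\<Prod>y\<leftarrow>ys. cmod (y\<^sup>2 + y + 1))"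
      using conjugates_norm_ge_1[OF c, of "[:1, 1, 1:]" 2] nt units(1)
      by (simp add: nontrivial_def power2_eq_square algebra_simps)
    ultimately show False using one_le_power[of "\<Prod>y\<leftarrow>ys. cmod (y\<^sup>2 + y + 1)" 3] by linarith
  qed
  then obtain y1 where y1: "y1 \<in> set ys" "(cmod y1 * cmod (y1 + 1))\<^sup>2 \<le> cmod (y1\<^sup>2 + y1 + 1) ^ 3" by blast
  have r65: "65 * s \<le> r"
    using archimedean_gap[OF rs _ _ s[OF y1(1)] r[OF y1(1)] y1(2)] nt[OF y1(1)] by (simp add: nontrivial_def)
  define q where "q = r div s"
  have q: "65 \<le> q" unfolding q_def using r65 s1 by (simp add: less_eq_div_iff_mult_less_eq)
  have q_r: "q * s \<le> r" "r < (q + 1) * s"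
    using s1 dividend_less_div_times[of s r] by (auto simp: q_def)
  \<comment> \<open>The largest n with 2 n + 1 <= r / s; the quotient 65 = 2 * 32 + 1 makes it at
    least 32.\<close>
  define n where "n = (q - 1) div 2"
  have n: "32 \<le> n" "2 * n + 1 \<le> q" "q < 2 * n + 3" using q by (auto simp: n_def)
  have rn: "(2 * n + 1) * s \<le> r" using mult_le_mono1[OF n(2), of s] q_r by linarith
  have "(q + 1) * s \<le> (2 * n + 3) * s" using n(3) by (intro mult_le_mono1) linarith
  then have rn': "r < (2 * n + 3) * s" using q_r by linarith
  define y0 where "y0 = hd ys"
  have y0: "y0 \<in> set ys" using ys by (simp add: y0_def)
  \<comment> \<open>If both vanished, the nonzero vector of (y0 + 1)^r and y0^r would be annihilated
    by a matrix whose determinant is nonzero by \<open>pade_det_nonzero\<close>.\<close>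
  have "\<exists>i\<le>1. pade_delta r s n i y0 \<noteq> 0"
  proof (rule ccontr)
    assume "\<not> ?thesis"
    then have z: "pade_delta r s n 0 y0 = 0" "pade_delta r s n 1 y0 = 0" by auto
    define x1 where "x1 = (y0 + 1) ^ s"
    define x2 where "x2 = - (y0 ^ s)"
    have nz: "y0 \<noteq> 0" "y0 + 1 \<noteq> 0" using nt[OF y0] by (auto simp: nontrivial_def eq_neg_iff_add_eq_0)
    have "x1 + x2 + (-1) = 0" using s[OF y0] by (simp add: x1_def x2_def trinomial_root_def)
    from pade_det_nonzero[OF this, of n]
    have det: "pade_x n 0 x1 x2 (-1) * pade_y n 1 x1 x2 (-1) \<noteq> pade_y n 0 x1 x2 (-1) * pade_x n 1 x1 x2 (-1)"
      using nz by (simp add: x1_def x2_def)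
    have e: "(y0 + 1) ^ r * pade_y n i x1 x2 (-1) = - (y0 ^ r * pade_x n i x1 x2 (-1))" if "pade_delta r s n i y0 = 0" for i
      using that by (simp add: pade_delta_def x1_def x2_def add_eq_0_iff2)
    have "(y0 + 1) ^ r * (pade_x n 0 x1 x2 (-1) * pade_y n 1 x1 x2 (-1))
        = pade_x n 0 x1 x2 (-1) * ((y0 + 1) ^ r * pade_y n 1 x1 x2 (-1))" by (simp only: mult_ac)
    also have "\<dots> = (- (y0 ^ r * pade_x n 0 x1 x2 (-1))) * pade_x n 1 x1 x2 (-1)" unfolding e[OF z(2)] by (simp add: mult_ac)
    also have "\<dots> = (y0 + 1) ^ r * (pade_y n 0 x1 x2 (-1) * pade_x n 1 x1 x2 (-1))" unfolding e[OF z(1), symmetric] by (simp only: mult_ac)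
    finally show False using det nz by simp
  qed
  then obtain i where i: "i \<le> 1" "pade_delta r s n i y0 \<noteq> 0" by blast
  define \<Delta> where "\<Delta> = (\<lambda>y :: complex. pade_delta r s n i y)"
  define U where "U = pade_delta r s n i [:0, 1 :: int:]"
  have U: "poly (of_int_poly U) y = \<Delta> y" for y unfolding U_def \<Delta>_def by (rule poly_pade_delta)
  \<comment> \<open>Conjugates satisfy the same integer equations, so the index i found for one of
    them serves all.\<close>
  have \<Delta>0: "\<Delta> y \<noteq> 0" if "y \<in> set ys" for y
    using conj[OF that y0, of U] i(2) unfolding U by (auto simp: \<Delta>_def)
  have norm: "1 \<le> (\<Prod>y\<leftarrow>ys. cmod (\<Delta> y))"
    using conjugates_norm_ge_1[OF c order_refl, of U] \<Delta>0 unfolding U units(1) power_one mult_1_left by blast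
  define M where "M = mahler G ys"
  have M: "M = (\<Prod>y\<leftarrow>ys. hgt y)" by (simp add: M_def mahler_def units)
  have M1: "1 \<le> M" unfolding M_def by (rule mahler_ge_1[OF c])
  define E where "E = (n - 2) * s + 1"
  define B where "B = real (3 * n + 2 choose (n + 1))"
  have "M ^ E = 1 * (\<Prod>y\<leftarrow>ys. hgt y ^ E)" by (simp add: M prod_list_pow)
  also have "\<dots> \<le> (\<Prod>y\<leftarrow>ys. cmod (\<Delta> y)) * (\<Prod>y\<leftarrow>ys. hgt y ^ E)"
    using norm hgt_ge_1 by (intro mult_right_mono prod_list_le[THEN conjunct1]) (auto intro: order_trans[OF zero_le_one])
  also have "\<dots> = (\<Prod>y\<leftarrow>ys. cmod (\<Delta> y) * hgt y ^ E)" by (simp add: prod_list_mult)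
  also have "\<dots> \<le> (\<Prod>y\<leftarrow>ys. 2 * B * (cmod y * cmod (y + 1)) ^ ((2 * n + 1) * s))"
  proof (rule prod_list_le[THEN conjunct2])
    fix y assume y: "y \<in> set ys"
    show "cmod (\<Delta> y) * hgt y ^ E \<le> 2 * B * (cmod y * cmod (y + 1)) ^ ((2 * n + 1) * s)"
      unfolding \<Delta>_def E_def B_def using n by (intro pade_delta_bound s r y i rn rn') auto
    show "0 \<le> cmod (\<Delta> y) * hgt y ^ E" using hgt_ge_1[of y] by simp
  qed
  also have "\<dots> = (2 * B) ^ d"
    by (simp only: prod_list_mult prod_list_const prod_list_pow units(2,3) mult_1_left power_one mult_1_right d_def power_mult_distrib)
  finally have up: "M ^ E \<le> (2 * B) ^ d" .
  have B: "2 * B \<le> (27 / 4) ^ (n + 1)"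
  proof -
    have "real (2 * (3 * (n + 1) - 1 choose (n + 1)) * 4 ^ (n + 1)) \<le> real (27 ^ (n + 1))"
      by (subst of_nat_le_iff) (rule central_choose_bound, simp)
    then have "2 * B * 4 ^ (n + 1) \<le> 27 ^ (n + 1)" by (simp add: B_def)
    then show ?thesis by (simp add: power_divide field_simps)
  qed
  have low: "(27 / 4) ^ d \<le> M ^ 10" unfolding M_def d_def by (rule mahler_lower_bound[OF c nt])
  have "((27 / 4) ^ E) ^ d = (((27 / 4) ^ d) ^ E :: real)" by (simp only: mult.commute flip: power_mult)
  also have "\<dots> \<le> (M ^ 10) ^ E" using low by (intro power_mono) auto
  also have "\<dots> = (M ^ E) ^ 10" by (simp only: mult.commute flip: power_mult)
  also have "\<dots> \<le> ((2 * B) ^ d) ^ 10" using up M1 by (intro power_mono) auto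
  also have "\<dots> \<le> (((27 / 4) ^ (n + 1)) ^ d) ^ 10" using B by (intro power_mono) (auto simp: B_def)
  also have "\<dots> = (((27 / 4) ^ (10 * (n + 1))) ^ d :: real)" by (simp only: mult_ac flip: power_mult)
  finally have "((27 / 4) ^ E :: real) \<le> (27 / 4) ^ (10 * (n + 1))" by (rule power_less_cancel_length) (use d in auto)
  then have "E \<le> 10 * (n + 1)" by (rule power_le_imp_le_exp[rotated]) simp
  then have E10: "(n - 2) * s + 1 \<le> 10 * (n + 1)" by (simp only: E_def)
  obtain k where k: "n = k + 2" using n(1) le_Suc_ex[of 2 n] by (auto simp: add.commute)
  have "k * s + 1 \<le> 10 * (k + 3)" using E10 by (simp add: k)
  \<comment> \<open>For s >= 11 the inequality says k <= 29, whereas n >= 32 means k >= 30.\<close>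
  moreover have "k * 11 \<le> k * s" using rs by (intro mult_le_mono2) auto
  ultimately have "k * 11 + 1 \<le> 10 * (k + 3)" by linarith
  then show False using n(1) k by simp
qed

section \<open>Exponents up to ten\<close>

lemma small_multiple_contradiction:
  fixes V :: "complex set"
  assumes V: "valuation_ring V" "of_nat p \<in> max_ideal V" "prime p"
    and eq: "of_nat c * X = of_nat p * Z" and X: "X \<in> V" "X \<notin> max_ideal V" and Z: "Z \<in> V" and c: "\<not> p dvd c"
  shows False
proof -
  have "of_nat c * X \<in> max_ideal V" unfolding eq by (rule max_ideal_mult[OF V(1,2) Z])
  then have "of_nat c \<in> max_ideal V"
    using max_ideal_prime[OF V(1) is_subring_of_nat[OF valuation_ring_subring[OF V(1)]] X(1)] X(2) by blast
  then show False using of_nat_in_max_ideal_iff[OF V] c by blast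
qed

text \<open>For \<open>s \<le> 10\<close> a suitable prime divides all coefficients of \<open>(y + 1)\<^sup>s - y\<^sup>s - 1\<close>, up to the
  factors \<open>y\<close> and \<open>y + 1\<close>, except the middle one.\<close>

lemma no_small_unit_root:
  assumes t: "trinomial_root s y" and nt: "nontrivial y" and s: "1 < s" "s \<le> 10"
    and unit: "\<And>p V. prime p \<Longrightarrow> valuation_ring V \<Longrightarrow> of_nat p \<in> max_ideal V \<Longrightarrow>
      y \<in> V \<and> y \<notin> max_ideal V \<and> y + 1 \<notin> max_ideal V"
  shows False
proof -
  have y: "y \<noteq> 0" "y + 1 \<noteq> 0" "y\<^sup>2 + y + 1 \<noteq> 0" using nt by (auto simp: nontrivial_def eq_neg_iff_add_eq_0)
  \<comment> \<open>Here \<open>a\<close> collects trivial factors to be cancelled, and the term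
    with coefficient c prime to p is the part surviving modulo p, which is a unit.\<close>
  have key: False if hyp: "prime p" "a * (of_nat c * (y ^ j * (y + 1) ^ k) - of_nat p * poly (of_int_poly Z) y) = 0" "a \<noteq> 0" "\<not> p dvd c"
    for p c j k a and Z :: "int poly"
  proof -
    obtain V :: "complex set" where V: "valuation_ring V" "of_nat p \<in> max_ideal V"
      using prime_valuation_ring_exists[OF hyp(1)] by blast
    note u = unit[OF hyp(1) V]
    have y1: "y + 1 \<in> V" using u valuation_ringD(3)[OF V(1) _ valuation_ringD(1)[OF V(1)]] by blast
    have "y ^ j * (y + 1) ^ k \<in> V" "y ^ j * (y + 1) ^ k \<notin> max_ideal V"
      using u y1 unit_power[OF V(1), of y j] unit_power[OF V(1), of "y + 1" k] unit_mult[OF V(1), of "y ^ j" "(y + 1) ^ k"]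
        valuation_ringD(5)[OF V(1)] valuation_ringD(7)[OF V(1)] by blast+
    moreover have "poly (of_int_poly Z) y \<in> V"
      unfolding poly_altdef using u by (auto intro!: is_subring_sum valuation_ring_subring V(1) valuation_ringD(5)[OF V(1)]
        valuation_ringD(7)[OF V(1)] is_subring_of_int)
    moreover have "of_nat c * (y ^ j * (y + 1) ^ k) = of_nat p * poly (of_int_poly Z) y" using hyp(2,3) by simp
    ultimately show False using small_multiple_contradiction[OF V hyp(1)] hyp(4) by blast
  qed
  have E: "(y + 1) ^ s - y ^ s - 1 = 0" using t by (simp add: trinomial_root_def)
  \<comment> \<open>For s = 2, 3, 5, 7 all zeros are trivial; the exponents 4, 6, 8, 9, 10 use the
    primes 2, 3, 2, 3, 5.\<close>
  consider "s = 2" | "s = 3" | "s = 4" | "s = 5" | "s = 6" | "s = 7" | "s = 8" | "s = 9" | "s = 10" using s by linarith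
  then show False
  proof cases
    case 1
    have "2 * y = (y + 1) ^ 2 - y ^ 2 - 1" by (simp add: power_numeral_reduce algebra_simps)
    then show False using E y by (simp add: 1)
  next
    case 2
    have "3 * (y * (y + 1)) = (y + 1) ^ 3 - y ^ 3 - 1" by (simp add: power_numeral_reduce algebra_simps)
    then show False using E y by (simp add: 2)
  next
    case 3
    have "(2 * y) * (of_nat 3 * (y ^ 1 * (y + 1) ^ 0) - of_nat 2 * poly (of_int_poly [:-1, 0, -1:]) y) = (y + 1) ^ 4 - y ^ 4 - 1"
      by (simp add: power_numeral_reduce algebra_simps)
    then have *: "(2 * y) * (of_nat 3 * (y ^ 1 * (y + 1) ^ 0) - of_nat 2 * poly (of_int_poly [:-1, 0, -1:]) y) = 0"
      using E by (simp only: 3)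
    show False by (rule key[OF _ *]) (use y in simp_all)
  next
    case 4
    have "5 * (y * (y + 1) * (y\<^sup>2 + y + 1)) = (y + 1) ^ 5 - y ^ 5 - 1" by (simp add: power_numeral_reduce algebra_simps)
    then show False using E y by (simp add: 4)
  next
    case 5
    have "(y) * (of_nat 20 * (y ^ 2 * (y + 1) ^ 0) - of_nat 3 * poly (of_int_poly [:-2, -5, 0, -5, -2:]) y) = (y + 1) ^ 6 - y ^ 6 - 1"
      by (simp add: power_numeral_reduce algebra_simps)
    then have *: "(y) * (of_nat 20 * (y ^ 2 * (y + 1) ^ 0) - of_nat 3 * poly (of_int_poly [:-2, -5, 0, -5, -2:]) y) = 0"
      using E by (simp only: 5)
    show False by (rule key[OF _ *]) (use y in simp_all)
  next
    case 6
    have "7 * (y * (y + 1) * (y\<^sup>2 + y + 1)\<^sup>2) = (y + 1) ^ 7 - y ^ 7 - 1" by (simp add: power_numeral_reduce algebra_simps)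
    then show False using E y by (simp add: 6)
  next
    case 7
    have "(2 * y) * (of_nat 35 * (y ^ 3 * (y + 1) ^ 0) - of_nat 2 * poly (of_int_poly [:-2, -7, -14, 0, -14, -7, -2:]) y) = (y + 1) ^ 8 - y ^ 8 - 1"
      by (simp add: power_numeral_reduce algebra_simps)
    then have *: "(2 * y) * (of_nat 35 * (y ^ 3 * (y + 1) ^ 0) - of_nat 2 * poly (of_int_poly [:-2, -7, -14, 0, -14, -7, -2:]) y) = 0"
      using E by (simp only: 7)
    show False by (rule key[OF _ *]) (use y in simp_all)
  next
    case 8
    \<comment> \<open>After removal of 3 y two terms survive modulo 3; they combine because 1 + y^3
      is congruent to (1 + y)^3.\<close>
    have "(3 * y) * (of_nat 28 * (y ^ 2 * (y + 1) ^ 3) - of_nat 3 * poly (of_int_poly [:-1, -4, 0, 14, 14, 0, -4, -1:]) y) = (y + 1) ^ 9 - y ^ 9 - 1"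
      by (simp add: power_numeral_reduce algebra_simps)
    then have *: "(3 * y) * (of_nat 28 * (y ^ 2 * (y + 1) ^ 3) - of_nat 3 * poly (of_int_poly [:-1, -4, 0, 14, 14, 0, -4, -1:]) y) = 0"
      using E by (simp only: 8)
    show False by (rule key[OF _ *]) (use y in simp_all)
  next
    case 9
    have "(y) * (of_nat 252 * (y ^ 4 * (y + 1) ^ 0) - of_nat 5 * poly (of_int_poly [:-2, -9, -24, -42, 0, -42, -24, -9, -2:]) y) = (y + 1) ^ 10 - y ^ 10 - 1"
      by (simp add: power_numeral_reduce algebra_simps)
    then have *: "(y) * (of_nat 252 * (y ^ 4 * (y + 1) ^ 0) - of_nat 5 * poly (of_int_poly [:-2, -9, -24, -42, 0, -42, -24, -9, -2:]) y) = 0"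
      using E by (simp only: 9)
    show False by (rule key[OF _ *]) (use y in simp_all)
  qed
qed

section \<open>The trinomials as integer polynomials and Beukers's theorem\<close>

definition trinomial_poly :: "nat \<Rightarrow> int poly" where
  "trinomial_poly n = [:1, 1:] ^ n - [:0, 1:] ^ n - 1"

lemma poly_trinomial_poly: "poly (of_int_poly (trinomial_poly n)) y = (y + 1 :: complex) ^ n - y ^ n - 1"
  by (simp add: trinomial_poly_def hom_distribs poly_power add.commute)

lemma trinomial_poly_nonzero: assumes "n > 1" shows "trinomial_poly n \<noteq> 0"
proof
  assume "trinomial_poly n = 0"
  then have "poly (trinomial_poly n) 1 = 0" by simp
  then have "(2::int) ^ n = 2 ^ 1" by (simp add: trinomial_poly_def poly_power)
  then show False using assms power_inject_exp[of "2::int" n 1] by simp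
qed

theorem beukers_common_roots:
  assumes rs: "1 < s" "s < r" and s: "trinomial_root s y" and r: "trinomial_root r y"
  shows "\<not> nontrivial y"
proof
  assume nt: "nontrivial y"
  have root: "trinomial_root n z \<longleftrightarrow> poly (of_int_poly (trinomial_poly n)) z = 0" for n z
    by (simp add: poly_trinomial_poly trinomial_root_def diff_diff_eq)
  obtain G :: "int poly" and ys where G: "Polynomial.content G = 1" "y \<in> set ys"
      "of_int_poly G = smult (of_int (lead_coeff G)) (\<Prod>z\<leftarrow>ys. [:- z, 1 :: complex:])"
    and conj: "\<And>U z z'. z \<in> set ys \<Longrightarrow> z' \<in> set ys \<Longrightarrow> poly (of_int_poly U) z = 0 \<Longrightarrow> poly (of_int_poly U) z' = 0"
    using conjugates_exist[OF trinomial_poly_nonzero[OF rs(1)], of y] s unfolding root by blast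
  have c: "is_conjugates G ys" using G by (auto simp: is_conjugates_def)
  have s': "trinomial_root s z" and r': "trinomial_root r z" if "z \<in> set ys" for z
    using conj[OF G(2) that] s r unfolding root by blast+
  have nt': "nontrivial z" if z: "z \<in> set ys" for z
    using conj[OF z G(2), of "[:0, 1:]"] conj[OF z G(2), of "[:1, 1:]"] conj[OF z G(2), of "[:1, 1, 1:]"] nt
    by (auto simp: nontrivial_def power2_eq_square algebra_simps eq_neg_iff_add_eq_0)
  show False
  proof (cases "11 \<le> s")
    case True
    show False by (rule no_unit_conjugates[OF c nt' s' r' conj True rs(2)])
  next
    case False
    show False
    proof (rule no_small_unit_root[OF s nt rs(1)])
      show "s \<le> 10" using False by simp
      fix p and V :: "complex set" assume V: "prime p" "valuation_ring V" "of_nat p \<in> max_ideal V"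
      show "y \<in> V \<and> y \<notin> max_ideal V \<and> y + 1 \<notin> max_ideal V"
        by (rule conjugates_units[OF c nt' s' r' rs V(2,3,1) G(2)])
    qed
  qed
qed

section \<open>Counting primes\<close>

definition trivial_poly :: "int poly" where
  "trivial_poly = [:0, 1:] * [:1, 1:] * [:1, 1, 1:]"

lemma poly_trivial_poly: "poly trivial_poly y = y * (y + 1) * (y\<^sup>2 + y + 1)"
  by (simp add: trivial_poly_def power2_eq_square algebra_simps)

lemma monic_division:
  fixes f g :: "int poly"
  assumes "lead_coeff g = 1"
  shows "\<exists>q r. f = g * q + r \<and> (r = 0 \<or> degree r < degree g)"
proof -
  obtain q r where qr: "pseudo_divmod f g = (q, r)" by force
  have "g \<noteq> 0" using assms by auto
  from pseudo_divmod[OF this qr] assms show ?thesis by auto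
qed

lemma trivial_factor:
  fixes f :: "int poly"
  assumes z: "poly (of_int_poly f) z = (0::complex)" "\<not> nontrivial z"
  shows "\<exists>g. g dvd f \<and> g dvd trivial_poly \<and> degree g > 0"
proof -
  have lin: "[:- c, 1:] dvd f" if "poly (of_int_poly f) (of_int c) = (0::complex)" for c
  proof -
    have "poly f c = 0" using that by simp
    then show ?thesis by (simp only: poly_eq_0_iff_dvd)
  qed
  consider "z = 0" | "z = -1" | "z\<^sup>2 + z + 1 = 0" using z(2) by (auto simp: nontrivial_def)
  then show ?thesis
  proof cases
    case 1
    then have "[:0, 1:] dvd f" using lin[of 0] z(1) by simp
    moreover have "[:0, 1:] dvd trivial_poly" unfolding trivial_poly_def by (intro dvd_mult2 dvd_refl)
    ultimately show ?thesis by (intro exI[of _ "[:0, 1:]"]) simp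
  next
    case 2
    then have "[:1, 1:] dvd f" using lin[of "-1"] z(1) by simp
    moreover have "[:1, 1:] dvd trivial_poly" unfolding trivial_poly_def by (intro dvd_mult2 dvd_mult dvd_refl)
    ultimately show ?thesis by (intro exI[of _ "[:1, 1:]"]) simp
  next
    case 3
    let ?g = "[:1, 1, 1 :: int:]"
    obtain q r where qr: "f = ?g * q + r" "r = 0 \<or> degree r < degree ?g"
      using monic_division[of ?g f] by auto
    have "r = 0"
    proof (rule ccontr)
      assume "r \<noteq> 0"
      then have "degree r \<le> 1" using qr(2) by simp
      then have "r = [:coeff r 0, coeff r 1:]"
        by (intro poly_eqI) (auto simp: coeff_pCons coeff_eq_0 split: nat.split)
      then obtain a b where ab: "r = [:a, b:]" by blast
      have "poly (of_int_poly ?g) z = 0" using 3 by (simp add: power2_eq_square algebra_simps)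
      moreover have "of_int_poly f = (of_int_poly ?g * of_int_poly q + of_int_poly r :: complex poly)"
        unfolding qr(1) of_int_poly_hom.hom_add of_int_poly_hom.hom_mult ..
      ultimately have "poly (of_int_poly r) z = 0"
        using z(1) by (simp only: poly_add poly_mult mult_zero_left add_0_left)
      moreover have "of_int_poly r = [:of_int a, of_int b :: complex:]"
        unfolding ab by (rule poly_eqI) (simp add: coeff_pCons split: nat.split)
      ultimately have e: "of_int a + of_int b * z = 0" by (simp add: mult.commute)
      \<comment> \<open>The quadratic is positive on the real line; for z not real, a + b z = 0
        forces a = b = 0.\<close>
      have "Im z \<noteq> 0"
      proof
        assume "Im z = 0"
        then have "z = of_real (Re z)" by (simp add: complex_eq_iff)
        then have "of_real ((Re z)\<^sup>2 + Re z + 1) = (0::complex)" using 3 by (metis of_real_add of_real_power of_real_1)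
        then have "(Re z)\<^sup>2 + Re z + 1 = 0" by (simp only: of_real_eq_0_iff)
        moreover have "4 * (x\<^sup>2 + x + 1) = (2 * x + 1)\<^sup>2 + 3" for x :: real by (simp add: power2_eq_square algebra_simps)
        ultimately show False using zero_le_power2[of "2 * Re z + 1"] by (metis add_nonneg_pos less_irrefl mult_zero_right zero_less_numeral)
      qed
      moreover have "real_of_int b * Im z = 0" using arg_cong[OF e, of Im] by simp
      ultimately have "b = 0" by simp
      then have "a = 0" using e by simp
      then show False using ab \<open>b = 0\<close> \<open>r \<noteq> 0\<close> by simp
    qed
    then have "f = ?g * q" using qr(1) by (simp only: add_0_right)
    then have "?g dvd f" by (rule dvdI)
    moreover have "?g dvd trivial_poly" unfolding trivial_poly_def by (rule dvd_triv_right)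
    ultimately show ?thesis by (intro exI[of _ ?g]) simp
  qed
qed

text \<open>Both divisibilities hold in Z[y], so a zero of f modulo a prime at which
  \<open>trivial_poly\<close> does not vanish is a zero of A modulo that prime.\<close>

lemma nontrivial_part:
  fixes f :: "int poly"
  assumes "f \<noteq> 0"
  shows "\<exists>A k. A dvd f \<and> f dvd trivial_poly ^ k * A \<and> (\<forall>z. poly (of_int_poly A) z = (0::complex) \<longrightarrow> nontrivial z)"
  using assms
proof (induction "degree f" arbitrary: f rule: less_induct)
  case less
  show ?case
  proof (cases "\<forall>z. poly (of_int_poly f) z = (0::complex) \<longrightarrow> nontrivial z")
    case True
    then show ?thesis by (intro exI[of _ f] exI[of _ 0]) simp
  next
    case False
    then obtain g where g: "g dvd f" "g dvd trivial_poly" "degree g > 0" using trivial_factor by blast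
    obtain h where h: "f = g * h" using g(1) by (elim dvdE)
    have "h \<noteq> 0" "g \<noteq> 0" using less.prems h by auto
    then have "degree h < degree f" using g(3) by (simp add: h degree_mult_eq)
    then obtain A k where A: "A dvd h" "h dvd trivial_poly ^ k * A"
        "\<forall>z. poly (of_int_poly A) z = (0::complex) \<longrightarrow> nontrivial z"
      using less.hyps[OF _ \<open>h \<noteq> 0\<close>] by blast
    have "A dvd f" using A(1) by (simp add: h)
    moreover have "f dvd trivial_poly ^ Suc k * A"
      using mult_dvd_mono[OF g(2) A(2)] by (simp add: h mult.assoc)
    ultimately show ?thesis using A(3) by blast
  qed
qed

lemma poly_diff_in_max_ideal:
  fixes V :: "complex set" and U :: "int poly"
  assumes V: "valuation_ring V" and a: "a \<in> V" and d: "of_int b - a \<in> max_ideal V"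
  shows "of_int (poly U b) - poly (of_int_poly U) a \<in> max_ideal V"
proof (induction U)
  case 0 then show ?case by (simp add: zero_in_max_ideal[OF V])
next
  case (pCons c U)
  have Ua: "of_int (poly U b) \<in> V" by (rule is_subring_of_int[OF valuation_ring_subring[OF V]])
  have "of_int (poly (pCons c U) b) - poly (of_int_poly (pCons c U)) a
      = (of_int b - a) * of_int (poly U b) + a * (of_int (poly U b) - poly (of_int_poly U) a)"
  proof -
    have "of_int_poly (pCons c U) = pCons (of_int c :: complex) (of_int_poly U)"
      by (rule poly_eqI) (simp add: coeff_pCons split: nat.split)
    then show ?thesis by (simp add: algebra_simps)
  qed
  then show ?case
    using max_ideal_add[OF V max_ideal_mult[OF V d Ua] max_ideal_mult'[OF V a pCons.IH]] by simp
qed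

lemma prod_list_in_max_ideal:
  assumes V: "valuation_ring V" and "\<And>y. y \<in> set ys \<Longrightarrow> f y \<in> V" and a: "a \<in> set ys" "f a \<in> max_ideal V"
  shows "(\<Prod>y\<leftarrow>ys. f y) \<in> max_ideal V"
  using assms(2) a
proof (induction ys)
  case (Cons x xs)
  have xs: "(\<Prod>y\<leftarrow>xs. f y) \<in> V" using Cons.prems(1) by (intro is_subring_prod_list valuation_ring_subring V) auto
  show ?case
  proof (cases "a = x")
    case True then show ?thesis using max_ideal_mult[OF V _ xs] Cons.prems by simp
  next
    case False
    then have "(\<Prod>y\<leftarrow>xs. f y) \<in> max_ideal V" using Cons by auto
    then show ?thesis using max_ideal_mult'[OF V] Cons.prems(1)[of x] by simp
  qed
qed simp

text \<open>The norm below is the resultant of \<open>A\<close> and \<open>U\<close> up to sign.\<close>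

lemma prime_dvd_norm_of_common_root:
  fixes A U :: "int poly"
  assumes A: "Polynomial.content A = 1" "of_int_poly A = smult (of_int (lead_coeff A)) (\<Prod>z\<leftarrow>ys. [:- z, 1 :: complex:])"
    and U: "degree U \<le> n" and p: "prime p" and b: "int p dvd poly A b" "int p dvd poly U b"
    and Q: "of_int Q = of_int (lead_coeff A) ^ n * (\<Prod>y\<leftarrow>ys. poly (of_int_poly U) y)"
  shows "int p dvd Q"
proof -
  obtain V :: "complex set" where V: "valuation_ring V" "of_nat p \<in> max_ideal V"
    using prime_valuation_ring_exists[OF p] by blast
  note iff = of_int_in_max_ideal_iff[OF V p]
  note gauss = gauss_large_roots[OF V(1) A(2) content_one_primitive_over[OF A(1) p V]]
  define u where "u = of_int (lead_coeff A) * (\<Prod>y\<leftarrow>ys. large_part V y)"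
  have u: "u \<in> V" "u \<notin> max_ideal V" using gauss by (auto simp: u_def)
  \<comment> \<open>Linear factors normalised at the place. For y outside V the value is -1 up to
    the maximal ideal, so a non-unit product points to an integral root a congruent to b.\<close>
  define g where "g = (\<lambda>y :: complex. (of_int b - y) / large_part V y)"
  have bV: "(of_int b :: complex) \<in> V" by (rule is_subring_of_int[OF valuation_ring_subring[OF V(1)]])
  have big: "g y = of_int b * inverse y - 1" "inverse y \<in> max_ideal V" if "y \<notin> V" for y
  proof -
    have "y \<noteq> 0" using that valuation_ringD(2)[OF V(1)] by auto
    then show "g y = of_int b * inverse y - 1" using that by (simp add: g_def large_part_def field_simps)
    show "inverse y \<in> max_ideal V" by (rule inverse_in_max_ideal[OF V(1) that])
  qed
  have gV: "g y \<in> V" for y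
  proof (cases "y \<in> V")
    case True then show ?thesis using valuation_ringD(4)[OF V(1) bV] by (simp add: g_def large_part_def)
  next
    case False
    show ?thesis unfolding big(1)[OF False]
      by (intro valuation_ringD(4)[OF V(1)] valuation_ringD(5)[OF V(1)] bV max_ideal_subset[OF big(2)[OF False]] valuation_ringD(1)[OF V(1)])
  qed
  have "of_int (poly A b) = poly (of_int_poly A) (of_int b :: complex)" by simp
  also have "\<dots> = of_int (lead_coeff A) * (\<Prod>y\<leftarrow>ys. of_int b - y)" by (subst A(2)) (rule poly_smult_prod_roots)
  also have "\<dots> = of_int (lead_coeff A) * (\<Prod>y\<leftarrow>ys. large_part V y * g y)"
    using large_part_nonzero[OF V(1)] by (simp add: g_def)
  also have "\<dots> = u * (\<Prod>y\<leftarrow>ys. g y)" by (simp add: prod_list_mult u_def)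
  finally have "u * (\<Prod>y\<leftarrow>ys. g y) \<in> max_ideal V" using iff[THEN iffD2, OF b(1)] by simp
  moreover have "(\<Prod>y\<leftarrow>ys. g y) \<in> V" by (intro is_subring_prod_list valuation_ring_subring V gV)
  ultimately have "(\<Prod>y\<leftarrow>ys. g y) \<in> max_ideal V" using max_ideal_prime[OF V(1) u(1)] u(2) by blast
  then obtain a where a: "a \<in> set ys" "g a \<in> max_ideal V" using unit_prod_list[OF V(1), of ys g] gV by blast
  have aV: "a \<in> V"
  proof (rule ccontr)
    assume n: "a \<notin> V"
    have "g a - of_int b * inverse a \<in> max_ideal V" by (intro max_ideal_diff[OF V(1)] a max_ideal_mult'[OF V(1) bV big(2)[OF n]])
    then have "- 1 \<in> max_ideal V" by (simp add: big(1)[OF n])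
    then show False using max_ideal_uminus[OF V(1)] one_notin_max_ideal[OF V(1)] by fastforce
  qed
  then have "of_int b - a \<in> max_ideal V" using a(2) by (simp add: g_def large_part_def)
  from max_ideal_diff[OF V(1) iff[THEN iffD2, OF b(2)] poly_diff_in_max_ideal[OF V(1) aV this, of U]]
  have "of_int (poly U b) - (of_int (poly U b) - poly (of_int_poly U) a) \<in> max_ideal V" .
  then have Ua: "poly (of_int_poly U) a \<in> max_ideal V" by simp
  obtain w where w: "\<And>y. w y \<in> V" "\<And>y. poly (of_int_poly U) y = large_part V y ^ n * w y"
    using poly_large_part[OF V(1) U] by metis
  have "w a \<in> max_ideal V" using Ua w(2)[of a] aV by (simp add: large_part_def)
  then have "(\<Prod>y\<leftarrow>ys. w y) \<in> max_ideal V" by (rule prod_list_in_max_ideal[OF V(1) w(1) a(1)])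
  then have "u ^ n * (\<Prod>y\<leftarrow>ys. w y) \<in> max_ideal V" by (rule max_ideal_mult'[OF V(1) valuation_ringD(7)[OF V(1) u(1)]])
  moreover have "of_int Q = u ^ n * (\<Prod>y\<leftarrow>ys. w y)"
    unfolding Q w(2) by (simp add: u_def prod_list_mult prod_list_pow power_mult_distrib)
  ultimately have "of_int Q \<in> max_ideal V" by simp
  then show ?thesis by (rule iff[THEN iffD1])
qed

section \<open>The size of the integer that obstructs nontrivial common zeros\<close>

lemma coeff_trinomial_poly: "n > 1 \<Longrightarrow> coeff (trinomial_poly n) k = (if k = 0 \<or> k \<ge> n then 0 else int (n choose k))"
proof -
  assume n: "n > 1"
  have "coeff ([:0, 1:] ^ n :: int poly) k = (if k = n then 1 else 0)"
  proof -
    have "[:0, 1:] ^ n = (monom 1 n :: int poly)" by (simp add: monom_altdef)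
    then show ?thesis by simp
  qed
  moreover have "coeff ([:1, 1:] ^ n :: int poly) k = int (n choose k)"
  proof (cases "k \<le> n")
    case True
    show ?thesis unfolding coeff_linear_poly_power[OF True] by simp
  next
    case False
    have "degree ([:1, 1:] ^ n :: int poly) \<le> n" using degree_power_le[of "[:1, 1 :: int:]" n] by simp
    then show ?thesis using False by (simp add: coeff_eq_0 binomial_eq_0)
  qed
  ultimately show ?thesis using n by (auto simp: trinomial_poly_def coeff_1 binomial_eq_0)
qed

lemma degree_trinomial_poly: "n > 1 \<Longrightarrow> degree (trinomial_poly n) \<le> n"
  by (rule degree_le) (simp add: coeff_trinomial_poly)

text \<open>By Landau the Euclidean norm of the coefficients is an upper bound; the sum of squares
  is at most the bound 2^n for single coefficients times their sum, again at most 2^n.\<close>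

lemma mahler_measure_trinomial_poly:
  assumes n: "n > 1"
  shows "mahler_measure (trinomial_poly n) \<le> 2 ^ n"
proof -
  let ?c = "coeff (trinomial_poly n)"
  have c: "0 \<le> ?c k" "?c k \<le> int (n choose k)" for k using coeff_trinomial_poly[OF n, of k] by auto
  have ck: "?c k \<le> 2 ^ n" for k
  proof -
    have "int (n choose k) \<le> int (2 ^ n)" by (simp only: of_nat_le_iff binomial_le_pow2)
    also have "int (2 ^ n) = 2 ^ n" by simp
    finally show ?thesis using c(2)[of k] by linarith
  qed
  have "(\<Sum>a\<leftarrow>coeffs (trinomial_poly n). a * a) = (\<Sum>k\<le>degree (trinomial_poly n). ?c k * ?c k)"
    using trinomial_poly_nonzero[OF n]
    by (simp add: coeffs_def o_def sum_list_distinct_conv_sum_set[symmetric] interv_sum_list_conv_sum_set_nat atLeast0AtMost flip: lessThan_Suc_atMost atLeast0LessThan del: upt_Suc)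
  also have "\<dots> \<le> (\<Sum>k\<le>n. ?c k * ?c k)"
    using degree_trinomial_poly[OF n] by (intro sum_mono2) (auto simp: c)
  also have "\<dots> \<le> (\<Sum>k\<le>n. 2 ^ n * int (n choose k))" by (intro sum_mono mult_mono c ck) auto
  also have "\<dots> = 2 ^ n * int (\<Sum>k\<le>n. n choose k)" by (simp add: sum_distrib_left)
  also have "\<dots> = (2 ^ n)\<^sup>2" by (simp add: choose_row_sum power2_eq_square)
  finally have "real_of_int (\<Sum>a\<leftarrow>coeffs (trinomial_poly n). a * a) \<le> (2 ^ n)\<^sup>2" by (metis of_int_le_iff of_int_numeral of_int_power)
  then have "sqrt (real_of_int (\<Sum>a\<leftarrow>coeffs (trinomial_poly n). a * a)) \<le> 2 ^ n" by (intro real_le_lsqrt) auto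
  then show ?thesis using Landau_inequality_mahler_measure order_trans by blast
qed

text \<open>The integer is s times a norm of \<open>trinomial_poly r\<close> over the zeros of the
  nontrivial part of \<open>trinomial_poly s\<close>, nonzero by Beukers's theorem. The factor s
  covers the primes dividing the content, which divides the linear coefficient s.\<close>

theorem common_zero_obstruction:
  assumes rs: "1 < s" "s < r"
  shows "\<exists>Q :: int. Q \<noteq> 0 \<and> \<bar>real_of_int Q\<bar> \<le> 24 ^ (r * s) \<and>
    (\<forall>p b. prime p \<longrightarrow> int p dvd poly (trinomial_poly s) b \<longrightarrow> int p dvd poly (trinomial_poly r) b \<longrightarrow>
       \<not> int p dvd poly trivial_poly b \<longrightarrow> int p dvd Q)"
proof -
  let ?F = "trinomial_poly s" and ?U = "trinomial_poly r"
  have F0: "?F \<noteq> 0" by (rule trinomial_poly_nonzero[OF rs(1)])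
  have r1: "1 < r" using rs by simp
  define c where "c = Polynomial.content ?F"
  define F' where "F' = primitive_part ?F"
  have F: "?F = smult c F'" by (simp add: c_def F'_def)
  have F'0: "F' \<noteq> 0" "Polynomial.content F' = 1" using F0 by (auto simp: F'_def)
  have "c dvd coeff ?F 1" unfolding c_def by (rule content_dvd_coeff)
  then have cs: "c dvd int s" using rs by (simp add: coeff_trinomial_poly)
  obtain A k where A: "A dvd F'" "F' dvd trivial_poly ^ k * A" "\<forall>z. poly (of_int_poly A) z = (0::complex) \<longrightarrow> nontrivial z"
    using nontrivial_part[OF F'0(1)] by blast
  have A0: "A \<noteq> 0" using A(1) F'0(1) by auto
  have "Polynomial.content A dvd 1" using content_dvd_contentI[OF A(1)] F'0(2) by simp
  then have cA: "Polynomial.content A = 1" using content_ge_0_int[of A] by (simp add: zdvd1_eq)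
  obtain ys where "smult (coeff (of_int_poly A) (degree (of_int_poly A :: complex poly))) (\<Prod>z\<leftarrow>ys. [:- z, 1:])
      = (of_int_poly A :: complex poly)" and len: "length ys = degree (of_int_poly A :: complex poly)"
    using fundamental_theorem_algebra_factorized by blast
  then have ys: "of_int_poly A = smult (of_int (lead_coeff A)) (\<Prod>z\<leftarrow>ys. [:- z, 1 :: complex:])" by simp
  have root: "poly (of_int_poly A) z = 0" if "z \<in> set ys" for z
    unfolding ys poly_smult_prod_roots using that by (auto simp: prod_list_zero_iff)
  define q where "q = of_int (lead_coeff A) ^ r * (\<Prod>y\<leftarrow>ys. poly (of_int_poly ?U) y)"
  have "q \<in> \<int>" unfolding q_def by (rule norm_integral[OF ys cA degree_trinomial_poly[OF r1]])
  then obtain Q where Q: "of_int Q = q" by (metis Ints_cases)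
  have ts: "trinomial_root s z" if "z \<in> set ys" for z
  proof -
    have "A dvd ?F" using A(1) by (simp add: F dvd_smult)
    then obtain B where "?F = A * B" by (elim dvdE)
    then have "poly (of_int_poly ?F) z = 0" using root[OF that] by (simp add: hom_distribs)
    then show ?thesis by (simp add: poly_trinomial_poly trinomial_root_def diff_diff_eq)
  qed
  have "poly (of_int_poly ?U) z \<noteq> 0" if "z \<in> set ys" for z
  proof
    assume "poly (of_int_poly ?U) z = 0"
    then have "trinomial_root r z" by (simp add: poly_trinomial_poly trinomial_root_def diff_diff_eq)
    then show False using beukers_common_roots[OF rs ts[OF that]] A(3) root[OF that] by blast
  qed
  then have "q \<noteq> 0" using A0 by (auto simp: q_def prod_list_zero_iff)
  then have Q0: "Q \<noteq> 0" using Q by auto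
  have deg: "length ys \<le> s"
  proof -
    have "degree A \<le> degree F'" using A(1) F'0(1) by (rule dvd_imp_degree_le)
    also have "\<dots> \<le> s" using degree_trinomial_poly[OF rs(1)] by (simp add: F'_def)
    finally show ?thesis using len by simp
  qed
  define l where "l = \<bar>real_of_int (lead_coeff A)\<bar>"
  define m where "m = (\<lambda>y. max 1 (cmod y))"
  have l0: "0 \<le> l" by (simp add: l_def)
  have m1: "1 \<le> m y" for y by (simp add: m_def)
  have mah: "l * (\<Prod>y\<leftarrow>ys. m y) \<le> 2 ^ s"
  proof -
    have "A dvd ?F" using A(1) by (simp add: F dvd_smult)
    then have "mahler_measure A \<le> mahler_measure ?F" by (rule mahler_measure_dvd[OF F0])
    also have "\<dots> \<le> 2 ^ s" by (rule mahler_measure_trinomial_poly[OF rs(1)])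
    also have "mahler_measure A = l * (\<Prod>y\<leftarrow>ys. m y)"
      unfolding mahler_measure_def ys mahler_measure_poly_explicit by (simp add: l_def m_def)
    finally show ?thesis .
  qed
  have Ub: "cmod (poly (of_int_poly ?U) y) \<le> 3 * 2 ^ r * m y ^ r" for y
  proof -
    have y1: "cmod (y + 1) \<le> 2 * m y" using norm_triangle_ineq[of y 1] by (simp add: m_def)
    have "cmod (poly (of_int_poly ?U) y) \<le> cmod (y + 1) ^ r + cmod y ^ r + 1"
      unfolding poly_trinomial_poly
      using norm_triangle_ineq4[of "(y + 1) ^ r - y ^ r" 1] norm_triangle_ineq4[of "(y + 1) ^ r" "y ^ r"]
      by (simp add: norm_power)
    also have "\<dots> \<le> (2 * m y) ^ r + (2 * m y) ^ r + (2 * m y) ^ r"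
      using y1 m1[of y] by (intro add_mono power_mono one_le_power) (auto simp: m_def)
    finally show ?thesis by (simp add: power_mult_distrib mult_ac)
  qed
  have big: "(1::real) \<le> 3 * 2 ^ r" using one_le_power[of "2::real" r] by linarith
  have "\<bar>real_of_int Q\<bar> = cmod q" unfolding Q[symmetric] by simp
  also have "\<dots> = l ^ r * (\<Prod>y\<leftarrow>ys. cmod (poly (of_int_poly ?U) y))"
    by (simp add: q_def norm_mult norm_power norm_prod_list l_def)
  also have "\<dots> \<le> l ^ r * (\<Prod>y\<leftarrow>ys. 3 * 2 ^ r * m y ^ r)"
    using l0 Ub by (intro mult_left_mono prod_list_le[THEN conjunct2]) auto
  also have "\<dots> = (3 * 2 ^ r) ^ length ys * (l * (\<Prod>y\<leftarrow>ys. m y)) ^ r"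
    by (simp only: prod_list_mult prod_list_const prod_list_pow power_mult_distrib mult_ac)
  also have "\<dots> \<le> (3 * 2 ^ r) ^ s * (2 ^ s) ^ r"
    using big deg mah l0 prod_list_le[of ys "\<lambda>_. 1" m] m1
    by (intro mult_mono power_increasing power_mono mult_nonneg_nonneg) (auto simp: one_le_power prod_list_const intro: order_trans[OF zero_le_one])
  also have "\<dots> = 3 ^ s * 4 ^ (r * s)"
  proof -
    have "(2 ^ r) ^ s = (2 ^ (r * s) :: real)" "(2 ^ s) ^ r = (2 ^ (r * s) :: real)"
      by (simp_all only: mult.commute flip: power_mult)
    moreover have "(4 ^ (r * s) :: real) = 2 ^ (r * s) * 2 ^ (r * s)" by (simp flip: power_mult_distrib)
    ultimately show ?thesis by (simp only: power_mult_distrib mult.assoc)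
  qed
  finally have Qb: "\<bar>real_of_int Q\<bar> \<le> 3 ^ s * 4 ^ (r * s)" .
  define R where "R = int s * Q"
  have "R \<noteq> 0" using Q0 rs by (simp add: R_def)
  \<comment> \<open>The base 24 is 2 * 3 * 4: s <= 2^s joins 3^s, and 6^s <= 6^(rs).\<close>
  moreover have "\<bar>real_of_int R\<bar> \<le> 24 ^ (r * s)"
  proof -
    have "real s \<le> 2 ^ s" by (rule of_nat_less_two_power[THEN less_imp_le])
    then have "\<bar>real_of_int R\<bar> \<le> 2 ^ s * (3 ^ s * 4 ^ (r * s))"
      using Qb by (simp add: R_def abs_mult mult_mono)
    also have "\<dots> = 6 ^ s * 4 ^ (r * s)" by (simp flip: power_mult_distrib)
    also have "\<dots> \<le> 6 ^ (r * s) * 4 ^ (r * s)" using rs by (intro mult_right_mono power_increasing) auto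
    also have "\<dots> = 24 ^ (r * s)" by (simp flip: power_mult_distrib)
    finally show ?thesis .
  qed
  moreover have "int p dvd R"
    if p: "prime p" "int p dvd poly ?F b" "int p dvd poly ?U b" "\<not> int p dvd poly trivial_poly b" for p b
  proof (cases "int p dvd c")
    case True
    then have "int p dvd int s" using cs by (rule dvd_trans)
    then show ?thesis by (simp add: R_def)
  next
    case False
    have pp: "prime (int p)" using p(1) by simp
    have "poly ?F b = c * poly F' b" by (subst F) simp
    then have pF: "int p dvd poly F' b" using p(2) False pp by (simp add: prime_dvd_mult_iff)
    obtain B where "trivial_poly ^ k * A = F' * B" using A(2) by (elim dvdE)
    then have "poly trivial_poly b ^ k * poly A b = poly F' b * poly B b"
      by (metis poly_mult poly_power)
    then have "int p dvd poly trivial_poly b ^ k * poly A b" using pF by simp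
    then have "int p dvd poly A b" using p(4) pp prime_dvd_power[of "int p"] by (auto simp: prime_dvd_mult_iff)
    then have "int p dvd Q"
      by (rule prime_dvd_norm_of_common_root[OF cA ys degree_trinomial_poly[OF r1] p(1) _ p(3) Q[unfolded q_def]])
    then show ?thesis by (simp add: R_def)
  qed
  ultimately show ?thesis by blast
qed

section \<open>Solutions modulo p\<close>

lemma sol_set_subset:
  assumes p: "prime p" and xy: "(x, y) \<in> sol_set p r s"
  shows "0 \<le> y" "y < int p" "x = (y + 1) mod int p" "\<not> int p dvd y * (y + 1)"
    "int p dvd poly (trinomial_poly r) y" "int p dvd poly (trinomial_poly s) y"
proof -
  have p1: "int p > 1" using prime_gt_1_nat[OF p] by simp
  interpret residues "int p" "residue_ring (int p)" by unfold_locales (use p1 in auto)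
  have *: "x \<in> {0..int p - 1} - {0}" "y \<in> {0..int p - 1} - {0}" "x = (y + 1) mod int p"
    "x ^ r mod int p = (y ^ r mod int p + 1) mod int p" "x ^ s mod int p = (y ^ s mod int p + 1) mod int p"
    using xy pow_cong[of x r] pow_cong[of y r] pow_cong[of x s] pow_cong[of y s]
    by (auto simp: sol_set_def Let_def res_carrier_eq res_zero_eq res_one_eq res_add_eq)
  show "0 \<le> y" "y < int p" "x = (y + 1) mod int p" using * by auto
  have "\<not> int p dvd y" using * zdvd_imp_le[of "int p" y] by auto
  moreover have "\<not> int p dvd y + 1"
  proof
    assume "int p dvd y + 1"
    then have "x = 0" unfolding *(3) by simp
    then show False using *(1) by simp
  qed
  ultimately show "\<not> int p dvd y * (y + 1)" using p by (simp add: prime_dvd_mult_iff)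
  have e: "poly (trinomial_poly n) y = (y + 1) ^ n - (y ^ n + 1)" for n by (simp add: trinomial_poly_def poly_power add.commute)
  have "(y + 1) ^ n mod int p = (y ^ n + 1) mod int p"
    if "x ^ n mod int p = (y ^ n mod int p + 1) mod int p" for n
    using that unfolding *(3) by (simp add: mod_simps power_mod)
  then show "int p dvd poly (trinomial_poly r) y" "int p dvd poly (trinomial_poly s) y"
    using *(4,5) unfolding e by (auto simp: mod_eq_dvd_iff)
qed

lemma quadratic_roots_mod_prime:
  assumes "prime p"
  shows "card {y \<in> {0..<int p}. int p dvd y\<^sup>2 + y + 1} \<le> 2"
proof (cases "{y \<in> {0..<int p}. int p dvd y\<^sup>2 + y + 1} = {}")
  case False
  then obtain a where a: "a \<in> {0..<int p}" "int p dvd a\<^sup>2 + a + 1" by blast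
  have "{y \<in> {0..<int p}. int p dvd y\<^sup>2 + y + 1} \<subseteq> {a, (- 1 - a) mod int p}"
  proof
    fix y assume y: "y \<in> {y \<in> {0..<int p}. int p dvd y\<^sup>2 + y + 1}"
    have "(y\<^sup>2 + y + 1) - (a\<^sup>2 + a + 1) = (y - a) * (y - (- 1 - a))" by (simp add: power2_eq_square algebra_simps)
    then have "int p dvd (y - a) * (y - (- 1 - a))" using y a(2) dvd_diff by (metis (no_types, lifting) mem_Collect_eq)
    then have "int p dvd y - a \<or> int p dvd y - (- 1 - a)" using assms by (simp add: prime_dvd_mult_iff)
    then have "y mod int p = a mod int p \<or> y mod int p = (- 1 - a) mod int p" by (simp only: mod_eq_dvd_iff)
    then show "y \<in> {a, (- 1 - a) mod int p}" using y a(1) by auto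
  qed
  then have "card {y \<in> {0..<int p}. int p dvd y\<^sup>2 + y + 1} \<le> card {a, (- 1 - a) mod int p}" by (intro card_mono) auto
  also have "\<dots> \<le> 2" by (simp add: card_insert_if)
  finally show ?thesis .
next
  case True
  show ?thesis unfolding True by simp
qed

text \<open>A solution is determined by y, and neither y nor y + 1 vanishes modulo p. If all
  solutions were trivial they would be roots of y^2 + y + 1, of which there are at most two.\<close>

lemma nontrivial_zero_of_many_solutions:
  assumes p: "prime p" and N: "N p r s > 4"
  shows "\<exists>b. int p dvd poly (trinomial_poly s) b \<and> int p dvd poly (trinomial_poly r) b \<and> \<not> int p dvd poly trivial_poly b"
proof (rule ccontr)
  assume contr: "\<not> ?thesis"
  have "inj_on snd (sol_set p r s)"
    using sol_set_subset(3)[OF p] by (intro inj_onI) (metis prod.collapse)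
  moreover have "snd ` sol_set p r s \<subseteq> {y \<in> {0..<int p}. int p dvd y\<^sup>2 + y + 1}"
  proof
    fix y assume "y \<in> snd ` sol_set p r s"
    then obtain x where xy: "(x, y) \<in> sol_set p r s" by force
    note y = sol_set_subset[OF p xy]
    have "int p dvd poly trivial_poly y" using contr y(5,6) by blast
    then have "int p dvd y\<^sup>2 + y + 1" using y(4) p by (simp add: poly_trivial_poly prime_dvd_mult_iff)
    then show "y \<in> {y \<in> {0..<int p}. int p dvd y\<^sup>2 + y + 1}" using y(1,2) by simp
  qed
  ultimately have "card (sol_set p r s) \<le> card {y \<in> {0..<int p}. int p dvd y\<^sup>2 + y + 1}"
    by (intro card_inj_on_le) (auto intro: finite_subset[of _ "{0..<int p}"])
  then show False using N quadratic_roots_mod_prime[OF p] by (simp add: N_def)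
qed

section \<open>The number of prime divisors\<close>

lemma prod_primes_dvd:
  fixes Q :: int
  assumes "finite S" "\<And>p. p \<in> S \<Longrightarrow> prime p \<and> int p dvd Q"
  shows "int (\<Prod>S) dvd Q"
  using assms
proof (induction S)
  case (insert p S)
  have "algebraic_semidom_class.coprime (int p) (int (\<Prod>S))"
  proof -
    have "algebraic_semidom_class.coprime p (\<Prod>S)"
      using insert by (intro prod_coprime_right) (auto intro!: primes_coprime)
    then show ?thesis by (simp only: coprime_int_iff)
  qed
  moreover have "int p dvd Q" "int (\<Prod>S) dvd Q" using insert by auto
  ultimately have "int p * int (\<Prod>S) dvd Q" by (rule divides_mult[rotated 2])
  then show ?case using insert(1,2) by simp
qed simp

text \<open>The primes are split at sqrt n. The product of those above divides Q, so there are at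
  most 2 n ln 24 / ln n of them; those below number at most sqrt n <= 2 n / ln n.\<close>

lemma card_prime_divisors_le:
  fixes Q :: int and n :: nat
  assumes n: "n \<ge> 2" and Q: "Q \<noteq> 0" "\<bar>real_of_int Q\<bar> \<le> 24 ^ n" and S: "\<And>p. p \<in> S \<Longrightarrow> prime p \<and> int p dvd Q"
  shows "finite S \<and> real (card S) \<le> (2 * ln 24 + 2) * real n / ln (real n)"
proof -
  have "S \<subseteq> {..nat \<bar>Q\<bar>}"
  proof
    fix p assume "p \<in> S"
    then have "int p \<le> \<bar>Q\<bar>" using S[of p] dvd_imp_le_int[OF Q(1), of "int p"] by simp
    then show "p \<in> {..nat \<bar>Q\<bar>}" by simp
  qed
  then have fin: "finite S" using finite_subset by blast
  define L where "L = ln (real n)"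
  have L0: "L > 0" using n by (simp add: L_def)
  define B where "B = {p \<in> S. sqrt (real n) < real p}"
  define T where "T = {p \<in> S. real p \<le> sqrt (real n)}"
  have ST: "S = T \<union> B" "T \<inter> B = {}" by (auto simp: B_def T_def)
  have "sqrt (real n) ^ card B \<le> real (\<Prod>B)"
  proof -
    have "(\<Prod>p\<in>B. sqrt (real n)) \<le> (\<Prod>p\<in>B. real p)" by (intro prod_mono) (auto simp: B_def)
    then show ?thesis by simp
  qed
  also have "real (\<Prod>B) \<le> \<bar>real_of_int Q\<bar>"
  proof -
    have "int (\<Prod>B) dvd Q" using fin S by (intro prod_primes_dvd) (auto simp: B_def)
    then have "\<bar>int (\<Prod>B)\<bar> \<le> \<bar>Q\<bar>" by (rule dvd_imp_le_int[OF Q(1)])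
    then have "real_of_int \<bar>int (\<Prod>B)\<bar> \<le> real_of_int \<bar>Q\<bar>" by (simp only: of_int_le_iff)
    then show ?thesis by simp
  qed
  also have "\<dots> \<le> 24 ^ n" by (rule Q(2))
  finally have "ln (sqrt (real n) ^ card B) \<le> ln (24 ^ n)" using n by (subst ln_le_cancel_iff) auto
  then have "real (card B) * (L / 2) \<le> real n * ln 24" using n by (simp add: ln_realpow ln_sqrt L_def)
  then have cB: "real (card B) * L \<le> 2 * ln 24 * real n" by (simp add: mult_ac)
  have "T \<subseteq> {1..nat \<lfloor>sqrt (real n)\<rfloor>}"
  proof
    fix p assume p: "p \<in> T"
    then have "prime p" using S by (simp add: T_def)
    then have "1 \<le> p" using prime_gt_0_nat[of p] by simp
    moreover have "p \<le> nat \<lfloor>sqrt (real n)\<rfloor>" using p by (intro le_nat_floor) (simp add: T_def)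
    ultimately show "p \<in> {1..nat \<lfloor>sqrt (real n)\<rfloor>}" by simp
  qed
  then have "card T \<le> nat \<lfloor>sqrt (real n)\<rfloor>" using card_mono[of "{1..nat \<lfloor>sqrt (real n)\<rfloor>}" T] by simp
  also have "real (nat \<lfloor>sqrt (real n)\<rfloor>) \<le> sqrt (real n)" by simp
  finally have "real (card T) \<le> sqrt (real n)" by simp
  moreover have "L \<le> 2 * sqrt (real n)"
  proof -
    have "ln (sqrt (real n)) \<le> sqrt (real n)" using n ln_le_minus_one[of "sqrt (real n)"] by simp
    then show ?thesis using n by (simp add: ln_sqrt L_def)
  qed
  ultimately have "real (card T) * L \<le> sqrt (real n) * (2 * sqrt (real n))" using L0 by (intro mult_mono) auto
  moreover have "sqrt (real n) * (2 * sqrt (real n)) = 2 * real n"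
    by (simp only: mult.left_commute[of _ 2] real_sqrt_mult_self abs_of_nat)
  ultimately have cT: "real (card T) * L \<le> 2 * real n" by linarith
  have "finite T" "finite B" using fin by (simp_all add: T_def B_def)
  then have "card S = card T + card B" using card_Un_disjoint[OF _ _ ST(2)] ST(1) by metis
  then have "real (card S) * L \<le> (2 * ln 24 + 2) * real n" using cB cT by (simp add: algebra_simps)
  then show ?thesis using fin L0 by (simp add: pos_le_divide_eq L_def)
qed

theorem theorem1p5:
  "\<exists>C::real. \<forall>(r::nat) (s::nat). 1 < s \<and> s < r \<longrightarrow>
     finite {p::nat. prime p \<and> N p r s > 4} \<and>
     real (card {p::nat. prime p \<and> N p r s > 4})
       \<le> C * (real r * real s) / ln (real r * real s)"
proof (intro exI allI impI)
  fix r s :: nat assume rs: "1 < s \<and> s < r"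
  obtain Q :: int where Q: "Q \<noteq> 0" "\<bar>real_of_int Q\<bar> \<le> 24 ^ (r * s)"
      "\<And>p b. prime p \<Longrightarrow> int p dvd poly (trinomial_poly s) b \<Longrightarrow> int p dvd poly (trinomial_poly r) b \<Longrightarrow>
         \<not> int p dvd poly trivial_poly b \<Longrightarrow> int p dvd Q"
    using common_zero_obstruction[of s r] rs by blast
  have rs2: "2 \<le> r * s" using rs mult_le_mono[of 1 r 2 s] by simp
  have "prime p \<and> int p dvd Q" if "p \<in> {p. prime p \<and> N p r s > 4}" for p
  proof -
    have p: "prime p" "N p r s > 4" using that by auto
    obtain b where "int p dvd poly (trinomial_poly s) b" "int p dvd poly (trinomial_poly r) b"
        "\<not> int p dvd poly trivial_poly b"
      using nontrivial_zero_of_many_solutions[OF p] by blast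
    then show ?thesis using Q(3)[OF p(1)] p(1) by blast
  qed
  then have "finite {p. prime p \<and> N p r s > 4} \<and>
      real (card {p. prime p \<and> N p r s > 4}) \<le> (2 * ln 24 + 2) * real (r * s) / ln (real (r * s))"
    by (intro card_prime_divisors_le[OF rs2 Q(1,2)])
  then show "finite {p. prime p \<and> N p r s > 4} \<and>
      real (card {p. prime p \<and> N p r s > 4}) \<le> (2 * ln 24 + 2) * (real r * real s) / ln (real r * real s)"
    by simp
qed

end
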